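(* Let $\Omega_1$ and $\Omega_2$ be r.e. infinite sets, and let $P_1\in\mathbb{P}(\Omega_1)$ and $P_2\in\mathbb{P}(\Omega_2)$ be discrete probability spaces. Let $\alpha_1\in\Omega_1^\infty$ and $\alpha_2\in\Omega_2^\infty$. Let $\ell\in\mathbb{N}$, and for each $k=1,\dots,\ell$ let $\beta_k$ be an infinite sequence over an r.e. infinite set. Suppose that $P_1$ is computable. Then $\alpha_1\times\alpha_2$ is Martin-Löf $P_1\times P_2$-random relative to $\beta_1,\dots,\beta_\ell$ if and only if $\alpha_1$ is Martin-Löf $P_1$-random relative to $\alpha_2,\beta_1,\dots,\beta_\ell$ and $\alpha_2$ is Martin-Löf $P_2$-random relative to $\beta_1,\dots,\beta_\ell$.
   Context: Alphabets and sequences. $\mathbb{N}=\{0,1,2,\dots\}$, $\mathbb{N}^+=\{1,2,3,\dots\}$. For a nonempty set $\Omega$ (alphabet), $\Omega^*$ is the set of finite strings over $\Omega$ (including the empty string $\lambda$), and $\Omega^\infty$ is the set of infinite sequences $\alpha=\alpha(1)\alpha(2)\alpha(3)\cdots$ over $\Omega$; $\alpha\upharpoonright_n$ is the string of the first $n$ elements of $\alpha$. A set $S\subset\Omega^*$ is prefix-free if no string in $S$ is a prefix of another string in $S$. For $S\subset\Omega^*$, $[S]^{\prec}=\{\alpha\in\Omega^\infty\mid \exists n\ge 0,\ \alpha\upharpoonright_n\in S\}$. An r.e. infinite set is an infinite recursively enumerable set (of finite objects usable as Turing machine inputs). Probability spaces. For a countably infinite set $\Omega$, a discrete probability space on $\Omega$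 is a function $P\colon\Omega\to\mathbb{R}$ with $P(a)\ge 0$ for all $a$ and $\sum_{a\in\Omega}P(a)=1$; $\mathbb{P}(\Omega)$ is the set of all of them. For $\sigma=\sigma_1\cdots\sigma_n\in\Omega^*$, $P(\sigma)=P(\sigma_1)\cdots P(\sigma_n)$ and $P(\lambda)=1$. The generalized Bernoulli measure $\lambda_P$ is the probability measure on the Borel $\sigma$-field of $\Omega^\infty$ (generated by the open sets $[S]^{\prec}$, $S\subset\Omega^*$) determined by $\lambda_P([\{\sigma\}]^{\prec})=P(\sigma)$ for all $\sigma\in\Omega^*$. For $\Omega$ an r.e. infinite set, $P\in\mathbb{P}(\Omega)$ is computable if there is a partial recursive function $f$ with domain exactly $\Omega\times\mathbb{N}$ and values in $\mathbb{Q}$ such that $|P(a)-f(a,k)|\le 2^{-k}$ for all $a\in\Omega$, $k\in\mathbb{N}$. No computability is assumed unless stated. Products. $P_1\times P_2\in\mathbb{P}(\Omega_1\times\Omega_2)$ is given by $(P_1\times P_2)(a_1,a_2)=P_1(a_1)P_2(a_2)$. $\alpha_1\times\alpha_2$ is the infinite sequence over $\Omega_1\times\Omega_2$ whose $k$th element is $(\alpha_1(k),\alpha_2(k))$. Relative randomness. Let $\Omega$ be an r.e. infinite set, $P\in\mathbb{P}(\Omega)$, and let $\beta_1,\dots,\beta_\ell$ be infinite sequences, each over an r.e. infinite set. A Martin-Löf $P$-test relative to $\beta_1,\dots,\beta_\ell$ is a set $\mathcal{C}\subset\mathbb{N}^+\times\Omega^*$ that is the set of inputs in $\mathbb{N}^+\times\Omega^*$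 accepted by some oracle Turing machine which may query any $(k,m)\in\{1,\dots,\ell\}\times\mathbb{N}^+$ and receives the answer $\beta_k(m)$, and such that for every $n\in\mathbb{N}^+$ the set $\mathcal{C}_n=\{\sigma\mid(n,\sigma)\in\mathcal{C}\}$ is prefix-free and $\lambda_P([\mathcal{C}_n]^{\prec})<2^{-n}$. A sequence $\alpha\in\Omega^\infty$ is Martin-Löf $P$-random relative to $\beta_1,\dots,\beta_\ell$ if for every such test there is $n\in\mathbb{N}^+$ with $\alpha\notin[\mathcal{C}_n]^{\prec}$. For $\ell=0$ this is ordinary (unrelativized) Martin-Löf $P$-randomness, defined with r.e. sets $\mathcal{C}$. *)

theory Defs
  imports "HOL-Probability.Probability" "HOL-Library.Nat_Bijection" "HOL-Library.Sublist"
begin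

(* Finite objects are presented to machines through a natural number code.  A class with
   explicit instances is used because the codings must be effective; the library function
   to_nat of class countable is an arbitrary injection and would not do.  Every natural number
   is its own code, so an r.e. set of finite objects can be taken to be an r.e. set of natural
   numbers, and oracle sequences are sequences of natural numbers. *)

class finite_object =
  fixes encode :: "'a \<Rightarrow> nat"
  assumes inj_encode: "inj encode"

instantiation nat :: finite_object
begin
definition "encode (n :: nat) = n"
instance by standard (simp add: encode_nat_def inj_def)
end

instantiation int :: finite_object
begin
definition "encode (i :: int) = int_encode i"
instance by standard (simp add: encode_int_def[abs_def] inj_int_encode)
end

instantiation prod :: (finite_object, finite_object) finite_object
begin
definition "encode (p :: 'a \<times> 'b) = prod_encode (encode (fst p), encode (snd p))"
instance
  by standard (auto simp: encode_prod_def inj_def dest: injD[OF inj_encode])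
end

instantiation list :: (finite_object) finite_object
begin
definition "encode (xs :: 'a list) = list_encode (map encode xs)"
instance
  by standard (auto simp: encode_list_def inj_def dest!: injD[OF inj_list_encode] map_injective[OF _ inj_encode])
end

instantiation rat :: finite_object
begin
definition "encode (r :: rat) = encode (quotient_of r)"
instance
  by standard (auto simp: encode_rat_def inj_def dest!: injD[OF inj_encode] intro: quotient_of_inject)
end


(* Oracle Turing machines with finitely many two-way infinite tapes over a blank (False) and a
   stroke (True).  A tape (l, r) has hd r under the head, the rest of r to its right, and l to
   its left, nearest cell first; all cells not listed are blank. *)

type_synonym tape = "bool list \<times> bool list"

datatype action = Erase | Mark | MoveLeft | MoveRight

fun scanned :: "tape \<Rightarrow> bool" where
  "scanned (l, []) = False"
| "scanned (l, b # r) = b"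

fun perform :: "action \<Rightarrow> tape \<Rightarrow> tape" where
  "perform Erase (l, r) = (l, False # tl r)"
| "perform Mark (l, r) = (l, True # tl r)"
| "perform MoveLeft ([], r) = ([], False # r)"
| "perform MoveLeft (b # l, r) = (l, b # r)"
| "perform MoveRight (l, []) = (False # l, [])"
| "perform MoveRight (l, b # r) = (b # l, r)"

(* A number is written on a tape as a block of strokes with the head on its leftmost cell;
   it is read off a tape as the total number of strokes. *)

definition block :: "nat \<Rightarrow> tape" where
  "block n = ([], replicate n True)"

definition strokes :: "tape \<Rightarrow> nat" where
  "strokes t = count_list (fst t @ snd t) True"

(* The states of a machine M are the numbers below length M, with initial state 0; any other
   number is a halting state.

   In state Scan i (a, q) (b, q') the machine scans tape i; on a blank it performs a and goes
   to q, on a stroke it performs b and goes to q'.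

   In state Query i j t q it asks its oracle for element m of sequence k, where k and m are
   the numbers on tapes i and j, receives the answer on tape t, and goes to q.  Sequences and
   their elements are counted from 0.  A query with k \<ge> length \<beta>s gets no answer, and the
   machine never halts. *)

datatype instr =
    Scan nat "action \<times> nat" "action \<times> nat"
  | Query nat nat nat nat

type_synonym machine = "instr list"

type_synonym config = "nat \<times> (nat \<Rightarrow> tape)"

inductive step :: "machine \<Rightarrow> nat stream list \<Rightarrow> config \<Rightarrow> config \<Rightarrow> bool"
  for M :: machine and \<beta>s :: "nat stream list"
where
  scan_blank: "q < length M \<Longrightarrow> M ! q = Scan i (a, q0) (b, q1) \<Longrightarrow> \<not> scanned (T i) \<Longrightarrow>
    step M \<beta>s (q, T) (q0, T(i := perform a (T i)))"
| scan_stroke: "q < length M \<Longrightarrow> M ! q = Scan i (a, q0) (b, q1) \<Longrightarrow> scanned (T i) \<Longrightarrow>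
    step M \<beta>s (q, T) (q1, T(i := perform b (T i)))"
| query: "q < length M \<Longrightarrow> M ! q = Query i j t q' \<Longrightarrow> strokes (T i) < length \<beta>s \<Longrightarrow>
    step M \<beta>s (q, T) (q', T(t := block ((\<beta>s ! strokes (T i)) !! strokes (T j))))"

lemma step_deterministic: "step M \<beta>s c c' \<Longrightarrow> step M \<beta>s c c'' \<Longrightarrow> c' = c''"
  by (auto elim!: step.cases)

definition initial :: "nat \<Rightarrow> config" where
  "initial x = (0, (\<lambda>_. block 0)(0 := block x))"

(* The result of a halting computation is the number on tape 0. *)

definition computes :: "machine \<Rightarrow> nat stream list \<Rightarrow> nat \<Rightarrow> nat \<Rightarrow> bool" where
  "computes M \<beta>s x y \<longleftrightarrow>
     (\<exists>q T. (step M \<beta>s)\<^sup>*\<^sup>* (initial x) (q, T) \<and> length M \<le> q \<and> strokes (T 0) = y)"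

definition accepts :: "machine \<Rightarrow> nat stream list \<Rightarrow> nat \<Rightarrow> bool" where
  "accepts M \<beta>s x \<longleftrightarrow> (\<exists>y. computes M \<beta>s x y)"

definition partial_recursive :: "('a::finite_object \<rightharpoonup> 'b::finite_object) \<Rightarrow> bool" where
  "partial_recursive f \<longleftrightarrow>
     (\<exists>M. \<forall>x. case f x of
        None \<Rightarrow> \<not> accepts M [] (encode x)
      | Some y \<Rightarrow> computes M [] (encode x) (encode y))"

definition recursively_enumerable :: "'a::finite_object set \<Rightarrow> bool" where
  "recursively_enumerable A \<longleftrightarrow> (\<exists>M. \<forall>x. x \<in> A \<longleftrightarrow> accepts M [] (encode x))"

definition re_infinite :: "'a::finite_object set \<Rightarrow> bool" where
  "re_infinite A \<longleftrightarrow> recursively_enumerable A \<and> infinite A"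


(* A mass function on \<Omega> is identified with the pmf that extends it by 0 outside \<Omega>. *)

definition prob_spaces_on :: "'a set \<Rightarrow> 'a pmf set" where
  "prob_spaces_on \<Omega> = {P. set_pmf P \<subseteq> \<Omega>}"

definition computable_pmf :: "'a::finite_object set \<Rightarrow> 'a pmf \<Rightarrow> bool" where
  "computable_pmf \<Omega> P \<longleftrightarrow>
     (\<exists>f :: 'a \<times> nat \<rightharpoonup> rat. partial_recursive f \<and> dom f = \<Omega> \<times> UNIV \<and>
        (\<forall>a\<in>\<Omega>. \<forall>k. \<bar>pmf P a - of_rat (the (f (a, k)))\<bar> \<le> (1/2) ^ k))"

(* The generalized Bernoulli measure, as a measure on all streams over the type; for P in
   prob_spaces_on \<Omega> it is concentrated on streams \<Omega>. *)

definition bernoulli :: "'a pmf \<Rightarrow> 'a stream measure" where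
  "bernoulli P = stream_space (measure_pmf P)"

definition cyl :: "'a set \<Rightarrow> 'a list set \<Rightarrow> 'a stream set" where
  "cyl \<Omega> S = {\<alpha> \<in> streams \<Omega>. \<exists>n. stake n \<alpha> \<in> S}"

lemma prob_space_bernoulli: "prob_space (bernoulli P)"
  unfolding bernoulli_def
  by (intro prob_space.prob_space_stream_space prob_space_measure_pmf)

lemma sets_cyl [measurable]: "cyl \<Omega> S \<in> sets (bernoulli P)" for \<Omega> :: "'a::countable set"
proof -
  have [measurable_cong]: "sets (bernoulli P) = sets (stream_space (count_space UNIV))"
    unfolding bernoulli_def by (rule sets_stream_space_cong) simp
  have "cyl \<Omega> S = {\<alpha> \<in> space (stream_space (count_space UNIV)).
      (\<forall>n. \<alpha> !! n \<in> \<Omega>) \<and> (\<exists>n. stake n \<alpha> \<in> S)}"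
    by (auto simp: cyl_def streams_iff_snth space_stream_space)
  also have "\<dots> \<in> sets (bernoulli P)" by measurable
  finally show ?thesis .
qed

lemma measure_bernoulli_cyl:
  fixes \<sigma> :: "'a::countable list"
  assumes "P \<in> prob_spaces_on \<Omega>" and "\<sigma> \<in> lists \<Omega>"
  shows "measure (bernoulli P) (cyl \<Omega> {\<sigma>}) = (\<Prod>a\<leftarrow>\<sigma>. pmf P a)"
proof -
  have "emeasure (bernoulli P) (cyl \<Omega> {\<sigma>}) = ennreal (\<Prod>a\<leftarrow>\<sigma>. pmf P a)"
    using assms(2)
  proof (induction \<sigma>)
    case Nil
    interpret prob_space "bernoulli P" by (rule prob_space_bernoulli)
    have "AE a in measure_pmf P. a \<in> \<Omega>"
      using assms(1) by (auto simp: prob_spaces_on_def AE_measure_pmf_iff)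
    then have "AE \<alpha> in bernoulli P. stream_all (\<lambda>a. a \<in> \<Omega>) \<alpha>"
      unfolding bernoulli_def by (intro prob_space.AE_stream_all prob_space_measure_pmf) auto
    then have "AE \<alpha> in bernoulli P. \<alpha> \<in> cyl \<Omega> {[]}"
      by eventually_elim (auto simp: cyl_def streams_iff_snth stream_all_def intro: exI[of _ 0])
    then show ?case
      using emeasure_eq_1_AE[OF sets_cyl] by simp
  next
    case (Cons a \<sigma>)
    have *: "{x. t ## x \<in> cyl \<Omega> {a # \<sigma>}} = (if t = a then cyl \<Omega> {\<sigma>} else {})" for t
    proof -
      have "(\<exists>n. stake n (t ## x) = a # \<sigma>) \<longleftrightarrow> t = a \<and> (\<exists>n. stake n x = \<sigma>)" for x
      proof
        assume "\<exists>n. stake n (t ## x) = a # \<sigma>"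
        then obtain n where n: "stake n (t ## x) = a # \<sigma>" ..
        then show "t = a \<and> (\<exists>n. stake n x = \<sigma>)" by (cases n) auto
      next
        assume "t = a \<and> (\<exists>n. stake n x = \<sigma>)"
        then show "\<exists>n. stake n (t ## x) = a # \<sigma>" by (auto intro: exI[of _ "Suc n" for n])
      qed
      with Cons show ?thesis by (auto simp: cyl_def streams_Stream)
    qed
    have "emeasure (bernoulli P) (cyl \<Omega> {a # \<sigma>}) =
        (\<integral>\<^sup>+ t. emeasure (bernoulli P) {x. t ## x \<in> cyl \<Omega> {a # \<sigma>}} \<partial>measure_pmf P)"
      using prob_space.emeasure_stream_space[OF prob_space_measure_pmf,
          OF sets_cyl[of \<Omega> "{a # \<sigma>}" P, unfolded bernoulli_def]]
      by (simp add: bernoulli_def space_stream_space)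
    also have "\<dots> = (\<integral>\<^sup>+ t. emeasure (bernoulli P) (cyl \<Omega> {\<sigma>}) * indicator {a} t \<partial>measure_pmf P)"
      unfolding * by (intro nn_integral_cong) (auto split: split_indicator)
    also have "\<dots> = ennreal (\<Prod>b\<leftarrow>a # \<sigma>. pmf P b)"
      using Cons by (simp add: nn_integral_multc emeasure_pmf_single ennreal_mult' mult.commute)
    finally show ?case .
  qed
  moreover have "0 \<le> (\<Prod>a\<leftarrow>\<sigma>. pmf P a)" by (induction \<sigma>) auto
  ultimately show ?thesis
    by (simp add: measure_def)
qed

definition prefix_free :: "'a list set \<Rightarrow> bool" where
  "prefix_free S \<longleftrightarrow> (\<forall>\<sigma>\<in>S. \<forall>\<tau>\<in>S. prefix \<sigma> \<tau> \<longrightarrow> \<sigma> = \<tau>)"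

definition ml_test ::
  "'a::finite_object set \<Rightarrow> 'a pmf \<Rightarrow> nat stream list \<Rightarrow> (nat \<times> 'a list) set \<Rightarrow> bool" where
  "ml_test \<Omega> P \<beta>s C \<longleftrightarrow>
     (\<exists>M. C = {(n, \<sigma>). 1 \<le> n \<and> \<sigma> \<in> lists \<Omega> \<and> accepts M \<beta>s (encode (n, \<sigma>))}) \<and>
     (\<forall>n\<ge>1. prefix_free {\<sigma>. (n, \<sigma>) \<in> C} \<and>
        measure (bernoulli P) (cyl \<Omega> {\<sigma>. (n, \<sigma>) \<in> C}) < (1/2) ^ n)"

definition ml_random ::
  "'a::finite_object set \<Rightarrow> 'a pmf \<Rightarrow> nat stream list \<Rightarrow> 'a stream \<Rightarrow> bool" where
  "ml_random \<Omega> P \<beta>s \<alpha> \<longleftrightarrow>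
     (\<forall>C. ml_test \<Omega> P \<beta>s C \<longrightarrow> (\<exists>n\<ge>1. \<alpha> \<notin> cyl \<Omega> {\<sigma>. (n, \<sigma>) \<in> C}))"

end

theory Submission imports Defs begin

text \<open>
This is van Lambalgen's theorem for products of generalized Bernoulli measures over countable
alphabets. It rests on one fact of measure theory, Fubini's theorem for the product measure, and one
of computability, that the statement ``a finite list of strings has total \<open>P1\<close>-probability
less (greater) than \<open>(1/2) ^ n\<close>'' is recognizable because \<open>P1\<close> is computable.

If the pair is random, then \<open>\<alpha>2\<close> is random, as tests for \<open>\<alpha>2\<close> are tests for the pair
(\<open>snd_random_of_product_random\<close>). A test for \<open>\<alpha>1\<close> that consults \<open>\<alpha>2\<close> becomes a test for the pair when
it consults the second coordinate instead; its sections at other sequences are kept small by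
enumerating them only while their probability is recognized to be small
(\<open>fst_random_of_product_random\<close>).

Conversely, let the pair fail a test. The second coordinates at which the section of level \<open>2 * m\<close> is
larger than \<open>(1/2) ^ m\<close> form an enumerable open set of measure at most \<open>(1/2) ^ m\<close>. If \<open>\<alpha>2\<close> is
random, it lies in only finitely many of these sets, and then the sections at \<open>\<alpha>2\<close> are a
test that \<open>\<alpha>1\<close> fails (\<open>product_random_of_random\<close>).

All three arguments manipulate tests, and tests are given by machines. To avoid programming Turing
machines more than once, the work is split as follows. Pairing, unpairing, iteration and oracle
access are programmed on the tapes, used as counters; their closure under composition gives a
calculus of computable functions on finite objects, in which the computability of a concrete
function is proved by following its definition (\<open>computable_in\<close>). In the other direction,
the run of a machine for \<open>s\<close> steps with the first \<open>s\<close> elements of its oracle sequences is a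
computable function of \<open>s\<close> and these prefixes (\<open>run_within\<close>, \<open>computes_iff_run_within\<close>). Treating the
prefixes as data is what allows the second coordinate of a pair to take the place of an oracle.
Finally \<open>passes_decidable_test\<close> reduces tests to decidable predicates of strings: the length of a
string is at the same time the bound on the search, and minimal strings are prefix-free.
\<close>

section \<open>Counter programs on oracle Turing machines\<close>

text \<open>Erasing the first stroke of a block leaves a blank to the left of the head, and testing an empty
counter writes a blank under the head. The relation allows both, so that decrementing needs no cleanup;
\<^const>\<open>strokes\<close> does not see the blanks either.\<close>

definition holds_number :: "tape \<Rightarrow> nat \<Rightarrow> bool" where
  "holds_number t n \<longleftrightarrow>
     (\<exists>j k. t = (replicate j False, replicate n True @ replicate k False))"

lemma count_list_replicate: "count_list (replicate n y) x = (if x = y then n else 0)"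
  by (induction n) auto

lemma strokes_holds_number: "holds_number t n \<Longrightarrow> strokes t = n"
  by (auto simp: holds_number_def strokes_def count_list_replicate)

lemma scanned_holds_number: "holds_number t n \<Longrightarrow> scanned t \<longleftrightarrow> n > 0"
proof -
  assume "holds_number t n"
  then obtain j k where t: "t = (replicate j False, replicate n True @ replicate k False)"
    by (auto simp: holds_number_def)
  show ?thesis unfolding t by (cases n; cases k) auto
qed

lemma holds_number_block: "holds_number (block n) n"
  unfolding holds_number_def block_def by (rule exI[of _ 0], rule exI[of _ 0]) simp

lemma holds_number_increment:
  "holds_number t n \<Longrightarrow> holds_number (perform Mark (perform MoveLeft t)) (Suc n)"
proof -
  assume "holds_number t n"
  then obtain j k where t: "t = (replicate j False, replicate n True @ replicate k False)"
    by (auto simp: holds_number_def)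
  have "perform Mark (perform MoveLeft t) =
      (replicate (j - 1) False, replicate (Suc n) True @ replicate k False)"
    unfolding t by (cases j) auto
  then show ?thesis unfolding holds_number_def by blast
qed

lemma holds_number_decrement:
  "holds_number t (Suc n) \<Longrightarrow> holds_number (perform MoveRight (perform Erase t)) n"
proof -
  assume "holds_number t (Suc n)"
  then obtain j k where t: "t = (replicate j False, replicate (Suc n) True @ replicate k False)"
    by (auto simp: holds_number_def)
  have "perform MoveRight (perform Erase t) =
      (replicate (Suc j) False, replicate n True @ replicate k False)"
    unfolding t by auto
  then show ?thesis unfolding holds_number_def by blast
qed

lemma holds_number_erase_zero:
  "holds_number t 0 \<Longrightarrow> holds_number (perform Erase t) 0"
proof -
  assume "holds_number t 0"
  then obtain j k where t: "t = (replicate j False, replicate k False)"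
    by (auto simp: holds_number_def)
  have "perform Erase t = (replicate j False, replicate 0 True @ replicate (Suc (k - 1)) False)"
    unfolding t by (cases k) auto
  then show ?thesis unfolding holds_number_def by blast
qed

lemma holds_number_rewrite:
  "holds_number t n \<Longrightarrow> holds_number (perform (if scanned t then Mark else Erase) t) n"
proof -
  assume h: "holds_number t n"
  then obtain j k where t: "t = (replicate j False, replicate n True @ replicate k False)"
    by (auto simp: holds_number_def)
  show ?thesis
  proof (cases n)
    case 0
    then show ?thesis using h scanned_holds_number[OF h] holds_number_erase_zero by auto
  next
    case (Suc m)
    then have "perform Mark t = t" by (simp add: t)
    then show ?thesis using h scanned_holds_number[OF h] Suc by simp
  qed
qed

text \<open>Jump targets are absolute, so a piece of code is given as a function of the address at which it
is placed.\<close>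

type_synonym fragment = "nat \<Rightarrow> instr list"

definition occurs_at :: "machine \<Rightarrow> nat \<Rightarrow> instr list \<Rightarrow> bool" where
  "occurs_at M a cs \<longleftrightarrow> (\<exists>pre post. M = pre @ cs @ post \<and> length pre = a)"

text \<open>The machine seen as a counter machine: \<open>s i\<close> is the number on tape \<open>i\<close>. All tapes that hold these
numbers are allowed, and the computation may end with any tapes that hold the new ones.\<close>

definition reaches :: "machine \<Rightarrow> nat stream list \<Rightarrow> nat \<Rightarrow> (nat \<Rightarrow> nat) \<Rightarrow> nat \<Rightarrow> (nat \<Rightarrow> nat) \<Rightarrow> bool" where
  "reaches M \<beta>s a s b s' \<longleftrightarrow>
     (\<forall>T. (\<forall>i. holds_number (T i) (s i)) \<longrightarrow>
        (\<exists>T'. (step M \<beta>s)\<^sup>*\<^sup>* (a, T) (b, T') \<and> (\<forall>i. holds_number (T' i) (s' i))))"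

definition exec :: "nat stream list \<Rightarrow> fragment \<Rightarrow> (nat \<Rightarrow> nat) \<Rightarrow> (nat \<Rightarrow> nat) \<Rightarrow> bool" where
  "exec \<beta>s c s s' \<longleftrightarrow>
     (\<forall>M a. occurs_at M a (c a) \<longrightarrow> reaches M \<beta>s a s (a + length (c a)) s')"

lemma reaches_refl: "reaches M \<beta>s a s a s"
  unfolding reaches_def by blast

lemma reaches_trans:
  assumes "reaches M \<beta>s a s b s'" "reaches M \<beta>s b s' c s''"
  shows "reaches M \<beta>s a s c s''"
  unfolding reaches_def
proof (intro allI impI)
  fix T assume "\<forall>i. holds_number (T i) (s i)"
  then obtain T' where T': "(step M \<beta>s)\<^sup>*\<^sup>* (a, T) (b, T')" "\<forall>i. holds_number (T' i) (s' i)"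
    using assms(1) unfolding reaches_def by blast
  then obtain T'' where "(step M \<beta>s)\<^sup>*\<^sup>* (b, T') (c, T'')" "\<forall>i. holds_number (T'' i) (s'' i)"
    using assms(2) unfolding reaches_def by blast
  with T' show "\<exists>T'. (step M \<beta>s)\<^sup>*\<^sup>* (a, T) (c, T') \<and> (\<forall>i. holds_number (T' i) (s'' i))"
    by (meson rtranclp_trans)
qed

lemma occurs_at_append:
  "occurs_at M a (cs @ ds) \<longleftrightarrow> occurs_at M a cs \<and> occurs_at M (a + length cs) ds"
proof
  assume "occurs_at M a (cs @ ds)"
  then obtain pre post where "M = pre @ (cs @ ds) @ post" "length pre = a"
    by (auto simp: occurs_at_def)
  then show "occurs_at M a cs \<and> occurs_at M (a + length cs) ds"
    unfolding occurs_at_def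
    by (intro conjI exI[of _ pre] exI[of _ "ds @ post"] exI[of _ "pre @ cs"] exI[of _ post]) auto
next
  assume "occurs_at M a cs \<and> occurs_at M (a + length cs) ds"
  then obtain p q p' q' where *: "M = p @ cs @ q" "length p = a"
      "M = p' @ ds @ q'" "length p' = a + length cs"
    unfolding occurs_at_def by blast
  have "take (length p') M = p @ cs" unfolding *(1) using *(2,4) by simp
  moreover have "take (length p') M = p'" unfolding *(3) by simp
  ultimately have "p' = p @ cs" by simp
  with * show "occurs_at M a (cs @ ds)" by (auto simp: occurs_at_def)
qed

lemma occurs_at_Cons:
  "occurs_at M a (c # cs) \<longleftrightarrow> a < length M \<and> M ! a = c \<and> occurs_at M (Suc a) cs"
proof -
  have "occurs_at M a [c] \<longleftrightarrow> a < length M \<and> M ! a = c"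
  proof
    assume "a < length M \<and> M ! a = c"
    then have "M = take a M @ [c] @ drop (Suc a) M" "length (take a M) = a"
      using id_take_nth_drop[of a M] by auto
    then show "occurs_at M a [c]" unfolding occurs_at_def by blast
  qed (auto simp: occurs_at_def)
  then show ?thesis using occurs_at_append[of M a "[c]" cs] by simp
qed

lemma occurs_at_Nil: "occurs_at M a [] \<longleftrightarrow> a \<le> length M"
proof
  assume "a \<le> length M"
  then have "M = take a M @ [] @ drop a M" "length (take a M) = a" by auto
  then show "occurs_at M a []" unfolding occurs_at_def by blast
qed (auto simp: occurs_at_def)

lemma occurs_at_self: "occurs_at (cs @ ds) 0 cs"
  unfolding occurs_at_def by (rule exI[of _ "[]"]) simp

lemma reaches_scan:
  assumes "a < length M" "M ! a = Scan i (b, q0) (c, q1)"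
    and "\<And>t. holds_number t (s i) \<Longrightarrow> holds_number (perform (if s i = 0 then b else c) t) (s' i)"
    and "\<And>j. j \<noteq> i \<Longrightarrow> s' j = s j"
  shows "reaches M \<beta>s a s (if s i = 0 then q0 else q1) s'"
  unfolding reaches_def
proof (intro allI impI)
  fix T assume T: "\<forall>i. holds_number (T i) (s i)"
  let ?T = "T(i := perform (if s i = 0 then b else c) (T i))"
  have "step M \<beta>s (a, T) (if s i = 0 then q0 else q1, ?T)"
    using step.scan_blank[OF assms(1,2), of T \<beta>s] step.scan_stroke[OF assms(1,2), of T \<beta>s]
      scanned_holds_number[of "T i" "s i"] T by auto
  moreover have "\<forall>j. holds_number (?T j) (s' j)"
    using T assms(3)[of "T i"] assms(4) by auto
  ultimately show "\<exists>T'. (step M \<beta>s)\<^sup>*\<^sup>* (a, T) (if s i = 0 then q0 else q1, T') \<and>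
      (\<forall>i. holds_number (T' i) (s' i))"
    by blast
qed

text \<open>Rewriting the scanned symbol by itself leaves the number on the tape unchanged, and both
branches lead to the same state.\<close>

abbreviation goto :: "nat \<Rightarrow> nat \<Rightarrow> instr" where
  "goto i q \<equiv> Scan i (Erase, q) (Mark, q)"

lemma reaches_goto: 
  assumes "a < length M" "M ! a = goto i q" shows "reaches M \<beta>s a s q s"
proof -
  have "holds_number (perform (if s i = 0 then Erase else Mark) t) (s i)" 
    if "holds_number t (s i)" for t
    using holds_number_rewrite[OF that] scanned_holds_number[OF that] by auto
  then show ?thesis using reaches_scan[of a M i Erase q Mark q s s \<beta>s] assms by simp
qed

text \<open>The decrement-or-jump instruction of counter machines, with \<open>q\<close> as the target of the jump. The
erased cell ends up to the left of the head.\<close>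

definition take_one :: "nat \<Rightarrow> nat \<Rightarrow> fragment" where
  "take_one i q a = [Scan i (Erase, q) (Erase, a + 1), Scan i (MoveRight, a + 2) (MoveRight, a + 2)]"

lemma length_take_one [simp]: "length (take_one i q a) = 2"
  by (simp add: take_one_def)

lemma reaches_take_one_zero:
  assumes "occurs_at M a (take_one i q a)" "s i = 0" shows "reaches M \<beta>s a s q s"
  using reaches_scan[of a M i Erase q Erase "a + 1" s s \<beta>s] assms holds_number_erase_zero
  by (simp add: take_one_def occurs_at_Cons)

lemma reaches_take_one_Suc:
  assumes "occurs_at M a (take_one i q a)" "s i = Suc n"
  shows "reaches M \<beta>s a s (a + 2) (s(i := n))"
  unfolding reaches_def
proof (intro allI impI)
  fix T assume T: "\<forall>i. holds_number (T i) (s i)"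
  have M: "a < length M" "M ! a = Scan i (Erase, q) (Erase, a + 1)"
    "a + 1 < length M" "M ! (a + 1) = Scan i (MoveRight, a + 2) (MoveRight, a + 2)"
    using assms(1) by (auto simp: take_one_def occurs_at_Cons)
  let ?T = "T(i := perform Erase (T i))"
  let ?T' = "?T(i := perform MoveRight (?T i))"
  have "holds_number (T i) (Suc n)" using T[rule_format, of i] assms(2) by simp
  then have "scanned (T i)" by (simp add: scanned_holds_number)
  then have "step M \<beta>s (a, T) (a + 1, ?T)" by (rule step.scan_stroke[OF M(1,2)])
  moreover have "step M \<beta>s (a + 1, ?T) (a + 2, ?T')"
    using step.scan_stroke[OF M(3,4), of ?T \<beta>s] step.scan_blank[OF M(3,4), of ?T \<beta>s] by blast
  moreover have "\<forall>j. holds_number (?T' j) ((s(i := n)) j)"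
    using T holds_number_decrement[OF \<open>holds_number (T i) (Suc n)\<close>] by simp
  ultimately show "\<exists>T'. (step M \<beta>s)\<^sup>*\<^sup>* (a, T) (a + 2, T') \<and>
      (\<forall>j. holds_number (T' j) ((s(i := n)) j))"
    by (meson converse_rtranclp_into_rtranclp rtranclp.rtrancl_refl)
qed

definition skip :: fragment where "skip a = []"

definition seq :: "fragment \<Rightarrow> fragment \<Rightarrow> fragment" (infixr ";;" 60) where
  "(c ;; d) a = c a @ d (a + length (c a))"

definition incr :: "nat \<Rightarrow> fragment" where
  "incr i a = [Scan i (MoveLeft, a + 1) (MoveLeft, a + 1), Scan i (Mark, a + 2) (Mark, a + 2)]"

definition loop :: "nat \<Rightarrow> fragment \<Rightarrow> fragment" where
  "loop i c a = take_one i (a + 3 + length (c (a + 2))) a @ c (a + 2) @ [goto i a]"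

definition branch :: "nat \<Rightarrow> fragment \<Rightarrow> fragment \<Rightarrow> fragment" where
  "branch i c d a = (let b = a + 3 + length (c (a + 2)) in
     take_one i b a @ c (a + 2) @ [goto i (b + length (d b))] @ d b)"

definition query :: "nat \<Rightarrow> nat \<Rightarrow> nat \<Rightarrow> fragment" where
  "query i j t a = [Query i j t (a + 1)]"

lemma exec_skip: "exec \<beta>s skip s s"
  by (simp add: exec_def skip_def reaches_refl)

lemma exec_seq: "exec \<beta>s c s s' \<Longrightarrow> exec \<beta>s d s' s'' \<Longrightarrow> exec \<beta>s (c ;; d) s s''"
  unfolding exec_def seq_def occurs_at_append
  by (simp add: add.assoc[symmetric]) (meson reaches_trans)

lemma exec_incr: "exec \<beta>s (incr i) s (s(i := Suc (s i)))"
  unfolding exec_def reaches_def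
proof (intro allI impI)
  fix M a T assume o: "occurs_at M a (incr i a)" and T: "\<forall>i. holds_number (T i) (s i)"
  have M: "a < length M" "M ! a = Scan i (MoveLeft, a + 1) (MoveLeft, a + 1)"
    "a + 1 < length M" "M ! (a + 1) = Scan i (Mark, a + 2) (Mark, a + 2)"
    using o by (auto simp: incr_def occurs_at_Cons)
  let ?T = "T(i := perform MoveLeft (T i))"
  let ?T' = "?T(i := perform Mark (?T i))"
  have "step M \<beta>s (a, T) (a + 1, ?T)"
    using step.scan_stroke[OF M(1,2), of T \<beta>s] step.scan_blank[OF M(1,2), of T \<beta>s] by blast
  moreover have "step M \<beta>s (a + 1, ?T) (a + 2, ?T')"
    using step.scan_stroke[OF M(3,4), of ?T \<beta>s] step.scan_blank[OF M(3,4), of ?T \<beta>s] by blast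
  moreover have "\<forall>j. holds_number (?T' j) ((s(i := Suc (s i))) j)"
    using T holds_number_increment[of "T i" "s i"] by simp
  moreover have "length (incr i a) = 2" by (simp add: incr_def)
  ultimately show "\<exists>T'. (step M \<beta>s)\<^sup>*\<^sup>* (a, T) (a + length (incr i a), T') \<and>
      (\<forall>j. holds_number (T' j) ((s(i := Suc (s i))) j))"
    by (metis converse_rtranclp_into_rtranclp rtranclp.rtrancl_refl)
qed

lemma exec_query:
  assumes "s i < length \<beta>s"
  shows "exec \<beta>s (query i j t) s (s(t := (\<beta>s ! s i) !! s j))"
  unfolding exec_def reaches_def
proof (intro allI impI)
  fix M a T assume o: "occurs_at M a (query i j t a)" and T: "\<forall>i. holds_number (T i) (s i)"
  have M: "a < length M" "M ! a = Query i j t (a + 1)"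
    using o by (auto simp: query_def occurs_at_Cons)
  let ?T = "T(t := block ((\<beta>s ! strokes (T i)) !! strokes (T j)))"
  have st: "strokes (T i) = s i" "strokes (T j) = s j" using T strokes_holds_number by blast+
  have "step M \<beta>s (a, T) (a + 1, ?T)" by (rule step.query[OF M]) (simp add: assms st)
  moreover have "\<forall>k. holds_number (?T k) ((s(t := (\<beta>s ! s i) !! s j)) k)"
    using T st holds_number_block by simp
  moreover have "length (query i j t a) = 1" by (simp add: query_def)
  ultimately show "\<exists>T'. (step M \<beta>s)\<^sup>*\<^sup>* (a, T) (a + length (query i j t a), T') \<and>
      (\<forall>k. holds_number (T' k) ((s(t := (\<beta>s ! s i) !! s j)) k))"
    by (metis r_into_rtranclp)
qed

lemma exec_loop_zero: "s i = 0 \<Longrightarrow> exec \<beta>s (loop i c) s s"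
  unfolding exec_def loop_def occurs_at_append
  by (auto simp: eval_nat_numeral dest: reaches_take_one_zero)

lemma exec_loop_Suc:
  assumes "s i = Suc n" "exec \<beta>s c (s(i := n)) s'" "exec \<beta>s (loop i c) s' s''"
  shows "exec \<beta>s (loop i c) s s''"
  unfolding exec_def
proof (intro allI impI)
  fix M a assume o: "occurs_at M a (loop i c a)"
  then have o': "occurs_at M a (take_one i (a + 3 + length (c (a + 2))) a)"
    "occurs_at M (a + 2) (c (a + 2))" "occurs_at M (a + 2 + length (c (a + 2))) [goto i a]"
    by (auto simp: loop_def occurs_at_append)
  have "reaches M \<beta>s a s (a + 2) (s(i := n))"
    by (rule reaches_take_one_Suc) (use o' assms in auto)
  also have "reaches M \<beta>s (a + 2) (s(i := n)) (a + 2 + length (c (a + 2))) s'"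
    using assms(2) o'(2) unfolding exec_def by blast
  also (reaches_trans) have "reaches M \<beta>s (a + 2 + length (c (a + 2))) s' a s'"
    using o'(3) by (intro reaches_goto) (auto simp: occurs_at_Cons)
  also (reaches_trans) have "reaches M \<beta>s a s' (a + length (loop i c a)) s''"
    using assms(3) o unfolding exec_def by blast
  finally (reaches_trans) show "reaches M \<beta>s a s (a + length (loop i c a)) s''" .
qed

text \<open>The family \<open>F\<close> is the loop invariant, indexed by the value still left in the counter. The counter
has already been decremented when the body starts.\<close>

lemma exec_loop:
  assumes "\<And>n. F n i = n"
    and "\<And>n. n < N \<Longrightarrow> exec \<beta>s c ((F (Suc n))(i := n)) (F n)"
  shows "exec \<beta>s (loop i c) (F N) (F 0)"
proof -
  have "n \<le> N \<Longrightarrow> exec \<beta>s (loop i c) (F n) (F 0)" for n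
  proof (induction n)
    case 0 show ?case using assms(1)[of 0] by (rule exec_loop_zero)
  next
    case (Suc n)
    then show ?case using exec_loop_Suc[OF assms(1)[of "Suc n"] assms(2)[of n]] by simp
  qed
  then show ?thesis by simp
qed

lemma exec_branch_zero:
  assumes "s i = 0" "exec \<beta>s d s s'" shows "exec \<beta>s (branch i c d) s s'"
  unfolding exec_def
proof (intro allI impI)
  fix M a assume o: "occurs_at M a (branch i c d a)"
  define b where "b = a + 3 + length (c (a + 2))"
  have o': "occurs_at M a (take_one i b a)" "occurs_at M b (d b)"
    using o by (auto simp: branch_def occurs_at_append occurs_at_Cons Let_def b_def eval_nat_numeral)
  have "reaches M \<beta>s a s b s" by (rule reaches_take_one_zero) (use o' assms in auto)
  also have "reaches M \<beta>s b s (b + length (d b)) s'"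
    using assms(2) o'(2) unfolding exec_def by blast
  finally (reaches_trans) show "reaches M \<beta>s a s (a + length (branch i c d a)) s'"
    by (simp add: branch_def b_def eval_nat_numeral add_ac)
qed

lemma exec_branch_Suc:
  assumes "s i = Suc n" "exec \<beta>s c (s(i := n)) s'" shows "exec \<beta>s (branch i c d) s s'"
  unfolding exec_def
proof (intro allI impI)
  fix M a assume o: "occurs_at M a (branch i c d a)"
  define b where "b = a + 3 + length (c (a + 2))"
  have o': "occurs_at M a (take_one i b a)" "occurs_at M (a + 2) (c (a + 2))"
    "occurs_at M (a + 2 + length (c (a + 2))) [goto i (b + length (d b))]"
    using o by (auto simp: branch_def occurs_at_append Let_def b_def occurs_at_Cons occurs_at_Nil)
  have "reaches M \<beta>s a s (a + 2) (s(i := n))"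
    by (rule reaches_take_one_Suc) (use o' assms in auto)
  also have "reaches M \<beta>s (a + 2) (s(i := n)) (a + 2 + length (c (a + 2))) s'"
    using assms(2) o'(2) unfolding exec_def by blast
  also (reaches_trans) have "reaches M \<beta>s (a + 2 + length (c (a + 2))) s' (b + length (d b)) s'"
    using o'(3) by (intro reaches_goto) (auto simp: occurs_at_Cons)
  finally (reaches_trans) show "reaches M \<beta>s a s (a + length (branch i c d a)) s'"
    by (simp add: branch_def b_def eval_nat_numeral add_ac)
qed

section \<open>Functions computable from oracles\<close>

text \<open>The calling convention. The argument and the result are in register \<open>d\<close>; the registers above \<open>d\<close>
are scratch space, empty before and after; those below \<open>d\<close> are left alone. A program
can therefore protect intermediate results by calling its subprograms at a larger \<open>d\<close>.\<close>

definition implements :: "nat stream list \<Rightarrow> nat \<Rightarrow> fragment \<Rightarrow> (nat \<Rightarrow> nat) \<Rightarrow> bool" where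
  "implements \<beta>s d c f \<longleftrightarrow> (\<forall>s. (\<forall>i>d. s i = 0) \<longrightarrow> exec \<beta>s c s (s(d := f (s d))))"

text \<open>Total functions are enough: all the tests constructed below are decidable.\<close>

definition realizable :: "nat stream list \<Rightarrow> (nat \<Rightarrow> nat) \<Rightarrow> bool" where
  "realizable \<beta>s f \<longleftrightarrow> (\<forall>d. \<exists>c. implements \<beta>s d c f)"

lemma exec_incrI: "s' = s(i := Suc (s i)) \<Longrightarrow> exec \<beta>s (incr i) s s'"
  using exec_incr[of \<beta>s i s] by simp

definition clear :: "nat \<Rightarrow> fragment" where "clear i = loop i skip"

lemma exec_clearI:
  assumes "s' = s(i := 0)" shows "exec \<beta>s (clear i) s s'"
proof -
  define F where "F n = s(i := n)" for n
  have "exec \<beta>s (clear i) (F (s i)) (F 0)"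
    unfolding clear_def
  proof (rule exec_loop)
    fix n
    have "(F (Suc n))(i := n) = F n" by (simp add: F_def)
    then show "exec \<beta>s skip ((F (Suc n))(i := n)) (F n)" by (simp only: exec_skip)
  qed (simp add: F_def)
  then show ?thesis using assms by (simp add: F_def)
qed

definition move :: "nat \<Rightarrow> nat \<Rightarrow> fragment" where "move i j = loop i (incr j)"

lemma exec_moveI:
  assumes "i \<noteq> j" "s' = s(i := 0, j := s j + s i)" shows "exec \<beta>s (move i j) s s'"
proof -
  define F where "F n = s(i := n, j := s j + (s i - n))" for n
  have "exec \<beta>s (move i j) (F (s i)) (F 0)"
    unfolding move_def
  proof (rule exec_loop)
    fix n assume "n < s i"
    then show "exec \<beta>s (incr j) ((F (Suc n))(i := n)) (F n)"
      using assms(1) by (intro exec_incrI) (auto simp: F_def fun_eq_iff)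
  qed (use assms in \<open>simp add: F_def\<close>)
  then show ?thesis using assms by (simp add: F_def)
qed

text \<open>Counters can only be read by destroying them, hence the second copy in \<open>t\<close>, from which \<open>i\<close> is
restored.\<close>

definition copy :: "nat \<Rightarrow> nat \<Rightarrow> nat \<Rightarrow> fragment" where
  "copy i j t = loop i (incr j ;; incr t) ;; move t i"

lemma exec_copyI:
  assumes "i \<noteq> j" "i \<noteq> t" "j \<noteq> t" "s t = 0" "s' = s(j := s j + s i)"
  shows "exec \<beta>s (copy i j t) s s'"
proof -
  define F where "F n = s(i := n, j := s j + (s i - n), t := s i - n)" for n
  have e1: "exec \<beta>s (loop i (incr j ;; incr t)) (F (s i)) (F 0)"
  proof (rule exec_loop)
    fix n assume n: "n < s i"
    define u where "u = (F (Suc n))(i := n)"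
    have e1: "exec \<beta>s (incr j) u (u(j := Suc (u j)))" by (rule exec_incr)
    have e2: "exec \<beta>s (incr t) (u(j := Suc (u j))) (F n)"
      by (rule exec_incrI) (use n assms(1-3) in \<open>auto simp: u_def F_def fun_eq_iff\<close>)
    show "exec \<beta>s (incr j ;; incr t) ((F (Suc n))(i := n)) (F n)"
      using exec_seq[OF e1 e2] unfolding u_def .
  qed (use assms in \<open>simp add: F_def\<close>)
  have e2: "exec \<beta>s (move t i) (F 0) s'"
    by (rule exec_moveI) (use assms in \<open>auto simp: F_def fun_eq_iff\<close>)
  have "F (s i) = s" using assms by (auto simp: F_def fun_eq_iff)
  then show ?thesis using exec_seq[OF e1 e2] by (simp add: copy_def)
qed

lemma realizable_id: "realizable \<beta>s (\<lambda>x. x)"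
  unfolding realizable_def implements_def by (auto intro: exec_skip)

lemma realizable_comp:
  assumes "realizable \<beta>s f" "realizable \<beta>s g" shows "realizable \<beta>s (\<lambda>x. f (g x))"
  unfolding realizable_def
proof
  fix d
  obtain c c' where c: "implements \<beta>s d c f" "implements \<beta>s d c' g"
    using assms unfolding realizable_def by blast
  have "implements \<beta>s d (c' ;; c) (\<lambda>x. f (g x))"
    unfolding implements_def
  proof (intro allI impI)
    fix s :: "nat \<Rightarrow> nat" assume s: "\<forall>i>d. s i = 0"
    have e1: "exec \<beta>s c' s (s(d := g (s d)))" using c(2) s by (simp add: implements_def)
    have e2: "exec \<beta>s c (s(d := g (s d))) (s(d := f (g (s d))))"
      using c(1) s unfolding implements_def by (elim allE[of _ "s(d := g (s d))"]) simp
    show "exec \<beta>s (c' ;; c) s (s(d := f (g (s d))))" by (rule exec_seq[OF e1 e2])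
  qed
  then show "\<exists>c. implements \<beta>s d c (\<lambda>x. f (g x))"
    by (rule exI[of _ "c' ;; c"])
qed

lemma realizableI:
  "(\<And>d s. \<forall>i>d. s i = 0 \<Longrightarrow> exec \<beta>s (c d) s (s(d := f (s d)))) \<Longrightarrow> realizable \<beta>s f"
  unfolding realizable_def implements_def by blast

lemma realizable_zero: "realizable \<beta>s (\<lambda>_. 0)"
  by (rule realizableI[of _ clear], rule exec_clearI, simp)

lemma realizable_Suc: "realizable \<beta>s Suc"
  by (rule realizableI[of _ incr], rule exec_incr)

lemma realizable_const: "realizable \<beta>s (\<lambda>_. n)"
proof (induction n)
  case (Suc n) then show ?case using realizable_comp[OF realizable_Suc] by simp
qed (rule realizable_zero)

text \<open>The walk through all pairs in the order of \<^const>\<open>prod_encode\<close>. Counting \<open>n\<close> steps from the origin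
decodes \<open>n\<close> without any arithmetic.\<close>

definition unpair_step :: "nat \<times> nat \<Rightarrow> nat \<times> nat" where
  "unpair_step p = (case p of (a, 0) \<Rightarrow> (0, Suc a) | (a, Suc b) \<Rightarrow> (Suc a, b))"

lemma prod_encode_unpair_step: "prod_encode (unpair_step p) = Suc (prod_encode p)"
  by (cases p; cases "snd p") (auto simp: unpair_step_def prod_encode_def)

lemma funpow_unpair_step: "(unpair_step ^^ n) (0, 0) = prod_decode n"
proof -
  have "prod_encode ((unpair_step ^^ n) (0, 0)) = n"
    by (induction n) (auto simp: prod_encode_unpair_step, simp add: prod_encode_def)
  then show ?thesis by (metis prod_encode_inverse)
qed

definition unpair :: "nat \<Rightarrow> fragment" where
  "unpair d = loop d (branch (d + 2) (incr (d + 1)) (move (d + 1) (d + 2) ;; incr (d + 2)))"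

lemma exec_unpair:
  assumes "\<forall>i>d. s i = 0"
  shows "exec \<beta>s (unpair d) s
    (s(d := 0, d + 1 := fst (prod_decode (s d)), d + 2 := snd (prod_decode (s d))))"
proof -
  define F where "F n =
    s(d := n, d + 1 := fst (prod_decode (s d - n)), d + 2 := snd (prod_decode (s d - n)))" for n
  have "exec \<beta>s (unpair d) (F (s d)) (F 0)"
    unfolding unpair_def
  proof (rule exec_loop)
    fix n assume n: "n < s d"
    obtain a b where p: "prod_decode (s d - Suc n) = (a, b)" by fastforce
    have "prod_decode (s d - n) = (unpair_step ^^ Suc (s d - Suc n)) (0, 0)"
      using n by (simp only: funpow_unpair_step Suc_diff_Suc)
    also have "\<dots> = unpair_step (a, b)"
      by (simp only: funpow.simps o_apply funpow_unpair_step p)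
    finally have q: "prod_decode (s d - n) = unpair_step (a, b)" .
    define u where "u = s(d := n, d + 1 := a, d + 2 := b)"
    have u: "(F (Suc n))(d := n) = u"
      by (simp add: F_def p fun_eq_iff u_def)
    show "exec \<beta>s (branch (d + 2) (incr (d + 1)) (move (d + 1) (d + 2) ;; incr (d + 2)))
        ((F (Suc n))(d := n)) (F n)"
    proof (cases b)
      case 0
      have e1: "exec \<beta>s (move (d + 1) (d + 2)) u (u(d + 1 := 0, d + 2 := a))"
        by (rule exec_moveI) (simp_all add: u_def 0 fun_eq_iff)
      have e2: "exec \<beta>s (incr (d + 2)) (u(d + 1 := 0, d + 2 := a)) (F n)"
        by (rule exec_incrI) (simp add: u_def F_def q 0 unpair_step_def fun_eq_iff)
      show ?thesis unfolding u
        by (rule exec_branch_zero[OF _ exec_seq[OF e1 e2]]) (simp add: u_def 0)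
    next
      case (Suc b')
      have e: "exec \<beta>s (incr (d + 1)) (u(d + 2 := b')) (F n)"
        by (rule exec_incrI) (simp add: u_def F_def q Suc unpair_step_def fun_eq_iff)
      show ?thesis unfolding u by (rule exec_branch_Suc[OF _ e]) (simp add: u_def Suc)
    qed
  qed (simp add: F_def)
  moreover have "prod_decode 0 = (0, 0)" using funpow_unpair_step[of 0] by simp
  then have "F (s d) = s" using assms by (simp add: F_def fun_eq_iff)
  ultimately show ?thesis by (simp add: F_def)
qed

lemma realizable_fst: "realizable \<beta>s (\<lambda>x. fst (prod_decode x))"
proof (rule realizableI)
  fix d and s :: "nat \<Rightarrow> nat" assume s: "\<forall>i>d. s i = 0"
  let ?s1 = "s(d := 0, d + 1 := fst (prod_decode (s d)), d + 2 := snd (prod_decode (s d)))"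
  let ?s2 = "?s1(d + 2 := 0)" and ?s3 = "s(d := fst (prod_decode (s d)))"
  have e1: "exec \<beta>s (unpair d) s ?s1" by (rule exec_unpair[OF s])
  have e2: "exec \<beta>s (clear (d + 2)) ?s1 ?s2" by (rule exec_clearI) simp
  have e3: "exec \<beta>s (move (d + 1) d) ?s2 ?s3"
    by (rule exec_moveI) (use s in \<open>simp_all add: fun_eq_iff\<close>)
  from exec_seq[OF e1 exec_seq[OF e2 e3]]
  show "exec \<beta>s (unpair d ;; clear (d + 2) ;; move (d + 1) d) s ?s3" .
qed

lemma realizable_snd: "realizable \<beta>s (\<lambda>x. snd (prod_decode x))"
proof (rule realizableI)
  fix d and s :: "nat \<Rightarrow> nat" assume s: "\<forall>i>d. s i = 0"
  let ?s1 = "s(d := 0, d + 1 := fst (prod_decode (s d)), d + 2 := snd (prod_decode (s d)))"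
  let ?s2 = "?s1(d + 1 := 0)" and ?s3 = "s(d := snd (prod_decode (s d)))"
  have e1: "exec \<beta>s (unpair d) s ?s1" by (rule exec_unpair[OF s])
  have e2: "exec \<beta>s (clear (d + 1)) ?s1 ?s2" by (rule exec_clearI) simp
  have e3: "exec \<beta>s (move (d + 2) d) ?s2 ?s3"
    by (rule exec_moveI) (use s in \<open>simp_all add: fun_eq_iff\<close>)
  from exec_seq[OF e1 exec_seq[OF e2 e3]]
  show "exec \<beta>s (unpair d ;; clear (d + 1) ;; move (d + 2) d) s ?s3" .
qed

text \<open>Since \<open>prod_encode (m, n) = triangle (m + n) + m\<close>, encoding a pair comes down to adding a triangular
number to register \<open>d\<close>; each pass of the loop adds one row of the triangle, with \<open>t\<close> as scratch.\<close>

definition add_triangle :: "nat \<Rightarrow> nat \<Rightarrow> nat \<Rightarrow> fragment" where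
  "add_triangle e d t = loop e (incr d ;; copy e d t)"

lemma exec_add_triangle:
  assumes "e \<noteq> d" "e \<noteq> t" "d \<noteq> t" "s t = 0" "s' = s(e := 0, d := s d + triangle (s e))"
  shows "exec \<beta>s (add_triangle e d t) s s'"
proof -
  define F where "F n = s(e := n, d := s d + (triangle (s e) - triangle n))" for n
  have mono: "triangle m \<le> triangle n" if "m \<le> n" for m n
    using that by (induction rule: dec_induct) auto
  have "exec \<beta>s (add_triangle e d t) (F (s e)) (F 0)"
    unfolding add_triangle_def
  proof (rule exec_loop)
    fix n assume n: "n < s e"
    define u where "u = (F (Suc n))(e := n)"
    have le: "triangle (Suc n) \<le> triangle (s e)" using n by (intro mono) simp
    have e1: "exec \<beta>s (incr d) u (u(d := Suc (u d)))" by (rule exec_incr)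
    have e2: "exec \<beta>s (copy e d t) (u(d := Suc (u d))) (F n)"
      by (rule exec_copyI) (use assms(1-4) le in \<open>auto simp: u_def F_def fun_eq_iff\<close>)
    show "exec \<beta>s (incr d ;; copy e d t) ((F (Suc n))(e := n)) (F n)"
      using exec_seq[OF e1 e2] unfolding u_def .
  qed (use assms in \<open>simp add: F_def\<close>)
  then show ?thesis using assms by (simp add: F_def)
qed

lemma realizable_pair:
  assumes "realizable \<beta>s f" "realizable \<beta>s g"
  shows "realizable \<beta>s (\<lambda>x. prod_encode (f x, g x))"
  unfolding realizable_def
proof
  fix d
  obtain c c' where c: "implements \<beta>s (d + 1) c f" "implements \<beta>s (d + 2) c' g"
    using assms unfolding realizable_def by blast
  let ?c = "copy d (d + 1) (d + 2) ;; c ;; copy d (d + 2) (d + 3) ;; c' ;; clear d ;;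
    copy (d + 1) d (d + 3) ;; move (d + 1) (d + 2) ;; add_triangle (d + 2) d (d + 3)"
  have "implements \<beta>s d ?c (\<lambda>x. prod_encode (f x, g x))"
    unfolding implements_def
  proof (intro allI impI)
    fix s :: "nat \<Rightarrow> nat" assume s: "\<forall>i>d. s i = 0"
    define x where "x = s d"
    let ?s1 = "s(d + 1 := x)" and ?s2 = "s(d + 1 := f x)"
    let ?s3 = "?s2(d + 2 := x)" and ?s4 = "?s2(d + 2 := g x)"
    let ?s5 = "?s4(d := 0)" and ?s6 = "?s4(d := f x)"
    let ?s7 = "s(d := f x, d + 2 := f x + g x)"
    have e1: "exec \<beta>s (copy d (d + 1) (d + 2)) s ?s1"
      by (rule exec_copyI) (use s in \<open>simp_all add: x_def\<close>)
    have e2: "exec \<beta>s c ?s1 ?s2"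
      using c(1) s unfolding implements_def by (elim allE[of _ ?s1]) simp
    have e3: "exec \<beta>s (copy d (d + 2) (d + 3)) ?s2 ?s3"
      by (rule exec_copyI) (use s in \<open>simp_all add: x_def\<close>)
    have e4: "exec \<beta>s c' ?s3 ?s4"
      using c(2) s unfolding implements_def by (elim allE[of _ ?s3]) simp
    have e5: "exec \<beta>s (clear d) ?s4 ?s5" by (rule exec_clearI) simp
    have e6: "exec \<beta>s (copy (d + 1) d (d + 3)) ?s5 ?s6"
      by (rule exec_copyI) (use s in simp_all)
    have e7: "exec \<beta>s (move (d + 1) (d + 2)) ?s6 ?s7"
      by (rule exec_moveI) (use s in \<open>simp_all add: fun_eq_iff\<close>)
    have e8: "exec \<beta>s (add_triangle (d + 2) d (d + 3)) ?s7 (s(d := prod_encode (f x, g x)))"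
      by (rule exec_add_triangle) (use s in \<open>simp_all add: fun_eq_iff prod_encode_def\<close>)
    show "exec \<beta>s ?c s (s(d := prod_encode (f (s d), g (s d))))"
      using exec_seq[OF e1 exec_seq[OF e2 exec_seq[OF e3 exec_seq[OF e4 exec_seq[OF e5
        exec_seq[OF e6 exec_seq[OF e7 e8]]]]]]] unfolding x_def .
  qed
  then show "\<exists>c. implements \<beta>s d c (\<lambda>x. prod_encode (f x, g x))"
    by (rule exI[of _ "?c"])
qed

text \<open>Iteration is the only recursion scheme that has to be programmed. With pairs, it yields primitive
recursion.\<close>

lemma realizable_funpow:
  assumes "realizable \<beta>s f"
  shows "realizable \<beta>s (\<lambda>z. (f ^^ fst (prod_decode z)) (snd (prod_decode z)))"
  unfolding realizable_def
proof
  fix d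
  obtain c where c: "implements \<beta>s (d + 2) c f"
    using assms unfolding realizable_def by blast
  let ?c = "unpair d ;; loop (d + 1) c ;; move (d + 2) d"
  have "implements \<beta>s d ?c (\<lambda>z. (f ^^ fst (prod_decode z)) (snd (prod_decode z)))"
    unfolding implements_def
  proof (intro allI impI)
    fix s :: "nat \<Rightarrow> nat" assume s: "\<forall>i>d. s i = 0"
    obtain N x where z: "prod_decode (s d) = (N, x)" by fastforce
    define F where "F n = s(d := 0, d + 1 := n, d + 2 := (f ^^ (N - n)) x)" for n
    have e1: "exec \<beta>s (unpair d) s (F N)"
      using exec_unpair[OF s, of \<beta>s] by (simp add: z F_def)
    have e2: "exec \<beta>s (loop (d + 1) c) (F N) (F 0)"
    proof (rule exec_loop)
      fix n assume n: "n < N"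
      define u where "u = (F (Suc n))(d + 1 := n)"
      have "N - n = Suc (N - Suc n)" using n by simp
      then have "u(d + 2 := f (u (d + 2))) = F n" by (simp add: u_def F_def fun_eq_iff)
      moreover have "\<forall>i>d + 2. u i = 0" using s by (simp add: u_def F_def)
      ultimately show "exec \<beta>s c ((F (Suc n))(d + 1 := n)) (F n)"
        using c unfolding implements_def u_def by metis
    qed (auto simp: F_def)
    have e3: "exec \<beta>s (move (d + 2) d) (F 0) (s(d := (f ^^ N) x))"
      by (rule exec_moveI) (use s in \<open>simp_all add: F_def fun_eq_iff\<close>)
    show "exec \<beta>s ?c s (s(d := (f ^^ fst (prod_decode (s d))) (snd (prod_decode (s d)))))"
      using exec_seq[OF e1 exec_seq[OF e2 e3]] by (simp only: z fst_conv snd_conv)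
  qed
  then show "\<exists>c. implements \<beta>s d c (\<lambda>z. (f ^^ fst (prod_decode z)) (snd (prod_decode z)))"
    by (rule exI[of _ "?c"])
qed

lemma realizable_oracle:
  assumes "k < length \<beta>s" shows "realizable \<beta>s (\<lambda>m. (\<beta>s ! k) !! m)"
  unfolding realizable_def
proof
  fix d
  \<comment> \<open>A query reads the index of the sequence off a tape; \<open>k\<close> increments put it there.\<close>
  let ?m = "\<lambda>d. ((;;) (incr (d + 1)) ^^ k) skip"
  let ?c = "\<lambda>d. ?m d ;; query (d + 1) d d ;; clear (d + 1)"
  have "implements \<beta>s d (?c d) (\<lambda>m. (\<beta>s ! k) !! m)"
    unfolding implements_def
  proof (intro allI impI)
    fix s :: "nat \<Rightarrow> nat" assume s: "\<forall>i>d. s i = 0"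
    have "exec \<beta>s (((;;) (incr (d + 1)) ^^ n) skip) (s(d + 1 := i)) (s(d + 1 := i + n))" for n i
    proof (induction n arbitrary: i)
      case 0 then show ?case by (simp add: exec_skip)
    next
      case (Suc n)
      have "exec \<beta>s (incr (d + 1)) (s(d + 1 := i)) (s(d + 1 := Suc i))"
        using exec_incr[of \<beta>s "d + 1" "s(d + 1 := i)"] by simp
      from exec_seq[OF this Suc[of "Suc i"]] show ?case
        by (simp del: fun_upd_apply)
    qed
    from this[of k 0] have e1: "exec \<beta>s (?m d) s (s(d + 1 := k))" using s by (simp add: fun_upd_idem)
    let ?s = "s(d + 1 := k, d := (\<beta>s ! k) !! s d)"
    have e2: "exec \<beta>s (query (d + 1) d d) (s(d + 1 := k)) ?s"
      using exec_query[of "s(d + 1 := k)" "d + 1" \<beta>s d d] assms by simp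
    have e3: "exec \<beta>s (clear (d + 1)) ?s (s(d := (\<beta>s ! k) !! s d))"
      by (rule exec_clearI) (use s in \<open>simp add: fun_eq_iff\<close>)
    show "exec \<beta>s (?c d) s (s(d := (\<beta>s ! k) !! s d))"
      by (rule exec_seq[OF e1 exec_seq[OF e2 e3]])
  qed
  then show "\<exists>c. implements \<beta>s d c (\<lambda>m. (\<beta>s ! k) !! m)"
    by (rule exI[of _ "?c d"])
qed

text \<open>Acceptance is halting, so the program for \<open>f\<close> is followed by one instruction that loops on
itself as long as it scans a blank on the output tape.\<close>

lemma machine_of_realizable:
  assumes "realizable \<beta>s f"
  shows "\<exists>M. \<forall>x. accepts M \<beta>s x \<longleftrightarrow> f x > 0"
proof -
  obtain c where c: "implements \<beta>s 0 c f" using assms unfolding realizable_def by blast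
  define n where "n = length (c 0)"
  \<comment> \<open>State \<open>n\<close> is the added instruction; its exit \<open>Suc n\<close> is the first halting state.\<close>
  define M where "M = c 0 @ [Scan 0 (Erase, n) (Mark, Suc n)]"
  have "accepts M \<beta>s x \<longleftrightarrow> f x > 0" for x
  proof -
    let ?s = "(\<lambda>_. 0)(0 := x)"
    have "exec \<beta>s c ?s (?s(0 := f x))"
      using c unfolding implements_def by (elim allE[of _ ?s]) simp
    then have "reaches M \<beta>s 0 ?s n (?s(0 := f x))"
      using occurs_at_self unfolding exec_def M_def n_def by force
    moreover have "\<forall>i. holds_number (((\<lambda>_. block 0)(0 := block x)) i) (?s i)"
      using holds_number_block by simp
    ultimately obtain T where T: "(step M \<beta>s)\<^sup>*\<^sup>* (initial x) (n, T)"
        "\<forall>i. holds_number (T i) ((?s(0 := f x)) i)"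
      unfolding reaches_def initial_def by blast
    have M: "n < length M" "M ! n = Scan 0 (Erase, n) (Mark, Suc n)" 
      by (auto simp: M_def n_def)
    show ?thesis
    proof (cases "f x")
      case 0
      have inv: "fst c = n \<and> \<not> scanned (snd c 0)"
        if "(step M \<beta>s)\<^sup>*\<^sup>* (n, T) c" for c
        using that
      proof (induction rule: rtranclp_induct)
        case base
        then show ?case using T(2) 0 scanned_holds_number[of "T 0" 0] by (auto dest: spec[of _ 0])
      next
        case (step c c')
        obtain T' where c: "c = (n, T')" "\<not> scanned (T' 0)" using step by (cases c) auto
        obtain l r where lr: "T' 0 = (l, r)" by fastforce
        have "step M \<beta>s c (n, T'(0 := perform Erase (T' 0)))"
          unfolding c(1) by (rule step.scan_blank[OF M]) (rule c)
        then have "c' = (n, T'(0 := perform Erase (T' 0)))"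
          using step(2) step_deterministic by blast
        then show ?case by (simp add: lr)
      qed
      have "\<not> accepts M \<beta>s x"
      proof
        assume "accepts M \<beta>s x"
        then obtain q T' where h: "(step M \<beta>s)\<^sup>*\<^sup>* (initial x) (q, T')" "length M \<le> q"
          unfolding accepts_def computes_def by blast
        have stuck: "\<not> step M \<beta>s (q, T') d" for d using h(2) by (auto elim: step.cases)
        have "(step M \<beta>s)\<^sup>*\<^sup>* (n, T) (q, T') \<or> (step M \<beta>s)\<^sup>*\<^sup>* (q, T') (n, T)"
          using h(1) T(1)
        proof (induction rule: rtranclp_induct)
          case (step y z)
          then show ?case by (metis converse_rtranclpE step_deterministic rtranclp.rtrancl_into_rtrancl)
        qed blast
        then have "(step M \<beta>s)\<^sup>*\<^sup>* (n, T) (q, T')"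
          using stuck by (metis converse_rtranclpE rtranclp.rtrancl_refl)
        from inv[OF this] have "q = n" by simp
        then show False using h(2) M by simp
      qed
      with 0 show ?thesis by simp
    next
      case (Suc m)
      have "scanned (T 0)" using T(2) Suc scanned_holds_number[of "T 0"] by (auto dest: spec[of _ 0])
      then have "step M \<beta>s (n, T) (Suc n, T(0 := perform Mark (T 0)))"
        by (rule step.scan_stroke[OF M])
      then have "(step M \<beta>s)\<^sup>*\<^sup>* (initial x) (Suc n, T(0 := perform Mark (T 0)))"
        using T(1) by (rule rtranclp.rtrancl_into_rtrancl[rotated])
      moreover have "length M = Suc n" by (simp add: M_def n_def)
      ultimately show ?thesis using Suc unfolding accepts_def computes_def by auto
    qed
  qed
  then show ?thesis by blast
qed

section \<open>Closure properties of computability\<close>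

text \<open>Truth values are finite objects, so that decidable predicates are computable functions.\<close>

instantiation bool :: finite_object
begin
definition "encode (b :: bool) = (if b then 1 else 0 :: nat)"
instance by standard (auto simp: encode_bool_def inj_def split: if_splits)
end

text \<open>Computability of functions between arbitrary finite objects, by way of their codes. The rules
collected in \<open>computable\<close> follow the syntax of a term; applying them as introduction rules proves that a concrete function
is computable. Bound variables are handled by passing to a pair of environment and variable.\<close>

definition computable_in :: "nat stream list \<Rightarrow> ('a::finite_object \<Rightarrow> 'b::finite_object) \<Rightarrow> bool" where
  "computable_in \<beta>s f \<longleftrightarrow> (\<exists>g. realizable \<beta>s g \<and> (\<forall>x. g (encode x) = encode (f x)))"

named_theorems computable

lemma encode_Nil: "encode ([] :: 'a::finite_object list) = 0"
  by (simp add: encode_list_def)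

lemma encode_Cons: "encode (x # xs) = Suc (prod_encode (encode x, encode xs))"
  by (simp add: encode_list_def)

lemma encode_Pair: "encode (x, y) = prod_encode (encode x, encode y)"
  by (simp add: encode_prod_def)

lemma length_le_encode: "length xs \<le> encode xs"
  by (induction xs) (auto simp: encode_Nil encode_Cons intro: order_trans[OF _ le_prod_encode_2])

lemma computable_comp:
  assumes "computable_in \<beta>s f" "computable_in \<beta>s g"
  shows "computable_in \<beta>s (\<lambda>x. f (g x))"
proof -
  obtain f' g' where "realizable \<beta>s f'" "\<forall>x. f' (encode x) = encode (f x)"
      "realizable \<beta>s g'" "\<forall>x. g' (encode x) = encode (g x)"
    using assms unfolding computable_in_def by blast
  then show ?thesis
    unfolding computable_in_def using realizable_comp[of \<beta>s f' g']
    by (intro exI[of _ "\<lambda>x. f' (g' x)"]) simp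
qed

lemma computable_id [computable]: "computable_in \<beta>s (\<lambda>x. x)"
  unfolding computable_in_def by (intro exI[of _ "\<lambda>x. x"]) (simp add: realizable_id)

lemma computable_const [computable]: "computable_in \<beta>s (\<lambda>_. c)"
  unfolding computable_in_def by (intro exI[of _ "\<lambda>_. encode c"]) (simp add: realizable_const)

lemma computable_Pair [computable]:
  assumes "computable_in \<beta>s f" "computable_in \<beta>s g"
  shows "computable_in \<beta>s (\<lambda>x. (f x, g x))"
proof -
  obtain f' g' where "realizable \<beta>s f'" "\<forall>x. f' (encode x) = encode (f x)"
      "realizable \<beta>s g'" "\<forall>x. g' (encode x) = encode (g x)"
    using assms unfolding computable_in_def by blast
  then show ?thesis
    unfolding computable_in_def using realizable_pair[of \<beta>s f' g']
    by (intro exI[of _ "\<lambda>x. prod_encode (f' x, g' x)"]) (simp add: encode_Pair)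
qed

lemma computable_fst [computable]:
  assumes "computable_in \<beta>s f" shows "computable_in \<beta>s (\<lambda>x. fst (f x))"
  by (rule computable_comp[OF _ assms])
    (auto simp: computable_in_def encode_Pair intro!: exI[of _ "\<lambda>x. fst (prod_decode x)"] realizable_fst)

lemma computable_snd [computable]:
  assumes "computable_in \<beta>s f" shows "computable_in \<beta>s (\<lambda>x. snd (f x))"
  by (rule computable_comp[OF _ assms])
    (auto simp: computable_in_def encode_Pair intro!: exI[of _ "\<lambda>x. snd (prod_decode x)"] realizable_snd)

lemma computable_encode [computable]:
  assumes "computable_in \<beta>s f" shows "computable_in \<beta>s (\<lambda>x. encode (f x))"
  using assms unfolding computable_in_def by (simp add: encode_nat_def)

lemma computable_if_encode: "computable_in \<beta>s (\<lambda>x. encode (f x)) \<Longrightarrow> computable_in \<beta>s f"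
  unfolding computable_in_def by (simp add: encode_nat_def)

lemma computable_nat_iff: "computable_in \<beta>s (f :: nat \<Rightarrow> nat) \<longleftrightarrow> realizable \<beta>s f"
proof
  assume "computable_in \<beta>s f"
  then obtain g where g: "realizable \<beta>s g" "\<And>x. g x = f x"
    unfolding computable_in_def by (auto simp: encode_nat_def)
  have "g = f" using g(2) by (rule ext)
  with g(1) show "realizable \<beta>s f" by simp
qed (auto simp: computable_in_def encode_nat_def)

lemma computable_of_codes:
  fixes F :: "nat \<Rightarrow> nat"
  assumes "computable_in \<beta>s F" "\<And>x. F (encode x) = encode (f x)"
  shows "computable_in \<beta>s f"
  using assms unfolding computable_nat_iff computable_in_def by blast

lemma computable_on_codes:
  assumes "computable_in \<beta>s f"
  obtains F :: "nat \<Rightarrow> nat" where "computable_in \<beta>s F" "\<And>x. F (encode x) = encode (f x)"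
  using assms unfolding computable_nat_iff computable_in_def by blast

lemma computable_Suc [computable]:
  assumes "computable_in \<beta>s f" shows "computable_in \<beta>s (\<lambda>x. Suc (f x))"
  by (rule computable_comp[OF _ assms]) (simp add: computable_nat_iff realizable_Suc)

lemma computable_oracle [computable]:
  assumes "k < length \<beta>s" "computable_in \<beta>s n"
  shows "computable_in \<beta>s (\<lambda>x. (\<beta>s ! k) !! (n x))"
  by (rule computable_comp[OF _ assms(2)]) (simp add: computable_nat_iff realizable_oracle assms(1))

lemma computable_funpow [computable]:
  fixes f :: "'a::finite_object \<Rightarrow> 'a"
  assumes "computable_in \<beta>s f" "computable_in \<beta>s n" "computable_in \<beta>s g"
  shows "computable_in \<beta>s (\<lambda>x. (f ^^ n x) (g x))"
proof -
  obtain F :: "nat \<Rightarrow> nat" where F: "computable_in \<beta>s F" "\<And>x. F (encode x) = encode (f x)"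
    using assms(1) computable_on_codes by blast
  have *: "(F ^^ k) (encode x) = encode ((f ^^ k) x)" for k x
    by (induction k) (simp_all add: F(2))
  have "computable_in \<beta>s (\<lambda>p::nat \<times> 'a. (f ^^ fst p) (snd p))"
    by (rule computable_of_codes[where F = "\<lambda>z. (F ^^ fst (prod_decode z)) (snd (prod_decode z))"])
      (use F in \<open>auto simp: computable_nat_iff realizable_funpow encode_Pair encode_nat_def *\<close>)
  from computable_comp[OF this computable_Pair[OF assms(2,3)]] show ?thesis by simp
qed

text \<open>The iterated state carries the environment and the counter next to the value under
construction.\<close>

lemma computable_rec_nat [computable]:
  assumes g: "computable_in \<beta>s g"
    and h: "computable_in \<beta>s (\<lambda>p. h (fst p) (fst (snd p)) (snd (snd p)))"
    and n: "computable_in \<beta>s n"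
  shows "computable_in \<beta>s (\<lambda>x. rec_nat (g x) (\<lambda>k r. h x k r) (n x))"
proof -
  let ?S = "\<lambda>p. (fst p, Suc (fst (snd p)), h (fst p) (fst (snd p)) (snd (snd p)))"
  have eq: "(?S ^^ k) (x, 0, g x) = (x, k, rec_nat (g x) (\<lambda>k r. h x k r) k)" for k x
    by (induction k) auto
  have "computable_in \<beta>s (\<lambda>x. snd (snd ((?S ^^ n x) (x, 0, g x))))"
    by (intro computable g n computable_Pair[OF _ computable_Pair[OF _ h]])
  then show ?thesis by (simp only: eq snd_conv)
qed

lemma computable_pred [computable]:
  assumes "computable_in \<beta>s f" shows "computable_in \<beta>s (\<lambda>x. f x - Suc 0)"
proof -
  have eq: "rec_nat 0 (\<lambda>k r. k) n = n - Suc 0" for n by (cases n) auto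
  have "computable_in \<beta>s (\<lambda>x. rec_nat 0 (\<lambda>k r. k) (f x))" by (intro computable assms)
  then show ?thesis by (simp only: eq)
qed

lemma computable_add [computable]:
  fixes f g :: "'a::finite_object \<Rightarrow> nat"
  assumes "computable_in \<beta>s f" "computable_in \<beta>s g" shows "computable_in \<beta>s (\<lambda>x. f x + g x)"
proof -
  have eq: "rec_nat m (\<lambda>k r. Suc r) n = m + n" for m n by (induction n) auto
  have "computable_in \<beta>s (\<lambda>x. rec_nat (f x) (\<lambda>k r. Suc r) (g x))" by (intro computable assms)
  then show ?thesis by (simp only: eq)
qed

lemma computable_diff [computable]:
  fixes f g :: "'a::finite_object \<Rightarrow> nat"
  assumes "computable_in \<beta>s f" "computable_in \<beta>s g" shows "computable_in \<beta>s (\<lambda>x. f x - g x)"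
proof -
  have eq: "rec_nat m (\<lambda>k r. r - Suc 0) n = m - n" for m n by (induction n) auto
  have "computable_in \<beta>s (\<lambda>x. rec_nat (f x) (\<lambda>k r. r - Suc 0) (g x))" by (intro computable assms)
  then show ?thesis by (simp only: eq)
qed

lemma computable_mult [computable]:
  fixes f g :: "'a::finite_object \<Rightarrow> nat"
  assumes "computable_in \<beta>s f" "computable_in \<beta>s g" shows "computable_in \<beta>s (\<lambda>x. f x * g x)"
proof -
  have eq: "rec_nat 0 (\<lambda>k r. r + m) n = m * n" for m n :: nat by (induction n) auto
  have "computable_in \<beta>s (\<lambda>x. rec_nat 0 (\<lambda>k r. r + f x) (g x))" by (intro computable assms computable_comp[OF assms(1)])
  then show ?thesis by (simp only: eq)
qed

lemma computable_power [computable]: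
  fixes f g :: "'a::finite_object \<Rightarrow> nat"
  assumes "computable_in \<beta>s f" "computable_in \<beta>s g" shows "computable_in \<beta>s (\<lambda>x. f x ^ g x)"
proof -
  have eq: "rec_nat 1 (\<lambda>k r. r * m) n = m ^ n" for m n :: nat by (induction n) auto
  have "computable_in \<beta>s (\<lambda>x. rec_nat 1 (\<lambda>k r. r * f x) (g x))" by (intro computable assms computable_comp[OF assms(1)])
  then show ?thesis by (simp only: eq)
qed

lemma computable_positive [computable]:
  assumes "computable_in \<beta>s f" shows "computable_in \<beta>s (\<lambda>x. 0 < (f x :: nat))"
proof (rule computable_if_encode)
  have eq: "rec_nat 0 (\<lambda>k r. 1) n = encode (0 < n)" for n
    by (cases n) (auto simp: encode_bool_def)
  have "computable_in \<beta>s (\<lambda>x. rec_nat (0::nat) (\<lambda>k r. 1) (f x))" by (intro computable assms)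
  then show "computable_in \<beta>s (\<lambda>x. encode (0 < f x))" by (simp only: eq)
qed

lemma computable_If [computable]:
  assumes "computable_in \<beta>s b" "computable_in \<beta>s f" "computable_in \<beta>s g"
  shows "computable_in \<beta>s (\<lambda>x. if b x then f x else g x)"
proof -
  have eq: "rec_nat v (\<lambda>k r. u) (encode c) = (if c then u else v)" for c u v
    by (auto simp: encode_bool_def)
  have "computable_in \<beta>s (\<lambda>x. rec_nat (g x) (\<lambda>k r. f x) (encode (b x)))"
    by (intro computable assms computable_comp[OF assms(2)])
  then show ?thesis by (simp only: eq)
qed

lemma computable_not [computable]:
  assumes "computable_in \<beta>s b" shows "computable_in \<beta>s (\<lambda>x. \<not> b x)"
proof -
  have "computable_in \<beta>s (\<lambda>x. if b x then False else True)" by (intro computable assms)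
  moreover have "(if c then False else True) = (\<not> c)" for c by simp
  ultimately show ?thesis by (simp only:)
qed

lemma computable_conj [computable]:
  assumes "computable_in \<beta>s b" "computable_in \<beta>s c" shows "computable_in \<beta>s (\<lambda>x. b x \<and> c x)"
proof -
  have "computable_in \<beta>s (\<lambda>x. if b x then c x else False)" by (intro computable assms)
  moreover have "(if u then v else False) \<longleftrightarrow> u \<and> v" for u v by simp
  ultimately show ?thesis by (simp only:)
qed

lemma computable_disj [computable]:
  assumes "computable_in \<beta>s b" "computable_in \<beta>s c" shows "computable_in \<beta>s (\<lambda>x. b x \<or> c x)"
proof -
  have "computable_in \<beta>s (\<lambda>x. if b x then True else c x)" by (intro computable assms)
  moreover have "(if u then True else v) \<longleftrightarrow> u \<or> v" for u v by simp
  ultimately show ?thesis by (simp only:)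
qed

lemma computable_less [computable]:
  fixes f g :: "'a::finite_object \<Rightarrow> nat"
  assumes "computable_in \<beta>s f" "computable_in \<beta>s g" shows "computable_in \<beta>s (\<lambda>x. f x < g x)"
proof -
  have "computable_in \<beta>s (\<lambda>x. 0 < g x - f x)" by (intro computable assms)
  then show ?thesis by simp
qed

lemma computable_le [computable]:
  fixes f g :: "'a::finite_object \<Rightarrow> nat"
  assumes "computable_in \<beta>s f" "computable_in \<beta>s g" shows "computable_in \<beta>s (\<lambda>x. f x \<le> g x)"
proof -
  have "computable_in \<beta>s (\<lambda>x. \<not> g x < f x)" by (intro computable assms)
  then show ?thesis by (simp add: not_less)
qed

lemma computable_eq [computable]:
  assumes "computable_in \<beta>s f" "computable_in \<beta>s g" shows "computable_in \<beta>s (\<lambda>x. f x = g x)"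
proof -
  have eq: "encode a \<le> encode b \<and> encode b \<le> encode a \<longleftrightarrow> a = b" for a b :: 'b
    using injD[OF inj_encode, of a b] by auto
  have "computable_in \<beta>s (\<lambda>x. encode (f x) \<le> encode (g x) \<and> encode (g x) \<le> encode (f x))"
    by (intro computable assms)
  then show ?thesis by (simp only: eq)
qed

lemma computable_div [computable]:
  fixes f g :: "'a::finite_object \<Rightarrow> nat"
  assumes "computable_in \<beta>s f" "computable_in \<beta>s g" shows "computable_in \<beta>s (\<lambda>x. f x div g x)"
proof -
  have eq: "rec_nat 0 (\<lambda>k r. if Suc r * m \<le> Suc k then Suc r else r) n = n div m" if "m > 0" for m n :: nat
  proof (induction n)
    case (Suc n)
    have "n div m * m \<le> n" "n < Suc (n div m) * m"
      using that by (auto simp: dividend_less_div_times)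
    show ?case
    proof (cases "Suc (n div m) * m \<le> Suc n")
      case True
      then have "Suc n = Suc (n div m) * m" using \<open>n < Suc (n div m) * m\<close> by linarith
      then have "Suc n div m = Suc (n div m)" using that by (metis nonzero_mult_div_cancel_right less_irrefl)
      then show ?thesis using True Suc by simp
    next
      case False
      then have "Suc n div m = n div m"
        using le_SucI[OF \<open>n div m * m \<le> n\<close>] that
        by (intro div_nat_eqI) (simp_all add: mult.commute)
      then show ?thesis using False Suc by simp
    qed
  qed simp
  have "computable_in \<beta>s (\<lambda>x. if 0 < g x
      then rec_nat 0 (\<lambda>k r. if Suc r * g x \<le> Suc k then Suc r else r) (f x) else 0)"
    by (intro computable assms computable_comp[OF assms(2)])
  moreover have "(if 0 < m then rec_nat 0 (\<lambda>k r. if Suc r * m \<le> Suc k then Suc r else r) n else 0)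
      = n div m" for m n :: nat
    using eq[of m n] by simp
  ultimately show ?thesis by (simp only:)
qed

lemma computable_mod [computable]:
  fixes f g :: "'a::finite_object \<Rightarrow> nat"
  assumes "computable_in \<beta>s f" "computable_in \<beta>s g" shows "computable_in \<beta>s (\<lambda>x. f x mod g x)"
proof -
  have "computable_in \<beta>s (\<lambda>x. f x - f x div g x * g x)" by (intro computable assms)
  then show ?thesis by (simp only: minus_div_mult_eq_mod)
qed

lemma computable_Cons [computable]:
  assumes "computable_in \<beta>s f" "computable_in \<beta>s g" shows "computable_in \<beta>s (\<lambda>x. f x # g x)"
proof (rule computable_if_encode)
  have "computable_in \<beta>s (\<lambda>x. Suc (encode (f x, g x)))" by (intro computable assms)
  then show "computable_in \<beta>s (\<lambda>x. encode (f x # g x))" by (simp only: encode_Cons encode_Pair)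
qed

text \<open>The code of \<open>a # as\<close> is one more than the code of the pair \<open>(a, as)\<close>, so the code for the second
branch can be run on the predecessor of the code of the list.\<close>

lemma computable_case_list [computable]:
  assumes "computable_in \<beta>s l" "computable_in \<beta>s f"
    and "computable_in \<beta>s (\<lambda>p. g (fst p) (fst (snd p)) (snd (snd p)))"
  shows "computable_in \<beta>s (\<lambda>x. case l x of [] \<Rightarrow> f x | a # as \<Rightarrow> g x a as)"
proof -
  obtain L F G :: "nat \<Rightarrow> nat" where *:
      "computable_in \<beta>s L" "\<And>x. L (encode x) = encode (l x)"
      "computable_in \<beta>s F" "\<And>x. F (encode x) = encode (f x)"
      "computable_in \<beta>s G" "\<And>p. G (encode p) = encode (g (fst p) (fst (snd p)) (snd (snd p)))"
    using computable_on_codes[OF assms(1)] computable_on_codes[OF assms(2)] computable_on_codes[OF assms(3)]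
    by metis
  show ?thesis
  proof (rule computable_of_codes)
    show "computable_in \<beta>s (\<lambda>z. if 0 < L z then G (encode (z, L z - Suc 0)) else F z)"
      by (intro computable * computable_comp[OF *(5)] computable_comp[OF *(3)] computable_comp[OF *(1)])
    show "(if 0 < L (encode x) then G (encode (encode x, L (encode x) - Suc 0)) else F (encode x))
        = encode (case l x of [] \<Rightarrow> f x | a # as \<Rightarrow> g x a as)" for x
    proof (cases "l x")
      case Nil
      then show ?thesis by (simp add: * encode_Nil)
    next
      case (Cons a as)
      have "encode (encode x, L (encode x) - Suc 0) = encode (x, a, as)"
        by (simp add: * Cons encode_Cons encode_Pair encode_nat_def)
      then show ?thesis using *(6)[of "(x, a, as)"] by (simp add: * Cons encode_Cons)
    qed
  qed
qed

text \<open>A fold is an iteration that consumes the list. The number of iterations only has to be large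
enough, and the code of a list is at least its length.\<close>

lemma computable_foldl [computable]:
  assumes "computable_in \<beta>s i" "computable_in \<beta>s l"
    and h: "computable_in \<beta>s (\<lambda>p. h (fst p) (fst (snd p)) (snd (snd p)))"
  shows "computable_in \<beta>s (\<lambda>x. foldl (\<lambda>r a. h x r a) (i x) (l x))"
proof -
  let ?S = "\<lambda>p. case snd (snd p) of [] \<Rightarrow> p
    | a # as \<Rightarrow> (fst p, h (fst p) (fst (snd p)) a, as)"
  have fin: "(?S ^^ n) (x, r, []) = (x, r, [])" for n x r
    by (induction n) auto
  have eq: "length as \<le> n \<Longrightarrow> (?S ^^ n) (x, r, as) = (x, foldl (\<lambda>r a. h x r a) r as, [])" for n x r as
  proof (induction as arbitrary: n r)
    case Nil show ?case using fin by simp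
  next
    case (Cons a as)
    then obtain m where n: "n = Suc m" "length as \<le> m" by (cases n) auto
    show ?case using Cons.IH[OF n(2)] by (simp add: n(1) funpow_Suc_right del: funpow.simps)
  qed
  have "computable_in \<beta>s (\<lambda>x. fst (snd ((?S ^^ encode (l x)) (x, i x, l x))))"
    by (intro computable assms
      computable_comp[OF h, of "\<lambda>p. (fst (fst p), fst (snd (fst p)), fst (snd p))", simplified])
  then show ?thesis by (simp only: eq[OF length_le_encode] fst_conv snd_conv)
qed

lemma computable_rev [computable]:
  assumes "computable_in \<beta>s l" shows "computable_in \<beta>s (\<lambda>x. rev (l x))"
proof -
  have eq: "foldl (\<lambda>r a. a # r) r as = rev as @ r" for r as :: "'b list"
    by (induction as arbitrary: r) auto
  have "computable_in \<beta>s (\<lambda>x. foldl (\<lambda>r a. a # r) [] (l x))" by (intro computable assms)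
  then show ?thesis by (simp add: eq)
qed

lemma computable_append [computable]:
  assumes "computable_in \<beta>s k" "computable_in \<beta>s l" shows "computable_in \<beta>s (\<lambda>x. k x @ l x)"
proof -
  have eq: "foldl (\<lambda>r a. a # r) r (rev as) = as @ r" for r as :: "'b list"
    by (induction as arbitrary: r rule: rev_induct) auto
  have "computable_in \<beta>s (\<lambda>x. foldl (\<lambda>r a. a # r) (l x) (rev (k x)))" by (intro computable assms)
  then show ?thesis by (simp only: eq)
qed

lemma computable_map [computable]:
  assumes "computable_in \<beta>s (\<lambda>p. f (fst p) (snd p))" "computable_in \<beta>s l"
  shows "computable_in \<beta>s (\<lambda>x. map (\<lambda>a. f x a) (l x))"
proof -
  have eq: "foldl (\<lambda>r a. r @ [f x a]) r as = r @ map (\<lambda>a. f x a) as" for x r as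
    by (induction as arbitrary: r) auto
  have "computable_in \<beta>s (\<lambda>x. foldl (\<lambda>r a. r @ [f x a]) [] (l x))"
    by (intro computable assms computable_comp[OF assms(1), of "\<lambda>p. (fst p, snd (snd p))", simplified])
  then show ?thesis by (simp only: eq append_Nil)
qed

lemma computable_filter [computable]:
  assumes "computable_in \<beta>s (\<lambda>p. f (fst p) (snd p))" "computable_in \<beta>s l"
  shows "computable_in \<beta>s (\<lambda>x. filter (\<lambda>a. f x a) (l x))"
proof -
  have eq: "foldl (\<lambda>r a. if f x a then r @ [a] else r) r as = r @ filter (\<lambda>a. f x a) as" for x r as
    by (induction as arbitrary: r) auto
  have "computable_in \<beta>s (\<lambda>x. foldl (\<lambda>r a. if f x a then r @ [a] else r) [] (l x))"
    by (intro computable assms computable_comp[OF assms(1), of "\<lambda>p. (fst p, snd (snd p))", simplified])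
  then show ?thesis by (simp only: eq append_Nil)
qed

lemma computable_bex_set [computable]:
  assumes "computable_in \<beta>s (\<lambda>p. f (fst p) (snd p))" "computable_in \<beta>s l"
  shows "computable_in \<beta>s (\<lambda>x. \<exists>a\<in>set (l x). f x a)"
proof -
  have eq: "foldl (\<lambda>r a. r \<or> f x a) r as \<longleftrightarrow> r \<or> (\<exists>a\<in>set as. f x a)" for x r as
    by (induction as arbitrary: r) auto
  have "computable_in \<beta>s (\<lambda>x. foldl (\<lambda>r a. r \<or> f x a) False (l x))"
    by (intro computable assms computable_comp[OF assms(1), of "\<lambda>p. (fst p, snd (snd p))", simplified])
  then show ?thesis by (simp only: eq simp_thms)
qed

lemma computable_ball_set [computable]:
  assumes "computable_in \<beta>s (\<lambda>p. f (fst p) (snd p))" "computable_in \<beta>s l"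
  shows "computable_in \<beta>s (\<lambda>x. \<forall>a\<in>set (l x). f x a)"
proof -
  have "computable_in \<beta>s (\<lambda>x. \<not> (\<exists>a\<in>set (l x). \<not> f x a))" by (intro computable assms)
  then show ?thesis by simp
qed

lemma computable_length [computable]:
  assumes "computable_in \<beta>s l" shows "computable_in \<beta>s (\<lambda>x. length (l x))"
proof -
  have eq: "foldl (\<lambda>r a. Suc r) r as = r + length as" for r and as :: "'b list"
    by (induction as arbitrary: r) auto
  have "computable_in \<beta>s (\<lambda>x. foldl (\<lambda>r a. Suc r) 0 (l x))" by (intro computable assms)
  then show ?thesis by (simp add: eq)
qed

lemma computable_sum_list_map [computable]:
  fixes f :: "'a::finite_object \<Rightarrow> 'b::finite_object \<Rightarrow> nat"
  assumes "computable_in \<beta>s (\<lambda>p. f (fst p) (snd p))" "computable_in \<beta>s l"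
  shows "computable_in \<beta>s (\<lambda>x. \<Sum>a\<leftarrow>l x. f x a)"
proof -
  have eq: "foldl (\<lambda>r a. r + f x a) r as = r + (\<Sum>a\<leftarrow>as. f x a)" for x r as
    by (induction as arbitrary: r) auto
  have "computable_in \<beta>s (\<lambda>x. foldl (\<lambda>r a. r + f x a) 0 (l x))"
    by (intro computable assms computable_comp[OF assms(1), of "\<lambda>p. (fst p, snd (snd p))", simplified])
  then show ?thesis by (simp add: eq)
qed

lemma computable_tl [computable]:
  assumes "computable_in \<beta>s l" shows "computable_in \<beta>s (\<lambda>x. tl (l x))"
proof -
  have "computable_in \<beta>s (\<lambda>x. case l x of [] \<Rightarrow> [] | a # as \<Rightarrow> as)" by (intro computable assms)
  then show ?thesis by (simp add: tl_def)
qed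

lemma computable_drop [computable]:
  assumes "computable_in \<beta>s n" "computable_in \<beta>s l" shows "computable_in \<beta>s (\<lambda>x. drop (n x) (l x))"
proof -
  have eq: "rec_nat as (\<lambda>k r. tl r) m = drop m as" for m and as :: "'b list"
    by (induction m) (auto simp: drop_Suc tl_drop)
  have "computable_in \<beta>s (\<lambda>x. rec_nat (l x) (\<lambda>k r. tl r) (n x))" by (intro computable assms)
  then show ?thesis by (simp only: eq)
qed

lemma computable_take [computable]:
  assumes "computable_in \<beta>s n" "computable_in \<beta>s l" shows "computable_in \<beta>s (\<lambda>x. take (n x) (l x))"
proof -
  have eq: "rev (drop (length as - m) (rev as)) = take m as" for m and as :: "'b list"
    by (cases "m \<le> length as") (simp_all add: rev_drop)
  have "computable_in \<beta>s (\<lambda>x. rev (drop (length (l x) - n x) (rev (l x))))" by (intro computable assms)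
  then show ?thesis by (simp only: eq)
qed

text \<open>Out of range, a default value keeps indexing total and computable.\<close>

definition nth_or :: "'a \<Rightarrow> 'a list \<Rightarrow> nat \<Rightarrow> 'a" where
  "nth_or d xs n = (case drop n xs of [] \<Rightarrow> d | x # _ \<Rightarrow> x)"

lemma nth_or: "nth_or d xs n = (if n < length xs then xs ! n else d)"
  by (auto simp: nth_or_def Cons_nth_drop_Suc[symmetric])

lemma computable_nth_or [computable]:
  assumes "computable_in \<beta>s d" "computable_in \<beta>s l" "computable_in \<beta>s n"
  shows "computable_in \<beta>s (\<lambda>x. nth_or (d x) (l x) (n x))"
  unfolding nth_or_def by (intro computable assms computable_comp[OF assms(1)])

lemma computable_list_update [computable]:
  assumes "computable_in \<beta>s l" "computable_in \<beta>s n" "computable_in \<beta>s v"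
  shows "computable_in \<beta>s (\<lambda>x. (l x)[n x := v x])"
proof -
  have eq: "(if m < length as then take m as @ b # drop (Suc m) as else as) = as[m := b]"
    for m b and as :: "'b list"
    by (cases "m < length as") (simp_all add: upd_conv_take_nth_drop list_update_beyond)
  have "computable_in \<beta>s (\<lambda>x. if n x < length (l x)
      then take (n x) (l x) @ v x # drop (Suc (n x)) (l x) else l x)"
    by (intro computable assms)
  then show ?thesis by (simp only: eq)
qed

lemma computable_upt [computable]:
  assumes "computable_in \<beta>s n" shows "computable_in \<beta>s (\<lambda>x. [0..<n x])"
proof -
  have eq: "rec_nat [] (\<lambda>k r. r @ [k]) m = [0..<m]" for m by (induction m) auto
  have "computable_in \<beta>s (\<lambda>x. rec_nat [] (\<lambda>k r. r @ [k]) (n x))" by (intro computable assms)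
  then show ?thesis by (simp only: eq)
qed

lemma computable_ex_less [computable]:
  assumes "computable_in \<beta>s (\<lambda>p. f (fst p) (snd p))" "computable_in \<beta>s n"
  shows "computable_in \<beta>s (\<lambda>x. \<exists>k<n x. f x (k::nat))"
proof -
  have "computable_in \<beta>s (\<lambda>x. \<exists>k\<in>set [0..<n x]. f x k)" by (intro computable assms)
  moreover have "(\<exists>k\<in>set [0..<m]. f x k) \<longleftrightarrow> (\<exists>k<m. f x k)" for x m by auto
  ultimately show ?thesis by (simp only:)
qed

lemma computable_ex_le [computable]:
  assumes "computable_in \<beta>s (\<lambda>p. f (fst p) (snd p))" "computable_in \<beta>s n"
  shows "computable_in \<beta>s (\<lambda>x. \<exists>k\<le>n x. f x (k::nat))"
proof -
  have "computable_in \<beta>s (\<lambda>x. \<exists>k<Suc (n x). f x k)" by (intro computable assms)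
  then show ?thesis by (simp add: less_Suc_eq_le)
qed

lemma computable_list_decode [computable]:
  assumes "computable_in \<beta>s n" shows "computable_in \<beta>s (\<lambda>x. list_decode (n x))"
  using assms by (rule_tac computable_if_encode) (simp add: encode_list_def encode_nat_def[abs_def])

lemma computable_zip [computable]:
  assumes "computable_in \<beta>s k" "computable_in \<beta>s l"
  shows "computable_in \<beta>s (\<lambda>x. zip (k x) (l x))"
proof -
  let ?f = "\<lambda>p a. case snd p of [] \<Rightarrow> p | b # bs \<Rightarrow> (fst p @ [(a, b)], bs)"
  have eq: "fst (foldl ?f (r, bs) as) = r @ zip as bs" for r and as :: "'b list" and bs :: "'c list"
  proof (induction as arbitrary: r bs)
    case (Cons a as) then show ?case by (cases bs) (auto split: list.splits)
  qed simp
  have "computable_in \<beta>s (\<lambda>x. fst (foldl ?f ([], l x) (k x)))" by (intro computable assms)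
  then show ?thesis by (simp only: eq append_Nil)
qed

lemma computable_prefix [computable]:
  assumes "computable_in \<beta>s f" "computable_in \<beta>s g"
  shows "computable_in \<beta>s (\<lambda>x. prefix (f x) (g x))"
proof -
  have eq: "take (length as) bs = as \<longleftrightarrow> prefix as bs" for as bs :: "'b list"
    by (metis append_eq_conv_conj prefix_def take_is_prefix)
  have "computable_in \<beta>s (\<lambda>x. take (length (f x)) (g x) = f x)" by (intro computable assms)
  then show ?thesis by (simp only: eq)
qed

lemma computable_map_stake:
  assumes "\<And>\<gamma>. \<gamma> \<in> set \<gamma>s \<Longrightarrow> computable_in \<beta>s (\<lambda>m. \<gamma> !! m)" "computable_in \<beta>s s"
  shows "computable_in \<beta>s (\<lambda>x. map (stake (s x)) \<gamma>s)"
  using assms(1)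
proof (induction \<gamma>s)
  case (Cons \<gamma> \<gamma>s)
  have eq: "stake n \<gamma> = map (\<lambda>m. \<gamma> !! m) [0..<n]" for n
    by (rule nth_equalityI) auto
  have "computable_in \<beta>s (\<lambda>x. map (\<lambda>m. \<gamma> !! m) [0..<s x])"
    using computable_comp[OF Cons.prems[of \<gamma>] computable_snd[OF computable_id]] by (intro computable assms) simp
  then have "computable_in \<beta>s (\<lambda>x. stake (s x) \<gamma>)" by (simp only: eq)
  moreover have "computable_in \<beta>s (\<lambda>x. map (stake (s x)) \<gamma>s)" using Cons by simp
  ultimately show ?case by (simp add: computable_Cons)
qed (simp add: computable_const)

lemma computable_oracle_prefixes:
  assumes "computable_in \<beta>s s" shows "computable_in \<beta>s (\<lambda>x. map (stake (s x)) \<beta>s)"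
proof (rule computable_map_stake[OF _ assms])
  fix \<gamma> assume "\<gamma> \<in> set \<beta>s"
  then obtain k where "k < length \<beta>s" "\<gamma> = \<beta>s ! k" by (auto simp: in_set_conv_nth)
  then show "computable_in \<beta>s (\<lambda>m. \<gamma> !! m)" by (simp add: computable)
qed

lemma machine_of_decidable:
  assumes "computable_in \<beta>s Q" shows "\<exists>M. \<forall>x. accepts M \<beta>s (encode x) \<longleftrightarrow> Q x"
proof -
  obtain F where F: "realizable \<beta>s F" "\<And>x. F (encode x) = encode (Q x)"
    using assms unfolding computable_in_def by blast
  have "F (encode x) > 0 \<longleftrightarrow> Q x" for x by (simp add: F(2) encode_bool_def)
  moreover obtain M where "\<forall>x. accepts M \<beta>s x \<longleftrightarrow> F x > 0"
    using machine_of_realizable[OF F(1)] ..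
  ultimately show ?thesis by (intro exI[of _ M]) simp
qed

lemma computable_Let [computable]:
  assumes "computable_in \<beta>s f" "computable_in \<beta>s (\<lambda>p. g (fst p) (snd p))"
  shows "computable_in \<beta>s (\<lambda>x. let y = f x in g x y)"
  using computable_comp[OF assms(2) computable_Pair[OF computable_id assms(1)]] by (simp add: Let_def)

lemma computable_funpow_param:
  fixes f :: "'a::finite_object \<Rightarrow> 'b::finite_object \<Rightarrow> 'b"
  assumes "computable_in \<beta>s (\<lambda>p. f (fst p) (snd p))" "computable_in \<beta>s n" "computable_in \<beta>s g"
  shows "computable_in \<beta>s (\<lambda>x. (f x ^^ n x) (g x))"
proof -
  have eq: "rec_nat y (\<lambda>k r. f x r) m = (f x ^^ m) y" for x y m by (induction m) auto
  have "computable_in \<beta>s (\<lambda>x. rec_nat (g x) (\<lambda>k r. f x r) (n x))"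
    by (intro computable assms computable_comp[OF assms(1), of "\<lambda>p. (fst p, snd (snd p))", simplified])
  then show ?thesis by (simp only: eq)
qed

section \<open>Step-bounded simulation\<close>

text \<open>The list of the cells on one side of the head becomes a binary number, nearest cell first.
Trailing blanks vanish, as they should on an infinite tape, and moving the head is halving one
side and doubling the other.\<close>

fun bits :: "bool list \<Rightarrow> nat" where
  "bits [] = 0"
| "bits (b # bs) = (if b then 1 else 0) + 2 * bits bs"

fun bit_count :: "nat \<Rightarrow> nat" where
  "bit_count n = (if n = 0 then 0 else n mod 2 + bit_count (n div 2))"

declare bit_count.simps [simp del]

lemma bit_count_double: "bit_count ((if b then 1 else 0) + 2 * n) = (if b then 1 else 0) + bit_count n"
  by (cases "n = 0") (auto simp: bit_count.simps[of "Suc (2 * n)"] bit_count.simps[of "2 * n"]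
      bit_count.simps[of 0] bit_count.simps[of "Suc 0"])

lemma bit_count_bits: "bit_count (bits bs) = count_list bs True"
  by (induction bs) (auto simp: bit_count.simps[of 0] bit_count_double[of True, simplified]
      bit_count_double[of False, simplified])

lemma bits_replicate_True: "bits (replicate n True) = 2 ^ n - 1"
proof (induction n)
  case (Suc n)
  have "Suc (2 * (m - 1)) = 2 * m - 1" if "1 \<le> m" for m :: nat using that by arith
  from this[of "2 ^ n"] Suc show ?case by simp
qed simp

lemma computable_bit_count [computable]:
  assumes "computable_in \<beta>s f" shows "computable_in \<beta>s (\<lambda>x. bit_count (f x))"
proof -
  let ?S = "\<lambda>p::nat \<times> nat. (fst p div 2, snd p + fst p mod 2)"
  have eq: "n \<le> k \<Longrightarrow> snd ((?S ^^ k) (n, c)) = c + bit_count n" for k n c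
  proof (induction k arbitrary: n c)
    case (Suc k)
    have "bit_count n = n mod 2 + bit_count (n div 2)"
      by (cases "n = 0") (simp_all add: bit_count.simps[of n])
    moreover have "n div 2 \<le> k" using Suc.prems by (cases "n = 0") auto
    ultimately show ?case
      using Suc.IH[of "n div 2" "c + n mod 2"] by (simp add: funpow_Suc_right del: funpow.simps)
  qed (simp add: bit_count.simps)
  have "computable_in \<beta>s (\<lambda>x. snd ((?S ^^ f x) (f x, 0)))" by (intro computable assms)
  then show ?thesis by (simp only: eq[OF order_refl] add_0)
qed

definition tape_code :: "tape \<Rightarrow> nat \<times> nat" where
  "tape_code t = (bits (fst t), bits (snd t))"

definition number_of :: "nat \<times> nat \<Rightarrow> nat" where
  "number_of t = bit_count (fst t) + bit_count (snd t)"

lemma number_of_tape_code: "number_of (tape_code t) = strokes t"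
proof -
  have "count_list (xs @ ys) b = count_list xs b + count_list ys b" for xs ys and b :: bool
    by (induction xs) auto
  then show ?thesis by (simp add: number_of_def tape_code_def strokes_def bit_count_bits)
qed

lemma tape_code_block: "tape_code (block n) = (0, 2 ^ n - 1)"
  by (simp add: tape_code_def block_def bits_replicate_True)

lemma scanned_tape_code: "scanned t \<longleftrightarrow> snd (tape_code t) mod 2 \<noteq> 0"
  by (cases t rule: scanned.cases) (auto simp: tape_code_def)

fun action_code :: "action \<Rightarrow> nat" where
  "action_code Erase = 0"
| "action_code Mark = 1"
| "action_code MoveLeft = 2"
| "action_code MoveRight = 3"

definition act :: "nat \<Rightarrow> nat \<times> nat \<Rightarrow> nat \<times> nat" where
  "act a t =
     (if a = 0 then (fst t, 2 * (snd t div 2))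
      else if a = 1 then (fst t, Suc (2 * (snd t div 2)))
      else if a = 2 then (fst t div 2, fst t mod 2 + 2 * snd t)
      else (snd t mod 2 + 2 * fst t, snd t div 2))"

lemma tape_code_perform: "tape_code (perform a t) = act (action_code a) (tape_code t)"
proof -
  have tl: "bits (tl r) = bits r div 2" for r by (cases r) auto
  show ?thesis
    by (cases "(a, t)" rule: perform.cases) (auto simp: tape_code_def act_def tl)
qed

type_synonym instr_code = "(nat \<times> nat) \<times> (nat \<times> nat) \<times> (nat \<times> nat)"

fun instr_code :: "instr \<Rightarrow> instr_code" where
  "instr_code (Scan i (a, q0) (b, q1)) = ((0, i), (action_code a, q0), (action_code b, q1))"
| "instr_code (Query i j t q) = ((1, i), (j, t), (q, 0))"

type_synonym config_code = "nat \<times> (nat \<times> nat) list"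

text \<open>The oracle is replaced by finite prefixes \<open>os\<close> of the oracle sequences. A query outside the known
prefixes leaves the configuration unchanged, exactly like halting, so that the simulation can be
iterated without bookkeeping. All arguments being finite objects, this is a computable function
without any oracle.\<close>

definition sim_step :: "instr_code list \<Rightarrow> nat list list \<Rightarrow> config_code \<Rightarrow> config_code" where
  "sim_step P os c =
     (if fst c < length P then
        let I = nth_or ((0, 0), (0, 0), (0, 0)) P (fst c);
            i = snd (fst I); t = nth_or (0, 0) (snd c) i
        in if fst (fst I) = 0
           then let b = (if snd t mod 2 = 0 then fst (snd I) else snd (snd I))
                in (snd b, (snd c)[i := act (fst b) t])
           else let \<sigma> = nth_or [] os (number_of t);
                    m = number_of (nth_or (0, 0) (snd c) (fst (fst (snd I))))
                in if m < length \<sigma>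
                   then (fst (snd (snd I)), (snd c)[snd (fst (snd I)) := (0, 2 ^ nth_or 0 \<sigma> m - 1)])
                   else c
      else c)"

fun instr_width :: "instr \<Rightarrow> nat" where
  "instr_width (Scan i _ _) = i"
| "instr_width (Query i j t _) = i + j + t"

text \<open>A machine only touches the tapes that its instructions mention, so finitely many tapes are
enough; the successor makes room for tape 0, which holds input and output.\<close>

definition tape_count :: "machine \<Rightarrow> nat" where
  "tape_count M = Suc (\<Sum>I\<leftarrow>M. instr_width I)"

lemma instr_width_less_tape_count: "q < length M \<Longrightarrow> instr_width (M ! q) < tape_count M"
  unfolding tape_count_def less_Suc_eq_le by (rule member_le_sum_list) auto

definition config_code :: "machine \<Rightarrow> config \<Rightarrow> config_code" where
  "config_code M c = (fst c, map (\<lambda>i. tape_code (snd c i)) [0..<tape_count M])"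

lemma config_code_update:
  "(snd (config_code M (q, T)))[i := tape_code t] = snd (config_code M (q', T(i := t)))"
  by (rule nth_equalityI) (auto simp: config_code_def nth_list_update)

lemma nth_or_config_code:
  "i < tape_count M \<Longrightarrow> nth_or d (snd (config_code M c)) i = tape_code (snd c i)"
  by (simp add: nth_or config_code_def)

definition oracle_answers :: "nat list list \<Rightarrow> nat \<Rightarrow> nat \<Rightarrow> nat option" where
  "oracle_answers os k m =
     (if m < length (nth_or [] os k) then Some (nth_or 0 (nth_or [] os k) m) else None)"

lemma oracle_answers_stake:
  "oracle_answers (map (stake s) \<beta>s) k m =
     (if k < length \<beta>s \<and> m < s then Some ((\<beta>s ! k) !! m) else None)"
  by (auto simp: oracle_answers_def nth_or)

lemma sim_step_Scan:
  assumes "q < length M" "M ! q = Scan i (a, q0) (b, q1)"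
  shows "sim_step (map instr_code M) os (config_code M (q, T)) =
    (if scanned (T i) then config_code M (q1, T(i := perform b (T i)))
     else config_code M (q0, T(i := perform a (T i))))"
proof -
  have i: "i < tape_count M" using instr_width_less_tape_count[OF assms(1)] assms(2) by simp
  have "nth_or ((0, 0), (0, 0), (0, 0)) (map instr_code M) q
      = ((0, i), (action_code a, q0), (action_code b, q1))"
    using assms by (simp add: nth_or)
  moreover define c where "c = config_code M (q, T)"
  ultimately have c: "fst c = q" "nth_or (0, 0) (snd c) i = tape_code (T i)"
      "nth_or ((0, 0), (0, 0), (0, 0)) (map instr_code M) (fst c) = ((0, i), (action_code a, q0), (action_code b, q1))"
      "\<And>t p. (p, (snd c)[i := tape_code t]) = config_code M (p, T(i := t))"
    using nth_or_config_code[OF i, of "(0, 0)" "(q, T)"] config_code_update[of M q T i]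
    by (simp_all add: config_code_def)
  show ?thesis
    unfolding c_def[symmetric] sim_step_def scanned_tape_code Let_def c(3) fst_conv snd_conv c(2)
    using assms(1) by (simp add: c(1,4) tape_code_perform[symmetric])
qed

lemma sim_step_Query:
  assumes "q < length M" "M ! q = Query i j t q'"
  shows "sim_step (map instr_code M) os (config_code M (q, T)) =
    (case oracle_answers os (strokes (T i)) (strokes (T j)) of
       Some y \<Rightarrow> config_code M (q', T(t := block y))
     | None \<Rightarrow> config_code M (q, T))"
proof -
  have i: "i < tape_count M" "j < tape_count M"
    using instr_width_less_tape_count[OF assms(1)] assms(2) by simp_all
  have "nth_or ((0, 0), (0, 0), (0, 0)) (map instr_code M) q = ((1, i), (j, t), (q', 0))"
    using assms by (simp add: nth_or)
  moreover define c where "c = config_code M (q, T)"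
  ultimately have c: "fst c = q" "nth_or (0, 0) (snd c) i = tape_code (T i)"
      "nth_or (0, 0) (snd c) j = tape_code (T j)"
      "nth_or ((0, 0), (0, 0), (0, 0)) (map instr_code M) (fst c) = ((1, i), (j, t), (q', 0))"
      "\<And>y p. (p, (snd c)[t := (0, 2 ^ y - 1)]) = config_code M (p, T(t := block y))"
    using nth_or_config_code[OF i(1), of "(0, 0)" "(q, T)"]
      nth_or_config_code[OF i(2), of "(0, 0)" "(q, T)"] 
      config_code_update[of M q T t "block y" for y]
    by (simp_all add: config_code_def tape_code_block)
  show ?thesis
    unfolding c_def[symmetric] sim_step_def oracle_answers_def Let_def c(4) fst_conv snd_conv
      c(2,3) number_of_tape_code c(5)
    using assms(1) by (simp add: c(1))
qed

lemma sim_step_halted: "length P \<le> fst c \<Longrightarrow> sim_step P os c = c"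
  by (simp add: sim_step_def)

lemma sim_step_sound:
  "sim_step (map instr_code M) (map (stake s) \<beta>s) (config_code M c) = config_code M c \<or>
   (\<exists>c'. step M \<beta>s c c' \<and> sim_step (map instr_code M) (map (stake s) \<beta>s) (config_code M c) = config_code M c')"
proof (cases c)
  case (Pair q T)
  show ?thesis
  proof (cases "q < length M")
    case False
    then show ?thesis by (simp add: sim_step_halted Pair config_code_def)
  next
    case q: True
    show ?thesis
    proof (cases "M ! q")
      case (Scan i u v)
      then obtain a q0 b q1 where I: "M ! q = Scan i (a, q0) (b, q1)" by (cases u; cases v) auto
      show ?thesis
        using step.scan_stroke[OF q I, of T \<beta>s] step.scan_blank[OF q I, of T \<beta>s]
        unfolding Pair sim_step_Scan[OF q I] by (cases "scanned (T i)") auto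
    next
      case (Query i j t q')
      show ?thesis
        using step.query[OF q Query, of T \<beta>s]
        unfolding Pair sim_step_Query[OF q Query] oracle_answers_stake
        by (cases "strokes (T i) < length \<beta>s \<and> strokes (T j) < s") auto
    qed
  qed
qed

lemma sim_step_complete:
  assumes "step M \<beta>s c c'"
  shows "\<exists>s0. \<forall>s\<ge>s0. sim_step (map instr_code M) (map (stake s) \<beta>s) (config_code M c) = config_code M c'"
  using assms
proof cases
  case (scan_blank q i a q0 b q1 T)
  then show ?thesis by (simp add: sim_step_Scan)
next
  case (scan_stroke q i a q0 b q1 T)
  then show ?thesis by (simp add: sim_step_Scan)
next
  case (query q i j t q' T)
  then show ?thesis
    by (intro exI[of _ "Suc (strokes (T j))"]) (auto simp: sim_step_Query oracle_answers_stake)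
qed

text \<open>The value is 0 if the machine has not halted within \<open>s\<close> steps, and \<open>Suc y\<close> if it has halted with
result \<open>y\<close>.\<close>

definition run_within :: "machine \<Rightarrow> nat list list \<Rightarrow> nat \<Rightarrow> nat \<Rightarrow> nat" where
  "run_within M os s x =
     (let c = (sim_step (map instr_code M) os ^^ s)
                (0, (replicate (tape_count M) (0, 0))[0 := (0, 2 ^ x - 1)])
      in if fst c < length M then 0 else Suc (number_of (nth_or (0, 0) (snd c) 0)))"

lemma config_code_initial:
  "config_code M (initial x) = (0, (replicate (tape_count M) (0, 0))[0 := (0, 2 ^ x - 1)])"
proof -
  have "snd (config_code M (initial x)) = (replicate (tape_count M) (0, 0))[0 := (0, 2 ^ x - 1)]"
    by (rule nth_equalityI) (auto simp: config_code_def initial_def nth_list_update tape_code_block)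
  then show ?thesis by (simp add: config_code_def initial_def)
qed

lemma run_within_eq:
  assumes "(sim_step (map instr_code M) os ^^ s) (config_code M (initial x)) = config_code M c"
  shows "run_within M os s x = (if fst c < length M then 0 else Suc (strokes (snd c 0)))"
proof -
  have "nth_or (0, 0) (snd (config_code M c)) 0 = tape_code (snd c 0)"
    by (rule nth_or_config_code) (simp add: tape_count_def)
  moreover have "fst (config_code M c) = fst c" by (simp add: config_code_def)
  ultimately show ?thesis
    unfolding run_within_def config_code_initial[symmetric] assms Let_def
    by (simp only: number_of_tape_code)
qed

lemma computable_run_within [computable]:
  assumes "computable_in \<beta>s os" "computable_in \<beta>s s" "computable_in \<beta>s x"
  shows "computable_in \<beta>s (\<lambda>z. run_within M (os z) (s z) (x z))"
  unfolding run_within_def number_of_def sim_step_def act_def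
  by (intro computable computable_funpow_param assms computable_comp[OF assms(1)])

lemma funpow_fixpoint: "f c = c \<Longrightarrow> (f ^^ n) c = c"
  by (induction n) auto

lemma sim_steps_sound:
  "\<exists>c'. (step M \<beta>s)\<^sup>*\<^sup>* c c' \<and>
     (sim_step (map instr_code M) (map (stake s) \<beta>s) ^^ n) (config_code M c) = config_code M c'"
proof (induction n)
  case (Suc n)
  then obtain c' where c': "(step M \<beta>s)\<^sup>*\<^sup>* c c'"
      "(sim_step (map instr_code M) (map (stake s) \<beta>s) ^^ n) (config_code M c) = config_code M c'"
    by blast
  show ?case
  proof (cases "sim_step (map instr_code M) (map (stake s) \<beta>s) (config_code M c') = config_code M c'")
    case True
    with c' show ?thesis by (intro exI[of _ c']) simp
  next
    case False
    then obtain d where "step M \<beta>s c' d"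
        "sim_step (map instr_code M) (map (stake s) \<beta>s) (config_code M c') = config_code M d"
      using sim_step_sound[of M s \<beta>s c'] by blast
    with c' show ?thesis
      by (intro exI[of _ d]) (simp add: rtranclp.rtrancl_into_rtrancl)
  qed
qed (intro exI[of _ c], simp)

lemma sim_steps_complete:
  assumes "(step M \<beta>s)\<^sup>*\<^sup>* c c'"
  shows "\<exists>n s0. \<forall>s\<ge>s0.
     (sim_step (map instr_code M) (map (stake s) \<beta>s) ^^ n) (config_code M c) = config_code M c'"
  using assms
proof (induction rule: rtranclp_induct)
  case base
  show ?case by (rule exI[of _ 0]) simp
next
  case (step d e)
  then obtain n s0 s1 where
    "\<forall>s\<ge>s0. (sim_step (map instr_code M) (map (stake s) \<beta>s) ^^ n) (config_code M c) = config_code M d"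
    "\<forall>s\<ge>s1. sim_step (map instr_code M) (map (stake s) \<beta>s) (config_code M d) = config_code M e"
    using sim_step_complete[OF step(2)] by blast
  then show ?case by (intro exI[of _ "Suc n"] exI[of _ "max s0 s1"]) auto
qed

text \<open>The use principle: a halting computation asks only finitely many questions, so it is found by the
simulation with long enough prefixes. The same bound \<open>s\<close> serves for the number of steps and the
length of the prefixes.\<close>

lemma computes_iff_run_within:
  "computes M \<beta>s x y \<longleftrightarrow> (\<exists>s. run_within M (map (stake s) \<beta>s) s x = Suc y)"
proof
  assume "computes M \<beta>s x y"
  then obtain q T where h: "(step M \<beta>s)\<^sup>*\<^sup>* (initial x) (q, T)" "length M \<le> q" "strokes (T 0) = y"
    unfolding computes_def by blast
  obtain n s0 where *: "\<And>s. s0 \<le> s \<Longrightarrow>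
      (sim_step (map instr_code M) (map (stake s) \<beta>s) ^^ n) (config_code M (initial x)) = config_code M (q, T)"
    using sim_steps_complete[OF h(1)] by blast
  define s where "s = max n s0"
  let ?f = "sim_step (map instr_code M) (map (stake s) \<beta>s)"
  have "(?f ^^ s) (config_code M (initial x)) = (?f ^^ (s - n)) ((?f ^^ n) (config_code M (initial x)))"
    by (simp add: s_def funpow_add[symmetric, unfolded o_def, THEN fun_cong])
  also have "\<dots> = (?f ^^ (s - n)) (config_code M (q, T))"
    by (subst *) (simp_all add: s_def)
  also have "\<dots> = config_code M (q, T)"
    by (intro funpow_fixpoint sim_step_halted) (simp add: h config_code_def)
  finally have "run_within M (map (stake s) \<beta>s) s x = Suc y"
    using h by (subst run_within_eq) auto
  then show "\<exists>s. run_within M (map (stake s) \<beta>s) s x = Suc y" ..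
next
  assume "\<exists>s. run_within M (map (stake s) \<beta>s) s x = Suc y"
  then obtain s where s: "run_within M (map (stake s) \<beta>s) s x = Suc y" by blast
  obtain c' where c': "(step M \<beta>s)\<^sup>*\<^sup>* (initial x) c'"
      "(sim_step (map instr_code M) (map (stake s) \<beta>s) ^^ s) (config_code M (initial x)) = config_code M c'"
    using sim_steps_sound by blast
  from s run_within_eq[OF c'(2)] have "length M \<le> fst c'" "strokes (snd c' 0) = y"
    by (auto split: if_splits)
  then show "computes M \<beta>s x y" using c'(1) unfolding computes_def by (cases c') auto
qed

lemma sim_step_more_oracle:
  assumes "\<And>k m y. oracle_answers os k m = Some y \<Longrightarrow> oracle_answers os' k m = Some y"
    and "sim_step P os c \<noteq> c"
  shows "sim_step P os' c = sim_step P os c"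
proof -
  have "m < length (nth_or [] os k) \<Longrightarrow>
      m < length (nth_or [] os' k) \<and> nth_or 0 (nth_or [] os' k) m = nth_or 0 (nth_or [] os k) m" for k m
    using assms(1)[of k m] by (auto simp: oracle_answers_def split: if_splits)
  then show ?thesis
    using assms(2) unfolding sim_step_def Let_def by (simp split: if_splits)
qed

text \<open>Longer prefixes and more steps do not change the result of a simulation that has halted: before
it halted no query can have failed, because a configuration that does not change once never
changes again.\<close>

lemma sim_steps_more_oracle:
  assumes "\<And>k m y. oracle_answers os k m = Some y \<Longrightarrow> oracle_answers os' k m = Some y"
    and "length P \<le> fst ((sim_step P os ^^ n) c)" "n \<le> n'"
  shows "(sim_step P os' ^^ n') c = (sim_step P os ^^ n) c"
  using assms(2,3)
proof (induction n arbitrary: c n')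
  case 0
  then show ?case by (simp add: funpow_fixpoint sim_step_halted)
next
  case (Suc n)
  show ?case
  proof (cases "sim_step P os c = c")
    case True
    then have "(sim_step P os ^^ Suc n) c = c" by (rule funpow_fixpoint)
    with Suc.prems show ?thesis by (simp add: funpow_fixpoint sim_step_halted)
  next
    case False
    from Suc.prems obtain k where k: "n' = Suc k" "n \<le> k" by (cases n') auto
    show ?thesis
      using Suc.IH[of "sim_step P os c" k] Suc.prems k sim_step_more_oracle[OF assms(1) False]
      by (simp add: funpow_Suc_right del: funpow.simps)
  qed
qed

lemma run_within_mono:
  assumes "run_within M (map (stake s) \<beta>s) s x = Suc y" "s \<le> s'"
  shows "run_within M (map (stake s') \<beta>s) s' x = Suc y"
proof -
  let ?c = "(0, (replicate (tape_count M) (0, 0))[0 := (0, 2 ^ x - 1)])"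
  have "(sim_step (map instr_code M) (map (stake s') \<beta>s) ^^ s') ?c
      = (sim_step (map instr_code M) (map (stake s) \<beta>s) ^^ s) ?c"
    using assms by (intro sim_steps_more_oracle)
      (auto simp: oracle_answers_stake run_within_def Let_def split: if_splits)
  with assms(1) show ?thesis by (simp add: run_within_def)
qed

definition accepts_within :: "machine \<Rightarrow> nat list list \<Rightarrow> nat \<Rightarrow> nat \<Rightarrow> bool" where
  "accepts_within M os s x \<longleftrightarrow> 0 < run_within M os s x"

lemma computable_accepts_within [computable]:
  assumes "computable_in \<beta>s os" "computable_in \<beta>s s" "computable_in \<beta>s x"
  shows "computable_in \<beta>s (\<lambda>z. accepts_within M (os z) (s z) (x z))"
  unfolding accepts_within_def by (intro computable assms)

lemma accepts_iff_accepts_within: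
  "accepts M \<beta>s x \<longleftrightarrow> (\<exists>s. accepts_within M (map (stake s) \<beta>s) s x)"
  unfolding accepts_def computes_iff_run_within accepts_within_def
  by (metis Suc_pred zero_less_Suc)

lemma accepts_within_mono:
  assumes "accepts_within M (map (stake s) \<beta>s) s x" "s \<le> s'"
  shows "accepts_within M (map (stake s') \<beta>s) s' x"
  using assms run_within_mono[of M s \<beta>s x _ s'] unfolding accepts_within_def
  by (metis Suc_pred zero_less_Suc)

section \<open>Bernoulli measures\<close>

lemma cyl_singleton: "cyl \<Omega> {\<sigma>} = {X \<in> streams \<Omega>. stake (length \<sigma>) X = \<sigma>}"
  unfolding cyl_def by (auto intro!: exI[of _ "length \<sigma>"]) 

lemma cyl_Un: "cyl \<Omega> S = (\<Union>\<sigma>\<in>S. cyl \<Omega> {\<sigma>})"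
  unfolding cyl_def by auto

lemma cyl_mono: "S \<subseteq> T \<Longrightarrow> cyl \<Omega> S \<subseteq> cyl \<Omega> T"
  unfolding cyl_def by blast

lemma space_bernoulli [simp]: "space (bernoulli P) = UNIV"
  by (simp add: bernoulli_def space_stream_space)

lemma sets_bernoulli: "sets (bernoulli P) = sets (stream_space (count_space UNIV))"
  unfolding bernoulli_def by (rule sets_stream_space_cong) simp

lemma emeasure_bernoulli_cyl:
  fixes \<sigma> :: "'a::countable list"
  assumes "P \<in> prob_spaces_on \<Omega>" and "\<sigma> \<in> lists \<Omega>"
  shows "emeasure (bernoulli P) (cyl \<Omega> {\<sigma>}) = ennreal (\<Prod>a\<leftarrow>\<sigma>. pmf P a)"
proof -
  interpret prob_space "bernoulli P" by (rule prob_space_bernoulli)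
  show ?thesis using measure_bernoulli_cyl[OF assms] by (simp add: emeasure_eq_measure)
qed

lemma sstart_eq_cyl: "sstart UNIV \<sigma> = cyl UNIV {\<sigma>}"
proof -
  have "X \<in> sstart UNIV \<sigma> \<longleftrightarrow> stake (length \<sigma>) X = \<sigma>" for X
    by (auto simp: sstart_eq list_eq_iff_nth_eq)
  then show ?thesis by (auto simp: cyl_singleton)
qed

lemma measurable_szip_bernoulli:
  fixes P1 :: "'a::countable pmf" and P2 :: "'b::countable pmf"
  shows "(\<lambda>(X1, X2). szip X1 X2) \<in>
    measurable (bernoulli P1 \<Otimes>\<^sub>M bernoulli P2) (bernoulli (pair_pmf P1 P2))"
proof -
  have "sets (bernoulli P1 \<Otimes>\<^sub>M bernoulli P2) =
      sets (stream_space (count_space UNIV) \<Otimes>\<^sub>M stream_space (count_space UNIV))"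
    by (intro sets_pair_measure_cong sets_bernoulli)
  moreover have "sets (bernoulli (pair_pmf P1 P2)) =
      sets (stream_space (count_space UNIV \<Otimes>\<^sub>M count_space UNIV))"
    unfolding sets_bernoulli by (simp add: pair_measure_countable)
  ultimately show ?thesis
    using measurable_szip measurable_cong_sets by blast
qed

lemma prod_list_pair_pmf:
  "length \<sigma> = length \<tau> \<Longrightarrow>
    (\<Prod>a\<leftarrow>zip \<sigma> \<tau>. pmf (pair_pmf P1 P2) a) = (\<Prod>a\<leftarrow>\<sigma>. pmf P1 a) * (\<Prod>a\<leftarrow>\<tau>. pmf P2 a)"
  by (induction \<sigma> \<tau> rule: list_induct2) (auto simp: pmf_pair)

lemma prod_list_pmf_nonneg: "0 \<le> (\<Prod>a\<leftarrow>\<sigma>. pmf P a)"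
  by (induction \<sigma>) auto

text \<open>Both measures give a cylinder of the product the product of the two cylinder probabilities, and the
cylinders generate the Borel sets.\<close>

lemma bernoulli_pair_pmf:
  fixes P1 :: "'a::countable pmf" and P2 :: "'b::countable pmf"
  shows "bernoulli (pair_pmf P1 P2) =
    distr (bernoulli P1 \<Otimes>\<^sub>M bernoulli P2) (bernoulli (pair_pmf P1 P2)) (\<lambda>(X1, X2). szip X1 X2)"
    (is "?B = ?D")
proof (rule stream_space_eq_sstart[of UNIV])
  interpret B1: prob_space "bernoulli P1" by (rule prob_space_bernoulli)
  interpret B2: prob_space "bernoulli P2" by (rule prob_space_bernoulli)
  interpret pair_prob_space "bernoulli P1" "bernoulli P2" ..
  show "prob_space ?B" by (rule prob_space_bernoulli)
  show "prob_space ?D"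
    by (intro prob_space_distr measurable_szip_bernoulli)
  show "sets ?B = sets (stream_space (count_space UNIV))" by (rule sets_bernoulli)
  show "sets ?D = sets (stream_space (count_space UNIV))" by (simp add: sets_bernoulli)
  fix \<rho> :: "('a \<times> 'b) list"
  define \<sigma> \<tau> where "\<sigma> = map fst \<rho>" and "\<tau> = map snd \<rho>"
  have \<rho>: "\<rho> = zip \<sigma> \<tau>" "length \<sigma> = length \<tau>" "length \<rho> = length \<sigma>"
    by (simp_all add: \<sigma>_def \<tau>_def zip_map_fst_snd)
  have U: "P \<in> prob_spaces_on UNIV" for P :: "'c pmf" by (simp add: prob_spaces_on_def)
  have eq: "stake (length \<rho>) (szip X1 X2) = \<rho> \<longleftrightarrow>
      stake (length \<sigma>) X1 = \<sigma> \<and> stake (length \<tau>) X2 = \<tau>" for X1 X2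
  proof -
    have "stake (length \<rho>) (szip X1 X2) = zip (stake (length \<sigma>) X1) (stake (length \<tau>) X2)"
      using \<rho> by simp
    moreover have "zip a b = \<rho> \<longleftrightarrow> a = \<sigma> \<and> b = \<tau>" if "length a = length b" for a b
      using that \<rho> by (metis map_fst_zip map_snd_zip)
    ultimately show ?thesis using \<rho> by simp
  qed
  have m[measurable]: "cyl UNIV {\<rho>} \<in> sets ?B" "cyl UNIV {\<sigma>} \<in> sets (bernoulli P1)"
      "cyl UNIV {\<tau>} \<in> sets (bernoulli P2)"
    by measurable
  have "emeasure ?D (sstart UNIV \<rho>)
      = emeasure (bernoulli P1 \<Otimes>\<^sub>M bernoulli P2) (cyl UNIV {\<sigma>} \<times> cyl UNIV {\<tau>})"
    unfolding sstart_eq_cyl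
    by (subst emeasure_distr[OF measurable_szip_bernoulli m(1)])
      (auto simp: cyl_singleton space_pair_measure eq simp del: stake_szip intro!: arg_cong[where f = "emeasure _"])
  also have "\<dots> = ennreal (\<Prod>a\<leftarrow>\<sigma>. pmf P1 a) * ennreal (\<Prod>a\<leftarrow>\<tau>. pmf P2 a)"
    by (subst B2.emeasure_pair_measure_Times) (simp_all add: emeasure_bernoulli_cyl U)
  also have "\<dots> = emeasure ?B (sstart UNIV \<rho>)"
    unfolding sstart_eq_cyl using prod_list_pair_pmf[OF \<rho>(2), of P1 P2]
    by (simp add: emeasure_bernoulli_cyl U \<rho>(1)[symmetric] ennreal_mult prod_list_pmf_nonneg)
  finally show "emeasure ?B (sstart UNIV \<rho>) = emeasure ?D (sstart UNIV \<rho>)" by simp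
qed auto

lemma sections_measurable:
  fixes P1 :: "'a::countable pmf" and P2 :: "'b::countable pmf"
  assumes "U \<in> sets (bernoulli (pair_pmf P1 P2))"
  shows "{X1. szip X1 X2 \<in> U} \<in> sets (bernoulli P1)"
proof -
  have "(\<lambda>(X1, X2). szip X1 X2) -` U \<inter> space (bernoulli P1 \<Otimes>\<^sub>M bernoulli P2)
      \<in> sets (bernoulli P1 \<Otimes>\<^sub>M bernoulli P2)"
    by (rule measurable_sets[OF measurable_szip_bernoulli assms])
  from sets_Pair2[OF this, of X2] show ?thesis
    by (simp add: space_pair_measure vimage_def)
qed

text \<open>Fubini's theorem for sequences of pairs.\<close>

lemma emeasure_bernoulli_pair_pmf:
  fixes P1 :: "'a::countable pmf" and P2 :: "'b::countable pmf"
  assumes U: "U \<in> sets (bernoulli (pair_pmf P1 P2))"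
  shows "emeasure (bernoulli (pair_pmf P1 P2)) U =
    (\<integral>\<^sup>+X2. emeasure (bernoulli P1) {X1. szip X1 X2 \<in> U} \<partial>bernoulli P2)"
proof -
  interpret B1: prob_space "bernoulli P1" by (rule prob_space_bernoulli)
  interpret B2: prob_space "bernoulli P2" by (rule prob_space_bernoulli)
  interpret pair_prob_space "bernoulli P1" "bernoulli P2" ..
  let ?V = "(\<lambda>(X1, X2). szip X1 X2) -` U \<inter> space (bernoulli P1 \<Otimes>\<^sub>M bernoulli P2)"
  have "emeasure (bernoulli (pair_pmf P1 P2)) U = emeasure (bernoulli P1 \<Otimes>\<^sub>M bernoulli P2) ?V"
    by (subst bernoulli_pair_pmf) (rule emeasure_distr[OF measurable_szip_bernoulli U])
  also have "\<dots> = (\<integral>\<^sup>+X2. emeasure (bernoulli P1) ((\<lambda>X1. (X1, X2)) -` ?V) \<partial>bernoulli P2)"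
    by (rule emeasure_pair_measure_alt2) (rule measurable_sets[OF measurable_szip_bernoulli U])
  finally show ?thesis by (simp add: space_pair_measure vimage_def)
qed

lemma measurable_emeasure_sections:
  fixes P1 :: "'a::countable pmf" and P2 :: "'b::countable pmf"
  assumes U: "U \<in> sets (bernoulli (pair_pmf P1 P2))"
  shows "(\<lambda>X2. emeasure (bernoulli P1) {X1. szip X1 X2 \<in> U}) \<in> borel_measurable (bernoulli P2)"
proof -
  interpret B1: prob_space "bernoulli P1" by (rule prob_space_bernoulli)
  interpret B2: prob_space "bernoulli P2" by (rule prob_space_bernoulli)
  interpret pair_prob_space "bernoulli P1" "bernoulli P2" ..
  let ?V = "(\<lambda>(X1, X2). szip X1 X2) -` U \<inter> space (bernoulli P1 \<Otimes>\<^sub>M bernoulli P2)"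
  have "(\<lambda>X2. emeasure (bernoulli P1) ((\<lambda>X1. (X1, X2)) -` ?V)) \<in> borel_measurable (bernoulli P2)"
    by (rule measurable_emeasure_Pair2) (rule measurable_sets[OF measurable_szip_bernoulli U])
  then show ?thesis by (simp add: space_pair_measure vimage_def)
qed

lemma szip_in_streams: "szip X1 X2 \<in> streams (\<Omega>1 \<times> \<Omega>2) \<longleftrightarrow> X1 \<in> streams \<Omega>1 \<and> X2 \<in> streams \<Omega>2"
  by (auto simp: streams_iff_snth)

lemma lists_stake: "X \<in> streams \<Omega> \<Longrightarrow> stake n X \<in> lists \<Omega>"
  by (auto simp: streams_iff_snth in_set_conv_nth)

text \<open>For a list without repetitions this bounds the measure of the open set generated by its strings,
and it is equal to it if the strings are prefix-free. Unlike the measure, it can be approximated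
without looking for overlaps.\<close>

definition mass :: "'a pmf \<Rightarrow> 'a list list \<Rightarrow> real" where
  "mass P F = (\<Sum>\<sigma>\<leftarrow>F. \<Prod>a\<leftarrow>\<sigma>. pmf P a)"

lemma mass_distinct: "distinct F \<Longrightarrow> mass P F = (\<Sum>\<sigma>\<in>set F. \<Prod>a\<leftarrow>\<sigma>. pmf P a)"
  unfolding mass_def by (rule sum_list_distinct_conv_sum_set)

lemma mass_nonneg: "0 \<le> mass P F"
  unfolding mass_def by (rule sum_list_nonneg) (auto simp: prod_list_pmf_nonneg)

lemma emeasure_cyl_le_mass:
  fixes P :: "'a::countable pmf"
  assumes "P \<in> prob_spaces_on \<Omega>" "distinct F" "set F \<subseteq> lists \<Omega>"
  shows "emeasure (bernoulli P) (cyl \<Omega> (set F)) \<le> ennreal (mass P F)"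
proof -
  have "emeasure (bernoulli P) (cyl \<Omega> (set F)) \<le> (\<Sum>\<sigma>\<in>set F. emeasure (bernoulli P) (cyl \<Omega> {\<sigma>}))"
    by (subst cyl_Un) (intro emeasure_subadditive_finite; force)
  also have "\<dots> = (\<Sum>\<sigma>\<in>set F. ennreal (\<Prod>a\<leftarrow>\<sigma>. pmf P a))"
    using assms by (intro sum.cong emeasure_bernoulli_cyl) auto
  also have "\<dots> = ennreal (mass P F)"
    unfolding mass_distinct[OF assms(2)] by (rule sum_ennreal) (rule prod_list_pmf_nonneg)
  finally show ?thesis .
qed

lemma cyl_disjoint:
  assumes "prefix_free S" "\<sigma> \<in> S" "\<tau> \<in> S" "\<sigma> \<noteq> \<tau>" shows "cyl \<Omega> {\<sigma>} \<inter> cyl \<Omega> {\<tau>} = {}"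
proof (rule ccontr)
  assume "cyl \<Omega> {\<sigma>} \<inter> cyl \<Omega> {\<tau>} \<noteq> {}"
  then obtain X where X: "stake (length \<sigma>) X = \<sigma>" "stake (length \<tau>) X = \<tau>"
    by (auto simp: cyl_singleton)
  have "prefix (stake m X) (stake n X)" if "m \<le> n" for m n
    using that by (metis le_add_diff_inverse prefix_def stake_add)
  then have "prefix \<sigma> \<tau> \<or> prefix \<tau> \<sigma>" using X by (metis nle_le)
  then show False using assms unfolding prefix_free_def by metis
qed

lemma emeasure_cyl_eq_mass:
  fixes P :: "'a::countable pmf"
  assumes "P \<in> prob_spaces_on \<Omega>" "distinct F" "set F \<subseteq> lists \<Omega>" "prefix_free (set F)"
  shows "emeasure (bernoulli P) (cyl \<Omega> (set F)) = ennreal (mass P F)"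
proof -
  have "emeasure (bernoulli P) (cyl \<Omega> (set F)) = (\<Sum>\<sigma>\<in>set F. emeasure (bernoulli P) (cyl \<Omega> {\<sigma>}))"
    by (subst cyl_Un, rule sum_emeasure[symmetric])
      (auto simp: disjoint_family_on_def cyl_disjoint[OF assms(4)] intro: sets_cyl)
  also have "\<dots> = (\<Sum>\<sigma>\<in>set F. ennreal (\<Prod>a\<leftarrow>\<sigma>. pmf P a))"
    using assms by (intro sum.cong emeasure_bernoulli_cyl) auto
  also have "\<dots> = ennreal (mass P F)"
    unfolding mass_distinct[OF assms(2)] by (rule sum_ennreal) (rule prod_list_pmf_nonneg)
  finally show ?thesis .
qed

lemma prefix_free_subset: "prefix_free S \<Longrightarrow> T \<subseteq> S \<Longrightarrow> prefix_free T"
  unfolding prefix_free_def by blast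

text \<open>Every finite union of good stages is the largest one of them, so continuity from below applies.\<close>

lemma emeasure_stages_le:
  fixes P :: "'a::countable pmf" and A :: "nat \<Rightarrow> 'a list list"
  assumes P: "P \<in> prob_spaces_on \<Omega>"
    and A: "\<And>s. distinct (A s)" "\<And>s. set (A s) \<subseteq> lists \<Omega>"
      "\<And>s t. s \<le> t \<Longrightarrow> set (A s) \<subseteq> set (A t)"
    and c: "\<And>s. good s \<Longrightarrow> mass P (A s) \<le> c" "0 \<le> c"
  shows "emeasure (bernoulli P) (cyl \<Omega> (\<Union>s\<in>{s. good s}. set (A s))) \<le> ennreal c"
proof -
  let ?V = "\<lambda>n. \<Union>s\<in>{s. s \<le> n \<and> good s}. set (A s)"
  have "cyl \<Omega> (\<Union>s\<in>{s. good s}. set (A s)) = (\<Union>n. cyl \<Omega> (?V n))"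
    unfolding cyl_def by auto
  also have "emeasure (bernoulli P) \<dots> = (SUP n. emeasure (bernoulli P) (cyl \<Omega> (?V n)))"
  proof (rule SUP_emeasure_incseq[symmetric])
    show "range (\<lambda>n. cyl \<Omega> (?V n)) \<subseteq> sets (bernoulli P)" by (intro image_subsetI sets_cyl)
    show "incseq (\<lambda>n. cyl \<Omega> (?V n))"
    proof (intro incseq_SucI cyl_mono)
      show "?V n \<subseteq> ?V (Suc n)" for n by (intro UN_mono) auto
    qed
  qed
  also have "\<dots> \<le> ennreal c"
  proof (rule SUP_least)
    fix n
    show "emeasure (bernoulli P) (cyl \<Omega> (?V n)) \<le> ennreal c"
    proof (cases "\<exists>s\<le>n. good s")
      case True
      define m where "m = Max {s. s \<le> n \<and> good s}"
      have fin: "finite {s. s \<le> n \<and> good s}" by (rule finite_subset[of _ "{..n}"]) auto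
      have m: "m \<le> n" "good m" using Max_in[OF fin] True unfolding m_def by auto
      have "s \<le> m" if "s \<le> n" "good s" for s using Max_ge[OF fin, of s] that by (auto simp: m_def)
      then have "?V n = set (A m)" using A(3) m by blast
      then show ?thesis
        using emeasure_cyl_le_mass[OF P A(1,2), of m] c(1)[OF m(2)]
        by (metis ennreal_leI order_trans)
    next
      case False
      then have "cyl \<Omega> (?V n) = {}" by (auto simp: cyl_def)
      then show ?thesis by simp
    qed
  qed
  finally show ?thesis .
qed

section \<open>Decidable tests\<close>

text \<open>Each decidable predicate generates an open set, and the minimal strings that satisfy it are
prefix-free and decidable and generate the same set. So prefix-freeness need not be
considered any more: a random sequence escapes every uniformly decidable family of open sets with
measures below \<open>(1/2) ^ n\<close>. Enumerable families are covered too, by letting the length of a string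
bound the enumeration time.\<close>

lemma passes_decidable_test:
  fixes R :: "nat \<times> 'a::finite_object list \<Rightarrow> bool"
  assumes R: "computable_in \<beta>s R"
    and small: "\<And>n. 1 \<le> n \<Longrightarrow> measure (bernoulli P) (cyl \<Omega> {\<sigma>. R (n, \<sigma>)}) < (1/2) ^ n"
    and random: "ml_random \<Omega> P \<beta>s \<alpha>" and \<alpha>: "\<alpha> \<in> streams \<Omega>"
  shows "\<exists>n\<ge>1. \<forall>L. \<not> R (n, stake L \<alpha>)"
proof -
  let ?Q = "\<lambda>x. R x \<and> \<not> (\<exists>m<length (snd x). R (fst x, take m (snd x)))"
  have "computable_in \<beta>s ?Q"
    by (intro computable R computable_comp[OF R])
  from machine_of_decidable[OF this]
  obtain M where M: "\<forall>x. accepts M \<beta>s (encode x) \<longleftrightarrow> ?Q x" ..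
  define C where "C = {(n :: nat, \<sigma> :: 'a list). 1 \<le> n \<and> \<sigma> \<in> lists \<Omega> \<and> accepts M \<beta>s (encode (n, \<sigma>))}"
  have cyl: "cyl \<Omega> {\<sigma>. (n, \<sigma>) \<in> C} = cyl \<Omega> {\<sigma>. R (n, \<sigma>)}" if "1 \<le> n" for n :: nat
  proof (intro equalityI subsetI)
    fix X assume "X \<in> cyl \<Omega> {\<sigma>. R (n, \<sigma>)}"
    then have X: "X \<in> streams \<Omega>" "\<exists>L. R (n, stake L X)" by (auto simp: cyl_def)
    define L where "L = (LEAST L. R (n, stake L X))"
    have "R (n, stake L X)" unfolding L_def using X(2) by (rule LeastI_ex)
    moreover have "\<not> R (n, take m (stake L X))" if "m < L" for m
      using not_less_Least[of m "\<lambda>L. R (n, stake L X)"] that by (simp add: L_def take_stake min_def)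
    ultimately have "(n, stake L X) \<in> C"
      using that lists_stake[OF X(1)] by (simp add: C_def M)
    then show "X \<in> cyl \<Omega> {\<sigma>. (n, \<sigma>) \<in> C}" using X(1) by (auto simp: cyl_def)
  qed (auto simp: cyl_def C_def M)
  have "ml_test \<Omega> P \<beta>s C"
    unfolding ml_test_def
  proof (intro conjI allI impI)
    show "\<exists>M. C = {(n, \<sigma>). 1 \<le> n \<and> \<sigma> \<in> lists \<Omega> \<and> accepts M \<beta>s (encode (n, \<sigma>))}"
      unfolding C_def by blast
    fix n :: nat assume n: "1 \<le> n"
    show "measure (bernoulli P) (cyl \<Omega> {\<sigma>. (n, \<sigma>) \<in> C}) < (1/2) ^ n"
      using small[OF n] by (simp only: cyl[OF n])
    show "prefix_free {\<sigma>. (n, \<sigma>) \<in> C}"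
      unfolding prefix_free_def
    proof (intro ballI impI)
      fix \<sigma> \<tau> assume *: "\<sigma> \<in> {\<sigma>. (n, \<sigma>) \<in> C}" "\<tau> \<in> {\<sigma>. (n, \<sigma>) \<in> C}" "prefix \<sigma> \<tau>"
      then have "\<sigma> = take (length \<sigma>) \<tau>" "length \<sigma> \<le> length \<tau>"
        by (auto simp: prefix_def)
      moreover have "\<not> length \<sigma> < length \<tau>" using * calculation(1) by (auto simp: C_def M)
      ultimately show "\<sigma> = \<tau>" by simp
    qed
  qed
  then obtain n where "1 \<le> n" "\<alpha> \<notin> cyl \<Omega> {\<sigma>. (n, \<sigma>) \<in> C}"
    using random unfolding ml_random_def by blast
  then show ?thesis using cyl[of n] \<alpha> by (auto simp: cyl_def)
qed

lemma failed_test: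
  assumes "\<not> ml_random \<Omega> P \<beta>s \<alpha>"
  shows "\<exists>M. \<forall>n::nat\<ge>1.
    prefix_free {\<sigma> \<in> lists \<Omega>. accepts M \<beta>s (encode (n, \<sigma>))} \<and>
    measure (bernoulli P) (cyl \<Omega> {\<sigma> \<in> lists \<Omega>. accepts M \<beta>s (encode (n, \<sigma>))}) < (1/2) ^ n \<and>
    (\<exists>L. accepts M \<beta>s (encode (n, stake L \<alpha>)))"
proof -
  obtain C where C: "ml_test \<Omega> P \<beta>s C" "\<And>n. 1 \<le> n \<Longrightarrow> \<alpha> \<in> cyl \<Omega> {\<sigma>. (n, \<sigma>) \<in> C}"
    using assms unfolding ml_random_def by blast
  obtain M where M: "C = {(n, \<sigma>). 1 \<le> n \<and> \<sigma> \<in> lists \<Omega> \<and> accepts M \<beta>s (encode (n, \<sigma>))}"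
    using C(1) unfolding ml_test_def by blast
  have eq: "{\<sigma>. (n, \<sigma>) \<in> C} = {\<sigma> \<in> lists \<Omega>. accepts M \<beta>s (encode (n, \<sigma>))}" if "1 \<le> n" for n :: nat
    using that by (auto simp: M)
  have t: "prefix_free {\<sigma>. (n, \<sigma>) \<in> C}" "measure (bernoulli P) (cyl \<Omega> {\<sigma>. (n, \<sigma>) \<in> C}) < (1/2) ^ n"
    if "1 \<le> n" for n :: nat
    using C(1) that unfolding ml_test_def by blast+
  show ?thesis
  proof (intro exI[of _ M] allI impI conjI)
    fix n :: nat assume n: "1 \<le> n"
    show "prefix_free {\<sigma> \<in> lists \<Omega>. accepts M \<beta>s (encode (n, \<sigma>))}"
      using t(1)[OF n] unfolding eq[OF n] .
    show "measure (bernoulli P) (cyl \<Omega> {\<sigma> \<in> lists \<Omega>. accepts M \<beta>s (encode (n, \<sigma>))}) < (1/2) ^ n"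
      using t(2)[OF n] unfolding eq[OF n] .
    show "\<exists>L. accepts M \<beta>s (encode (n, stake L \<alpha>))"
      using C(2)[OF n] by (auto simp: cyl_def M)
  qed
qed

section \<open>Semideciding inequalities between masses\<close>

lemma computable_prod_decode [computable]:
  assumes "computable_in \<beta>s n" shows "computable_in \<beta>s (\<lambda>x. prod_decode (n x))"
  by (rule computable_if_encode) (simp add: encode_prod_def encode_nat_def assms)

definition rat_floor :: "nat \<Rightarrow> nat \<Rightarrow> nat" where
  "rat_floor k c =
     (if fst (prod_decode c) mod 2 = 0
      then fst (prod_decode c) div 2 * 2 ^ k div (snd (prod_decode c) div 2) else 0)"

text \<open>Codes of rationals are turned into natural multiples of \<open>(1/2) ^ k\<close>, which spares rational
arithmetic later. The numerator of a negative rational has an odd code, and the result is then 0.\<close>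

lemma rat_floor_encode: "rat_floor k (encode q) = nat \<lfloor>of_rat q * 2 ^ k :: real\<rfloor>"
proof -
  obtain a b where ab: "quotient_of q = (a, b)" by fastforce
  have b: "b > 0" using quotient_of_denom_pos[OF ab] .
  have q: "of_rat q = (of_int a / of_int b :: real)"
    using quotient_of_div[OF ab] by (simp add: of_rat_divide)
  have c: "prod_decode (encode q) = (int_encode a, int_encode b)"
    by (simp add: encode_rat_def ab encode_prod_def encode_int_def)
  have B: "int_encode b div 2 = nat b" using b by (simp add: int_encode_def sum_encode_def)
  show ?thesis
  proof (cases "0 \<le> a")
    case True
    have A: "int_encode a mod 2 = 0" "int_encode a div 2 = nat a"
      using True by (simp_all add: int_encode_def sum_encode_def)
    have "(of_rat q * 2 ^ k :: real) = of_int (a * 2 ^ k) / of_int b" by (simp add: q)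
    then have "\<lfloor>of_rat q * 2 ^ k :: real\<rfloor> = a * 2 ^ k div b"
      by (simp only: floor_divide_of_int_eq)
    moreover have "nat (a * 2 ^ k div b) = nat a * 2 ^ k div nat b"
      using True b by (simp add: nat_div_distrib nat_mult_distrib nat_power_eq)
    ultimately show ?thesis by (simp add: rat_floor_def c A B)
  next
    case False
    then have "int_encode a mod 2 = 1" by (simp add: int_encode_def sum_encode_def)
    moreover have "(of_rat q * 2 ^ k :: real) \<le> 0"
      using False b by (simp add: q divide_nonpos_pos mult_nonpos_nonneg)
    ultimately show ?thesis by (simp add: rat_floor_def c)
  qed
qed

lemma computable_rat_floor [computable]:
  assumes "computable_in \<beta>s k" "computable_in \<beta>s c"
  shows "computable_in \<beta>s (\<lambda>x. rat_floor (k x) (c x))"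
  unfolding rat_floor_def by (intro computable assms)

text \<open>What remains of computability once the strings whose probabilities are approximated have been
checked to be strings over \<open>\<Omega>\<close>.\<close>

definition approximator :: "machine \<Rightarrow> 'a::finite_object set \<Rightarrow> 'a pmf \<Rightarrow> bool" where
  "approximator M \<Omega> P \<longleftrightarrow> (\<forall>a\<in>\<Omega>. \<forall>k. \<exists>q :: rat.
     computes M [] (encode (a, k)) (encode q) \<and> \<bar>pmf P a - of_rat q\<bar> \<le> (1/2) ^ k)"

lemma approximator_exists:
  assumes "computable_pmf \<Omega> P" shows "\<exists>M. approximator M \<Omega> P"
proof -
  obtain f :: "'a \<times> nat \<rightharpoonup> rat" where f: "partial_recursive f" "dom f = \<Omega> \<times> UNIV"
      "\<forall>a\<in>\<Omega>. \<forall>k. \<bar>pmf P a - of_rat (the (f (a, k)))\<bar> \<le> (1/2) ^ k"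
    using assms unfolding computable_pmf_def by blast
  obtain M where M: "\<forall>x. case f x of None \<Rightarrow> \<not> accepts M [] (encode x)
      | Some y \<Rightarrow> computes M [] (encode x) (encode y)"
    using f(1) unfolding partial_recursive_def by blast
  have "approximator M \<Omega> P"
    unfolding approximator_def
  proof (intro ballI allI exI conjI)
    fix a k assume a: "a \<in> \<Omega>"
    then obtain q where q: "f (a, k) = Some q" using f(2) by blast
    then show "computes M [] (encode (a, k)) (encode (the (f (a, k))))"
      using M[rule_format, of "(a, k)"] by simp
    show "\<bar>pmf P a - of_rat (the (f (a, k)))\<bar> \<le> (1/2) ^ k" using f(3) a by blast
  qed
  then show ?thesis ..
qed

definition letter_run :: "machine \<Rightarrow> nat \<Rightarrow> nat \<Rightarrow> 'a::finite_object \<Rightarrow> nat" where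
  "letter_run M t k a = run_within M [] t (encode (a, k))"

text \<open>Rounding down and subtracting 1 turns an approximation with error \<open>(1/2) ^ k\<close> into a lower bound, in
units of \<open>(1/2) ^ k\<close>.\<close>

definition letter_low :: "machine \<Rightarrow> nat \<Rightarrow> nat \<Rightarrow> 'a::finite_object \<Rightarrow> nat" where
  "letter_low M t k a = rat_floor k (letter_run M t k a - 1) - 1"

text \<open>Rounding after every factor keeps the unit \<open>(1/2) ^ k\<close> for strings of all lengths.\<close>

definition string_low :: "machine \<Rightarrow> nat \<Rightarrow> nat \<Rightarrow> 'a::finite_object list \<Rightarrow> nat" where
  "string_low M t k \<sigma> = foldl (\<lambda>r a. r * letter_low M t k a div 2 ^ k) (2 ^ k) \<sigma>"

definition ready :: "machine \<Rightarrow> nat \<Rightarrow> nat \<Rightarrow> 'a::finite_object list list \<Rightarrow> bool" where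
  "ready M t k F \<longleftrightarrow> (\<forall>\<sigma>\<in>set F. \<forall>a\<in>set \<sigma>. 0 < letter_run M t k a)"

text \<open>That the mass of a finite list of strings is below, or above, \<open>(1/2) ^ n\<close> is
semidecidable: for strings over the alphabet, it is recognized at some stage \<open>t\<close> if it is true, and
never if it is false. The precision \<open>k\<close> and the time are searched for together.\<close>

definition mass_less :: "machine \<Rightarrow> nat \<Rightarrow> nat \<Rightarrow> 'a::finite_object list list \<Rightarrow> bool" where
  "mass_less M t n F \<longleftrightarrow> (\<exists>k\<le>t. ready M t k F \<and>
     (\<Sum>\<sigma>\<leftarrow>F. string_low M t k \<sigma> + 4 * length \<sigma>) * 2 ^ n < 2 ^ k)"

definition mass_greater :: "machine \<Rightarrow> nat \<Rightarrow> nat \<Rightarrow> 'a::finite_object list list \<Rightarrow> bool" where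
  "mass_greater M t n F \<longleftrightarrow> (\<exists>k\<le>t. ready M t k F \<and>
     2 ^ k < (\<Sum>\<sigma>\<leftarrow>F. string_low M t k \<sigma>) * 2 ^ n)"

lemma computable_mass_less [computable]:
  assumes "computable_in \<beta>s t" "computable_in \<beta>s n" "computable_in \<beta>s F"
  shows "computable_in \<beta>s (\<lambda>x. mass_less M (t x) (n x) (F x))"
  unfolding mass_less_def ready_def string_low_def letter_low_def letter_run_def
  by (intro computable assms computable_comp[OF assms(1)] computable_comp[OF assms(2)] computable_comp[OF assms(3)])

lemma computable_mass_greater [computable]:
  assumes "computable_in \<beta>s t" "computable_in \<beta>s n" "computable_in \<beta>s F"
  shows "computable_in \<beta>s (\<lambda>x. mass_greater M (t x) (n x) (F x))"
  unfolding mass_greater_def ready_def string_low_def letter_low_def letter_run_def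
  by (intro computable assms computable_comp[OF assms(1)] computable_comp[OF assms(2)] computable_comp[OF assms(3)])

lemma letter_run_mono: "letter_run M t k a = Suc c \<Longrightarrow> t \<le> t' \<Longrightarrow> letter_run M t' k a = Suc c"
  unfolding letter_run_def using run_within_mono[of M t "[]" "encode (a, k)" c t'] by simp

lemma letter_run_unique:
  "letter_run M t k a = Suc c \<Longrightarrow> letter_run M t' k a = Suc c' \<Longrightarrow> c = c'"
  using letter_run_mono[of M t k a c "max t t'"] letter_run_mono[of M t' k a c' "max t t'"] by simp

lemma letter_low_bounds:
  assumes "approximator M \<Omega> P" "a \<in> \<Omega>" "0 < letter_run M t k a"
  shows "real (letter_low M t k a) \<le> 2 ^ k * pmf P a" "2 ^ k * pmf P a \<le> letter_low M t k a + 3"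
proof -
  obtain q where q: "computes M [] (encode (a, k)) (encode (q :: rat))" "\<bar>pmf P a - of_rat q\<bar> \<le> (1/2) ^ k"
    using assms(1,2) unfolding approximator_def by blast
  then obtain s where "letter_run M s k a = Suc (encode q)"
    unfolding computes_iff_run_within letter_run_def by auto
  moreover obtain c where "letter_run M t k a = Suc c" using assms(3) by (cases "letter_run M t k a") auto
  ultimately have "letter_run M t k a - 1 = encode q" using letter_run_unique by fastforce
  define x where "x = (of_rat q * 2 ^ k :: real)"
  have low: "letter_low M t k a = nat \<lfloor>x\<rfloor> - 1"
    unfolding letter_low_def \<open>letter_run M t k a - 1 = encode q\<close> rat_floor_encode x_def ..
  have "\<bar>2 ^ k * pmf P a - x\<bar> = 2 ^ k * \<bar>pmf P a - of_rat q\<bar>"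
  proof -
    have "2 ^ k * pmf P a - x = 2 ^ k * (pmf P a - of_rat q)" by (simp add: x_def algebra_simps)
    then show ?thesis by (simp add: abs_mult)
  qed
  also have "\<dots> \<le> 2 ^ k * (1/2) ^ k" using q(2) by (intro mult_left_mono) auto
  also have "\<dots> = 1" by (simp add: power_one_over)
  finally have d: "\<bar>2 ^ k * pmf P a - x\<bar> \<le> 1" .
  have nonneg: "0 \<le> 2 ^ k * pmf P a" by simp
  show "real (letter_low M t k a) \<le> 2 ^ k * pmf P a"
    unfolding low using d nonneg by linarith
  show "2 ^ k * pmf P a \<le> letter_low M t k a + 3"
    unfolding low using d nonneg by linarith
qed

lemma prod_list_pmf_le_1: "(\<Prod>a\<leftarrow>\<sigma>. pmf P a) \<le> 1"
  by (induction \<sigma>) (auto intro: mult_le_one simp: pmf_le_1 prod_list_pmf_nonneg)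

text \<open>Every letter contributes an error of at most 4 units: 3 from the letter itself, as the remaining
factors are at most 1, and 1 from rounding the product.\<close>

lemma string_low_bounds:
  assumes "\<And>a. a \<in> set \<sigma> \<Longrightarrow> real (letter_low M t k a) \<le> 2 ^ k * pmf P a"
    and "\<And>a. a \<in> set \<sigma> \<Longrightarrow> 2 ^ k * pmf P a \<le> letter_low M t k a + 3"
  shows "real (string_low M t k \<sigma>) \<le> 2 ^ k * (\<Prod>a\<leftarrow>\<sigma>. pmf P a) \<and>
    2 ^ k * (\<Prod>a\<leftarrow>\<sigma>. pmf P a) \<le> string_low M t k \<sigma> + 4 * length \<sigma>"
  using assms
proof (induction \<sigma> rule: rev_induct)
  case Nil
  then show ?case by (simp add: string_low_def)
next
  case (snoc a \<sigma>)
  define v l pr p K where "v = real (string_low M t k \<sigma>)" and "l = real (letter_low M t k a)"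
    and "pr = (\<Prod>a\<leftarrow>\<sigma>. pmf P a)" and "p = pmf P a" and "K = (2 ^ k :: real)"
  have IH: "v \<le> K * pr" "K * pr \<le> v + 4 * length \<sigma>"
    using snoc by (simp_all add: v_def K_def pr_def)
  have l: "l \<le> K * p" "K * p \<le> l + 3" using snoc.prems[of a] by (simp_all add: l_def K_def p_def)
  have K: "K > 0" by (simp add: K_def)
  have pr: "0 \<le> pr" "pr \<le> 1" by (auto simp: pr_def prod_list_pmf_nonneg prod_list_pmf_le_1)
  have p: "0 \<le> p" "p \<le> 1" by (auto simp: p_def pmf_le_1)
  have vl: "0 \<le> v" "0 \<le> l" by (simp_all add: v_def l_def)
  have "string_low M t k (\<sigma> @ [a]) = string_low M t k \<sigma> * letter_low M t k a div 2 ^ k"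
    by (simp add: string_low_def)
  then have w: "real (string_low M t k (\<sigma> @ [a])) = \<lfloor>v * l / K\<rfloor>"
    using floor_divide_of_nat_eq[of "string_low M t k \<sigma> * letter_low M t k a" "2 ^ k", where ?'a = real]
    by (simp add: v_def l_def K_def)
  have "v * l \<le> (K * pr) * (K * p)" using IH l vl pr p K by (intro mult_mono) auto
  then have 1: "v * l / K \<le> K * (pr * p)" using K by (simp add: field_simps)
  have "K * (pr * p) = pr * (K * p)" by simp
  also have "\<dots> \<le> pr * (l + 3)" using l(2) pr by (intro mult_left_mono) auto
  also have "\<dots> = (K * pr) * l / K + 3 * pr" using K by (simp add: field_simps)
  also have "\<dots> \<le> (v + 4 * length \<sigma>) * l / K + 3 * pr"
    using IH(2) vl K by (intro add_right_mono divide_right_mono mult_right_mono) auto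
  also have "\<dots> = v * l / K + 4 * length \<sigma> * (l / K) + 3 * pr" using K by (simp add: field_simps)
  also have "\<dots> \<le> v * l / K + 4 * length \<sigma> * 1 + 3 * 1"
  proof -
    have "l \<le> K" using l(1) p K by (smt (verit) mult_left_le)
    then have "l / K \<le> 1" using K by simp
    then have "real (4 * length \<sigma>) * (l / K) \<le> real (4 * length \<sigma>) * 1"
      by (intro mult_left_mono) auto
    with pr show ?thesis by simp
  qed
  finally have 2: "K * (pr * p) \<le> v * l / K + 4 * length \<sigma> + 3" by simp
  have "real (string_low M t k (\<sigma> @ [a])) \<le> v * l / K" "v * l / K \<le> real (string_low M t k (\<sigma> @ [a])) + 1"
    unfolding w by linarith+
  with 1 2 show ?case
    by (simp add: K_def[symmetric] pr_def[symmetric] p_def[symmetric])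
qed

lemma real_sum_list: "real (\<Sum>x\<leftarrow>xs. f x) = (\<Sum>x\<leftarrow>xs. real (f x))"
  by (induction xs) auto

lemma real_mult_power_less: "x * 2 ^ n < 2 ^ k \<longleftrightarrow> real x * 2 ^ n < 2 ^ k"
  using of_nat_less_iff[of "x * 2 ^ n" "2 ^ k", where ?'a = real] by simp

lemma real_less_mult_power: "2 ^ k < x * 2 ^ n \<longleftrightarrow> 2 ^ k < real x * 2 ^ n"
  using of_nat_less_iff[of "2 ^ k" "x * 2 ^ n", where ?'a = real] by simp

context
  fixes M :: machine and \<Omega> :: "'a::finite_object set" and P :: "'a pmf"
  assumes M: "approximator M \<Omega> P"
begin

lemma mass_bounds:
  assumes "set F \<subseteq> lists \<Omega>" "ready M t k F"
  shows "(\<Sum>\<sigma>\<leftarrow>F. string_low M t k \<sigma>) \<le> 2 ^ k * mass P F"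
    and "2 ^ k * mass P F \<le> (\<Sum>\<sigma>\<leftarrow>F. string_low M t k \<sigma> + 4 * length \<sigma>)"
proof -
  have b: "real (string_low M t k \<sigma>) \<le> 2 ^ k * (\<Prod>a\<leftarrow>\<sigma>. pmf P a) \<and>
      2 ^ k * (\<Prod>a\<leftarrow>\<sigma>. pmf P a) \<le> string_low M t k \<sigma> + 4 * length \<sigma>" if "\<sigma> \<in> set F" for \<sigma>
    using assms that by (intro string_low_bounds letter_low_bounds[OF M]) (auto simp: ready_def)
  show "(\<Sum>\<sigma>\<leftarrow>F. string_low M t k \<sigma>) \<le> 2 ^ k * mass P F"
    unfolding mass_def sum_list_const_mult[symmetric] real_sum_list
    using b by (intro sum_list_mono) auto
  show "2 ^ k * mass P F \<le> (\<Sum>\<sigma>\<leftarrow>F. string_low M t k \<sigma> + 4 * length \<sigma>)"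
    unfolding mass_def sum_list_const_mult[symmetric] real_sum_list
    using b by (intro sum_list_mono) auto
qed

lemma ready_mono: "ready M t k F \<Longrightarrow> t \<le> t' \<Longrightarrow> ready M t' k F"
  unfolding ready_def using letter_run_mono by (metis Suc_pred zero_less_Suc)

lemma string_low_mono: "ready M t k F \<Longrightarrow> t \<le> t' \<Longrightarrow> \<sigma> \<in> set F \<Longrightarrow> string_low M t' k \<sigma> = string_low M t k \<sigma>"
proof -
  assume *: "ready M t k F" "t \<le> t'" "\<sigma> \<in> set F"
  have "letter_low M t' k a = letter_low M t k a" if "a \<in> set \<sigma>" for a
  proof -
    have "0 < letter_run M t k a" using * that by (auto simp: ready_def)
    then have "letter_run M t' k a = letter_run M t k a"
      using letter_run_mono[of M t k a _ t'] *(2) by (metis Suc_pred)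
    then show ?thesis by (simp add: letter_low_def)
  qed
  then show ?thesis unfolding string_low_def by (intro foldl_cong) auto
qed

lemma mass_less_mono: "mass_less M t n F \<Longrightarrow> t \<le> t' \<Longrightarrow> mass_less M t' n F"
proof -
  assume *: "mass_less M t n F" "t \<le> t'"
  then obtain k where k: "k \<le> t" "ready M t k F"
    "(\<Sum>\<sigma>\<leftarrow>F. string_low M t k \<sigma> + 4 * length \<sigma>) * 2 ^ n < 2 ^ k"
    unfolding mass_less_def by blast
  have "(\<Sum>\<sigma>\<leftarrow>F. string_low M t' k \<sigma> + 4 * length \<sigma>) = (\<Sum>\<sigma>\<leftarrow>F. string_low M t k \<sigma> + 4 * length \<sigma>)"
    using string_low_mono[OF k(2) *(2)] by (intro arg_cong[where f = sum_list] map_cong) auto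
  with k *(2) ready_mono show ?thesis
    unfolding mass_less_def by (intro exI[of _ k]) auto
qed

lemma mass_greater_mono: "mass_greater M t n F \<Longrightarrow> t \<le> t' \<Longrightarrow> mass_greater M t' n F"
proof -
  assume *: "mass_greater M t n F" "t \<le> t'"
  then obtain k where k: "k \<le> t" "ready M t k F"
    "2 ^ k < (\<Sum>\<sigma>\<leftarrow>F. string_low M t k \<sigma>) * 2 ^ n"
    unfolding mass_greater_def by blast
  have "(\<Sum>\<sigma>\<leftarrow>F. string_low M t' k \<sigma>) = (\<Sum>\<sigma>\<leftarrow>F. string_low M t k \<sigma>)"
    using string_low_mono[OF k(2) *(2)] by (intro arg_cong[where f = sum_list] map_cong) auto
  with k *(2) ready_mono show ?thesis
    unfolding mass_greater_def by (intro exI[of _ k]) auto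
qed

lemma eventually_ready: 
  assumes "set F \<subseteq> lists \<Omega>" shows "\<exists>t\<ge>k. ready M t k F"
proof -
  let ?A = "\<Union>\<sigma>\<in>set F. set \<sigma>"
  have "\<exists>t. 0 < letter_run M t k a" if "a \<in> ?A" for a
  proof -
    have "a \<in> \<Omega>" using that assms by auto
    then obtain q where "computes M [] (encode (a, k)) (encode (q :: rat))"
      using M unfolding approximator_def by blast
    then show ?thesis unfolding computes_iff_run_within letter_run_def by (metis list.map(1) zero_less_Suc)
  qed
  then obtain t where t: "\<And>a. a \<in> ?A \<Longrightarrow> 0 < letter_run M (t a) k a" by metis
  define T where "T = Max (insert k (t ` ?A))"
  have fin: "finite (insert k (t ` ?A))" by auto
  have "0 < letter_run M T k a" if a: "a \<in> ?A" for a
  proof -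
    have "t a \<le> T" unfolding T_def using fin a by (intro Max_ge) auto
    moreover have "letter_run M (t a) k a = Suc (letter_run M (t a) k a - 1)" using t[OF a] by simp
    ultimately show ?thesis using letter_run_mono by (metis zero_less_Suc)
  qed
  then have "ready M T k F" unfolding ready_def by blast
  moreover have "k \<le> T" unfolding T_def using fin by (intro Max_ge) auto
  ultimately show ?thesis by blast
qed

text \<open>The error \<open>e\<close> in units of \<open>(1/2) ^ k\<close> does not depend on \<open>k\<close>, so it falls below the gap \<open>g\<close> for large \<open>k\<close>.\<close>

lemma mass_less_iff:
  assumes F: "set F \<subseteq> lists \<Omega>"
  shows "(\<exists>t. mass_less M t n F) \<longleftrightarrow> mass P F < (1/2) ^ n"
proof
  assume "\<exists>t. mass_less M t n F"
  then obtain t k where k: "ready M t k F"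
    "(\<Sum>\<sigma>\<leftarrow>F. string_low M t k \<sigma> + 4 * length \<sigma>) * 2 ^ n < 2 ^ k"
    unfolding mass_less_def by blast
  have "2 ^ k * mass P F * 2 ^ n \<le> real (\<Sum>\<sigma>\<leftarrow>F. string_low M t k \<sigma> + 4 * length \<sigma>) * 2 ^ n"
    using mass_bounds(2)[OF F k(1)] by (intro mult_right_mono) auto
  also have "\<dots> < 2 ^ k" using k(2) by (simp only: real_mult_power_less)
  finally show "mass P F < (1/2) ^ n" by (simp add: field_simps)
next
  assume less: "mass P F < (1/2) ^ n"
  define e where "e = (\<Sum>\<sigma>\<leftarrow>F. 4 * length \<sigma>)"
  define g where "g = 1 - mass P F * 2 ^ n"
  have g: "0 < g" using less by (simp add: g_def field_simps)
  obtain k where k: "real e * 2 ^ n / g < 2 ^ k"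
    using real_arch_pow[of 2 "real e * 2 ^ n / g"] by auto
  obtain t where t: "k \<le> t" "ready M t k F" using eventually_ready[OF F] by blast
  have "real (\<Sum>\<sigma>\<leftarrow>F. string_low M t k \<sigma> + 4 * length \<sigma>) * 2 ^ n
      = (real (\<Sum>\<sigma>\<leftarrow>F. string_low M t k \<sigma>) + e) * 2 ^ n"
    by (simp add: sum_list_addf e_def)
  also have "\<dots> \<le> (2 ^ k * mass P F + e) * 2 ^ n"
    using mass_bounds(1)[OF F t(2)] by (intro mult_right_mono add_right_mono) auto
  also have "\<dots> = 2 ^ k * (1 - g) + e * 2 ^ n" by (simp add: g_def algebra_simps)
  also have "\<dots> < 2 ^ k" using k g by (simp add: field_simps)
  finally have "(\<Sum>\<sigma>\<leftarrow>F. string_low M t k \<sigma> + 4 * length \<sigma>) * 2 ^ n < 2 ^ k"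
    by (simp only: real_mult_power_less)
  with t show "\<exists>t. mass_less M t n F" unfolding mass_less_def by blast
qed

lemma mass_greater_iff:
  assumes F: "set F \<subseteq> lists \<Omega>"
  shows "(\<exists>t. mass_greater M t n F) \<longleftrightarrow> (1/2) ^ n < mass P F"
proof
  assume "\<exists>t. mass_greater M t n F"
  then obtain t k where k: "ready M t k F" "2 ^ k < (\<Sum>\<sigma>\<leftarrow>F. string_low M t k \<sigma>) * 2 ^ n"
    unfolding mass_greater_def by blast
  have "2 ^ k < real (\<Sum>\<sigma>\<leftarrow>F. string_low M t k \<sigma>) * 2 ^ n"
    using k(2) by (simp only: real_less_mult_power)
  also have "\<dots> \<le> 2 ^ k * mass P F * 2 ^ n"
    using mass_bounds(1)[OF F k(1)] by (intro mult_right_mono) auto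
  finally show "(1/2) ^ n < mass P F" by (simp add: field_simps)
next
  assume less: "(1/2) ^ n < mass P F"
  define e where "e = (\<Sum>\<sigma>\<leftarrow>F. 4 * length \<sigma>)"
  define g where "g = mass P F * 2 ^ n - 1"
  have g: "0 < g" using less by (simp add: g_def field_simps)
  obtain k where k: "real e * 2 ^ n / g < 2 ^ k"
    using real_arch_pow[of 2 "real e * 2 ^ n / g"] by auto
  obtain t where t: "k \<le> t" "ready M t k F" using eventually_ready[OF F] by blast
  have "2 ^ k < 2 ^ k * (1 + g) - e * 2 ^ n" using k g by (simp add: field_simps)
  also have "\<dots> = (2 ^ k * mass P F - e) * 2 ^ n" by (simp add: g_def algebra_simps)
  also have "\<dots> \<le> real (\<Sum>\<sigma>\<leftarrow>F. string_low M t k \<sigma>) * 2 ^ n"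
    using mass_bounds(2)[OF F t(2)] by (intro mult_right_mono) (auto simp: sum_list_addf e_def)
  finally have "2 ^ k < (\<Sum>\<sigma>\<leftarrow>F. string_low M t k \<sigma>) * 2 ^ n"
    by (simp only: real_less_mult_power)
  with t show "\<exists>t. mass_greater M t n F" unfolding mass_greater_def by blast
qed

end

section \<open>Enumeration by stages\<close>

definition strings_below :: "nat \<Rightarrow> nat list list" where
  "strings_below s = map list_decode [0..<s]"

text \<open>The strings found by stage \<open>s\<close> of an enumeration: their codes are below \<open>s\<close>, machine \<open>M\<close> has accepted
all their letters, and \<open>acc\<close> holds. The check of the letters is needed because a machine that
defines a test may accept strings over other letters, which do not count for the test but would
spoil the mass.\<close>

definition enum_stage :: "machine \<Rightarrow> (nat \<Rightarrow> nat list \<Rightarrow> bool) \<Rightarrow> nat \<Rightarrow> nat list list" where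
  "enum_stage M acc s =
     filter (\<lambda>\<sigma>. (\<forall>a\<in>set \<sigma>. accepts_within M [] s (encode a)) \<and> acc s \<sigma>) (strings_below s)"

lemma computable_enum_stage [computable]:
  assumes "computable_in \<beta>s (\<lambda>p. acc (fst p) (s (fst p)) (snd p))" "computable_in \<beta>s s"
  shows "computable_in \<beta>s (\<lambda>x. enum_stage M (acc x) (s x))"
  unfolding enum_stage_def strings_below_def
  by (intro computable assms computable_comp[OF assms(2)])

lemma encode_nat_list: "encode (\<sigma> :: nat list) = list_encode \<sigma>"
  by (simp add: encode_list_def encode_nat_def[abs_def])

lemma set_strings_below: "\<sigma> \<in> set (strings_below s) \<longleftrightarrow> encode \<sigma> < s"
  by (auto simp: strings_below_def encode_nat_list image_iff intro!: bexI[of _ "list_encode \<sigma>"])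

lemma distinct_enum_stage: "distinct (enum_stage M acc s)"
  unfolding enum_stage_def strings_below_def by (simp add: distinct_map inj_list_decode)

lemma length_enum_stage: "\<sigma> \<in> set (enum_stage M acc s) \<Longrightarrow> length \<sigma> < s"
  using length_le_encode[of \<sigma>] by (auto simp: enum_stage_def set_strings_below)

lemma enum_stage_acc: "\<sigma> \<in> set (enum_stage M acc s) \<Longrightarrow> acc s \<sigma>"
  by (simp add: enum_stage_def)

lemma accepts_within_mono_Nil:
  "accepts_within M [] s x \<Longrightarrow> s \<le> t \<Longrightarrow> accepts_within M [] t x"
  using accepts_within_mono[of M s "[]" x t] by simp

text \<open>The bound on the length allows \<open>acc s\<close> to consult a prefix of length \<open>s\<close> of another sequence.\<close>

lemma enum_stage_mono:
  assumes "\<And>s t \<sigma>. length \<sigma> < s \<Longrightarrow> acc s \<sigma> \<Longrightarrow> s \<le> t \<Longrightarrow> acc t \<sigma>" and "s \<le> t"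
  shows "set (enum_stage M acc s) \<subseteq> set (enum_stage M acc t)"
proof
  fix \<sigma> assume \<sigma>: "\<sigma> \<in> set (enum_stage M acc s)"
  then have "length \<sigma> < s" by (rule length_enum_stage)
  with \<sigma> show "\<sigma> \<in> set (enum_stage M acc t)"
    using assms(1)[of \<sigma> s t] assms(2) accepts_within_mono_Nil[OF _ assms(2)]
    by (auto simp: enum_stage_def set_strings_below)
qed

lemma enum_stage_sound:
  assumes "\<And>a. a \<in> \<Omega> \<longleftrightarrow> accepts M [] (encode a)"
  shows "set (enum_stage M acc s) \<subseteq> lists \<Omega>"
  using assms accepts_iff_accepts_within[of M "[]"] by (auto simp: enum_stage_def) blast

lemma enum_stage_complete:
  assumes \<Omega>: "\<And>a. a \<in> \<Omega> \<longleftrightarrow> accepts M [] (encode a)"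
    and mono: "\<And>s t \<sigma>. length \<sigma> < s \<Longrightarrow> acc s \<sigma> \<Longrightarrow> s \<le> t \<Longrightarrow> acc t \<sigma>"
    and \<sigma>: "\<sigma> \<in> lists \<Omega>" "acc s \<sigma>" "length \<sigma> < s"
  shows "\<exists>t. \<sigma> \<in> set (enum_stage M acc t)"
proof -
  have "\<exists>s. accepts_within M [] s (encode a)" if "a \<in> set \<sigma>" for a
    using that \<sigma>(1) \<Omega> accepts_iff_accepts_within[of M "[]"] by auto
  then obtain u where u: "\<And>a. a \<in> set \<sigma> \<Longrightarrow> accepts_within M [] (u a) (encode a)" by metis
  define t where "t = Max (insert s (insert (Suc (encode \<sigma>)) (u ` set \<sigma>)))"
  have t: "s \<le> t" "Suc (encode \<sigma>) \<le> t" "\<And>a. a \<in> set \<sigma> \<Longrightarrow> u a \<le> t"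
    unfolding t_def by (intro Max_ge; simp)+
  then have "\<sigma> \<in> set (enum_stage M acc t)"
    using mono[OF \<sigma>(3,2)] accepts_within_mono_Nil[OF u] by (auto simp: enum_stage_def set_strings_below)
  then show ?thesis ..
qed

section \<open>Van Lambalgen's theorem\<close>

text \<open>A constant of its own makes the computability rule for prefixes of the oracle applicable.\<close>

definition oracle_prefix :: "nat stream list \<Rightarrow> nat \<Rightarrow> nat list list" where
  "oracle_prefix \<beta>s s = map (stake s) \<beta>s"

lemma oracle_prefix_Cons: "oracle_prefix (\<alpha> # \<beta>s) s = stake s \<alpha> # oracle_prefix \<beta>s s"
  by (simp add: oracle_prefix_def)

lemma computable_oracle_prefix [computable]:
  assumes "computable_in \<beta>s s" shows "computable_in \<beta>s (\<lambda>x. oracle_prefix \<beta>s (s x))"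
  unfolding oracle_prefix_def by (rule computable_oracle_prefixes[OF assms])

lemma computable_oracle_prefix_tl:
  assumes "computable_in (\<alpha> # \<beta>s) s" shows "computable_in (\<alpha> # \<beta>s) (\<lambda>x. oracle_prefix \<beta>s (s x))"
  using computable_tl[OF computable_oracle_prefix[OF assms]] by (simp add: oracle_prefix_Cons)

lemma computable_oracle_prefix_hd:
  assumes "computable_in (\<alpha> # \<beta>s) s" shows "computable_in (\<alpha> # \<beta>s) (\<lambda>x. stake (s x) \<alpha>)"
  using computable_nth_or[OF computable_const[of _ "[]"] computable_oracle_prefix[OF assms] computable_const[of _ 0]]
  by (simp add: oracle_prefix_Cons nth_or)

lemma accepts_oracle_prefix:
  "accepts M \<beta>s x \<longleftrightarrow> (\<exists>s. accepts_within M (oracle_prefix \<beta>s s) s x)"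
  unfolding oracle_prefix_def by (rule accepts_iff_accepts_within)

lemma accepts_oracle_prefix_mono:
  "accepts_within M (oracle_prefix \<beta>s s) s x \<Longrightarrow> s \<le> t \<Longrightarrow> accepts_within M (oracle_prefix \<beta>s t) t x"
  unfolding oracle_prefix_def by (rule accepts_within_mono)

lemma prefix_stake: "prefix \<sigma> (stake L X) \<longleftrightarrow> length \<sigma> \<le> L \<and> stake (length \<sigma>) X = \<sigma>"
proof
  assume "prefix \<sigma> (stake L X)"
  then show "length \<sigma> \<le> L \<and> stake (length \<sigma>) X = \<sigma>"
    by (metis length_stake prefix_length_le prefix_def append_eq_conv_conj take_stake min.absorb2 min.commute)
next
  assume "length \<sigma> \<le> L \<and> stake (length \<sigma>) X = \<sigma>"
  then show "prefix \<sigma> (stake L X)" by (metis le_add_diff_inverse prefix_def stake_add)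
qed

lemma cyl_extensions:
  "cyl \<Omega> {\<tau>. \<exists>\<sigma>\<in>S. prefix \<sigma> \<tau>} = cyl \<Omega> S"
proof -
  have "(\<exists>L. \<exists>\<sigma>\<in>S. prefix \<sigma> (stake L X)) \<longleftrightarrow> (\<exists>L. stake L X \<in> S)" for X
  proof
    assume "\<exists>L. \<exists>\<sigma>\<in>S. prefix \<sigma> (stake L X)"
    then obtain \<sigma> where "\<sigma> \<in> S" "stake (length \<sigma>) X = \<sigma>" by (auto simp: prefix_stake)
    then show "\<exists>L. stake L X \<in> S" by (intro exI[of _ "length \<sigma>"]) simp
  qed blast
  then show ?thesis unfolding cyl_def by auto
qed

lemma map_stake_szip: "map fst (stake L (szip X1 X2)) = stake L X1" "map snd (stake L (szip X1 X2)) = stake L X2"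
  by simp_all

lemma measure_le_of_sections:
  fixes P1 :: "'a::countable pmf" and P2 :: "'b::countable pmf"
  assumes U: "U \<in> sets (bernoulli (pair_pmf P1 P2))"
    and le: "\<And>X2. emeasure (bernoulli P1) {X1. szip X1 X2 \<in> U} \<le> ennreal c" and c: "0 \<le> c"
  shows "measure (bernoulli (pair_pmf P1 P2)) U \<le> c"
proof -
  interpret B2: prob_space "bernoulli P2" by (rule prob_space_bernoulli)
  have "emeasure (bernoulli (pair_pmf P1 P2)) U \<le> (\<integral>\<^sup>+X2. ennreal c \<partial>bernoulli P2)"
    unfolding emeasure_bernoulli_pair_pmf[OF U] by (rule nn_integral_mono) (rule le)
  also have "\<dots> = ennreal c" using B2.emeasure_space_1 by simp
  finally show ?thesis unfolding measure_def using c by (rule enn2real_leI[rotated])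
qed

lemma mass_le_measure:
  fixes P :: "'a::countable pmf"
  assumes P: "P \<in> prob_spaces_on \<Omega>" and F: "distinct F" "set F \<subseteq> S" and S: "S \<subseteq> lists \<Omega>" "prefix_free S"
  shows "mass P F \<le> measure (bernoulli P) (cyl \<Omega> S)"
proof -
  interpret prob_space "bernoulli P" by (rule prob_space_bernoulli)
  have "emeasure (bernoulli P) (cyl \<Omega> (set F)) = ennreal (mass P F)"
    using F S by (intro emeasure_cyl_eq_mass[OF P] prefix_free_subset[OF S(2)]) auto
  then have "mass P F = measure (bernoulli P) (cyl \<Omega> (set F))"
    using mass_nonneg[of P F] by (simp add: measure_def)
  also have "\<dots> \<le> measure (bernoulli P) (cyl \<Omega> S)"
    by (intro finite_measure_mono cyl_mono F sets_cyl)
  finally show ?thesis .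
qed

text \<open>A test for \<open>\<alpha>2\<close> is a test for the product that ignores the first coordinate; its measure does not
change.\<close>

lemma snd_random_of_product_random:
  fixes \<Omega>1 \<Omega>2 :: "nat set" and P1 P2 :: "nat pmf"
  assumes random: "ml_random (\<Omega>1 \<times> \<Omega>2) (pair_pmf P1 P2) \<beta>s (szip \<alpha>1 \<alpha>2)"
    and \<alpha>: "\<alpha>1 \<in> streams \<Omega>1" "\<alpha>2 \<in> streams \<Omega>2"
  shows "ml_random \<Omega>2 P2 \<beta>s \<alpha>2"
proof (rule ccontr)
  assume "\<not> ml_random \<Omega>2 P2 \<beta>s \<alpha>2"
  from failed_test[OF this] obtain M where M:
    "\<And>n :: nat. 1 \<le> n \<Longrightarrow> prefix_free {\<sigma> \<in> lists \<Omega>2. accepts M \<beta>s (encode (n, \<sigma>))}"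
    "\<And>n :: nat. 1 \<le> n \<Longrightarrow>
      measure (bernoulli P2) (cyl \<Omega>2 {\<sigma> \<in> lists \<Omega>2. accepts M \<beta>s (encode (n, \<sigma>))}) < (1/2) ^ n"
    "\<And>n :: nat. 1 \<le> n \<Longrightarrow> \<exists>L. accepts M \<beta>s (encode (n, stake L \<alpha>2))"
    by blast
  \<comment> \<open>The length of the string bounds the number of steps, the oracle prefixes and the accepted prefix.\<close>
  define R :: "nat \<times> (nat \<times> nat) list \<Rightarrow> bool" where
    "R p \<longleftrightarrow> (\<exists>j\<le>length (snd p). accepts_within M (oracle_prefix \<beta>s (length (snd p))) (length (snd p))
        (encode (fst p, take j (map snd (snd p)))))" for p
  have R_computable: "computable_in \<beta>s R"
    unfolding R_def[abs_def] by (intro computable)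
  have R_small: "measure (bernoulli (pair_pmf P1 P2)) (cyl (\<Omega>1 \<times> \<Omega>2) {\<rho>. R (n, \<rho>)}) < (1/2) ^ n"
    (is "measure _ ?U < _") if n: "1 \<le> n" for n
  proof -
    let ?S = "cyl \<Omega>2 {\<sigma> \<in> lists \<Omega>2. accepts M \<beta>s (encode (n, \<sigma>))}"
    interpret B1: prob_space "bernoulli P1" by (rule prob_space_bernoulli)
    interpret B2: prob_space "bernoulli P2" by (rule prob_space_bernoulli)
    interpret B: prob_space "bernoulli (pair_pmf P1 P2)" by (rule prob_space_bernoulli)
    have S: "X2 \<in> ?S" if "szip X1 X2 \<in> ?U" for X1 X2
    proof -
      from that obtain L j where "X2 \<in> streams \<Omega>2"
        "accepts_within M (oracle_prefix \<beta>s L) L (encode (n, stake (min j L) X2))"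
        by (auto simp: cyl_def R_def szip_in_streams map_stake_szip take_stake)
      then show ?thesis using lists_stake[of X2 \<Omega>2 "min j L"]
        by (auto simp: cyl_def accepts_oracle_prefix)
    qed
    have "emeasure (bernoulli (pair_pmf P1 P2)) ?U
        \<le> (\<integral>\<^sup>+X2. indicator ?S X2 \<partial>bernoulli P2)"
      unfolding emeasure_bernoulli_pair_pmf[OF sets_cyl]
    proof (rule nn_integral_mono)
      fix X2
      show "emeasure (bernoulli P1) {X1. szip X1 X2 \<in> ?U} \<le> indicator ?S X2"
      proof (cases "X2 \<in> ?S")
        case True
        then show ?thesis using B1.emeasure_le_1 by simp
      next
        case False
        then have "{X1. szip X1 X2 \<in> ?U} = {}" using S by blast
        then show ?thesis by simp
      qed
    qed
    also have "\<dots> = emeasure (bernoulli P2) ?S" by (rule nn_integral_indicator) (rule sets_cyl)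
    finally have "measure (bernoulli (pair_pmf P1 P2)) ?U \<le> measure (bernoulli P2) ?S"
      by (simp add: B.emeasure_eq_measure B2.emeasure_eq_measure)
    then show ?thesis using M(2)[OF n] by linarith
  qed
  have "szip \<alpha>1 \<alpha>2 \<in> streams (\<Omega>1 \<times> \<Omega>2)" using \<alpha> by (simp add: szip_in_streams)
  from passes_decidable_test[OF R_computable R_small random this]
  obtain n where n: "1 \<le> n" "\<forall>L. \<not> R (n, stake L (szip \<alpha>1 \<alpha>2))" by blast
  obtain L where "accepts M \<beta>s (encode (n, stake L \<alpha>2))" using M(3)[OF n(1)] by blast
  then obtain s where s: "accepts_within M (oracle_prefix \<beta>s s) s (encode (n, stake L \<alpha>2))"
    unfolding accepts_oracle_prefix by blast
  have "R (n, stake (max s L) (szip \<alpha>1 \<alpha>2))"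
    unfolding R_def fst_conv snd_conv map_stake_szip length_stake
    using accepts_oracle_prefix_mono[OF s, of "max s L"]
    by (intro exI[of _ L]) (simp add: take_stake)
  then show False using n(2) by blast
qed

text \<open>Let a test for \<open>\<alpha>1\<close> use \<open>\<alpha>2\<close> as an oracle. Replacing \<open>\<alpha>2\<close> by the second coordinate \<open>X2\<close> of a variable
pair defines an open set of the product, but for \<open>X2\<close> other than \<open>\<alpha>2\<close> the section may be large. So
level \<open>n + 1\<close> of the test is enumerated only as long as its mass is recognized to be below
\<open>(1/2) ^ (n + 1)\<close>. Then every section has measure at most \<open>(1/2) ^ (n + 1)\<close>, and for \<open>X2 = \<alpha>2\<close> nothing
is lost, because there the strings are prefix-free and their mass is the measure.\<close>

lemma fst_random_of_product_random:
  fixes \<Omega>1 \<Omega>2 :: "nat set" and P1 P2 :: "nat pmf"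
  assumes \<Omega>1: "\<And>a. a \<in> \<Omega>1 \<longleftrightarrow> accepts E [] (encode a)"
    and A: "approximator A \<Omega>1 P1" and P1: "P1 \<in> prob_spaces_on \<Omega>1"
    and random: "ml_random (\<Omega>1 \<times> \<Omega>2) (pair_pmf P1 P2) \<beta>s (szip \<alpha>1 \<alpha>2)"
    and \<alpha>: "\<alpha>1 \<in> streams \<Omega>1" "\<alpha>2 \<in> streams \<Omega>2"
  shows "ml_random \<Omega>1 P1 (\<alpha>2 # \<beta>s) \<alpha>1"
proof (rule ccontr)
  assume "\<not> ml_random \<Omega>1 P1 (\<alpha>2 # \<beta>s) \<alpha>1"
  from failed_test[OF this] obtain M where M:
    "\<And>n :: nat. 1 \<le> n \<Longrightarrow> prefix_free {\<sigma> \<in> lists \<Omega>1. accepts M (\<alpha>2 # \<beta>s) (encode (n, \<sigma>))}"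
    "\<And>n :: nat. 1 \<le> n \<Longrightarrow>
      measure (bernoulli P1) (cyl \<Omega>1 {\<sigma> \<in> lists \<Omega>1. accepts M (\<alpha>2 # \<beta>s) (encode (n, \<sigma>))}) < (1/2) ^ n"
    "\<And>n :: nat. 1 \<le> n \<Longrightarrow> \<exists>L. accepts M (\<alpha>2 # \<beta>s) (encode (n, stake L \<alpha>1))"
    by blast
  \<comment> \<open>\<open>W\<close> works with a finite string for the second coordinate, \<open>V\<close> is the same for a sequence.\<close>
  define W where "W \<tau> n s = enum_stage E
      (\<lambda>s \<sigma>. accepts_within M (take s \<tau> # oracle_prefix \<beta>s s) s (encode (n, \<sigma>))) s" for \<tau> and n s :: nat
  define V where "V X2 n = enum_stage E
      (\<lambda>s \<sigma>. accepts_within M (oracle_prefix (X2 # \<beta>s) s) s (encode (n, \<sigma>)))" for X2 and n :: nat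
  have WV: "W (stake L X2) n s = V X2 n s" if "s \<le> L" for L X2 n s
    using that by (simp add: W_def V_def enum_stage_def take_stake oracle_prefix_Cons min_def)
  have V_lists: "set (V X2 n s) \<subseteq> lists \<Omega>1" for X2 n s
    unfolding V_def by (rule enum_stage_sound[OF \<Omega>1])
  have V_distinct: "distinct (V X2 n s)" for X2 n s
    unfolding V_def by (rule distinct_enum_stage)
  have V_mono: "set (V X2 n s) \<subseteq> set (V X2 n t)" if "s \<le> t" for X2 n s t
    unfolding V_def by (rule enum_stage_mono[OF _ that]) (rule accepts_oracle_prefix_mono)
  define R :: "nat \<times> (nat \<times> nat) list \<Rightarrow> bool" where
    "R p \<longleftrightarrow> (\<exists>s\<le>length (snd p).
        (\<exists>\<sigma>\<in>set (W (map snd (snd p)) (Suc (fst p)) s). prefix \<sigma> (map fst (snd p))) \<and>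
        mass_less A (length (snd p)) (Suc (fst p)) (W (map snd (snd p)) (Suc (fst p)) s))" for p
  have R: "R (n, stake L (szip X1 X2)) \<longleftrightarrow> (\<exists>s\<le>L.
      (\<exists>\<sigma>\<in>set (V X2 (Suc n) s). prefix \<sigma> (stake L X1)) \<and> mass_less A L (Suc n) (V X2 (Suc n) s))"
    for n L X1 X2
    unfolding R_def fst_conv snd_conv map_stake_szip length_stake by (simp add: WV cong: conj_cong)
  have R_computable: "computable_in \<beta>s R"
    unfolding R_def[abs_def] W_def by (intro computable)
  have R_small: "measure (bernoulli (pair_pmf P1 P2)) (cyl (\<Omega>1 \<times> \<Omega>2) {\<rho>. R (n, \<rho>)}) < (1/2) ^ n"
    (is "measure _ ?U < _") for n
  proof -
    have "measure (bernoulli (pair_pmf P1 P2)) ?U \<le> (1/2) ^ Suc n"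
    proof (rule measure_le_of_sections)
      fix X2
      let ?good = "\<lambda>s. mass P1 (V X2 (Suc n) s) \<le> (1/2) ^ Suc n"
      have "X1 \<in> cyl \<Omega>1 (\<Union>s\<in>{s. ?good s}. set (V X2 (Suc n) s))" if X1: "szip X1 X2 \<in> ?U" for X1
      proof -
        obtain L s \<sigma> where *: "X1 \<in> streams \<Omega>1" "\<sigma> \<in> set (V X2 (Suc n) s)" "prefix \<sigma> (stake L X1)"
            "mass_less A L (Suc n) (V X2 (Suc n) s)"
          using X1 by (auto simp: cyl_def szip_in_streams R simp del: stake_szip)
        have "mass P1 (V X2 (Suc n) s) < (1/2) ^ Suc n"
          using mass_less_iff[OF A V_lists] *(4) by blast
        then have "stake (length \<sigma>) X1 \<in> (\<Union>s\<in>{s. ?good s}. set (V X2 (Suc n) s))"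
          using *(2,3) by (intro UN_I[of s]) (simp_all add: prefix_stake)
        with *(1) show ?thesis unfolding cyl_def by blast
      qed
      then have "emeasure (bernoulli P1) {X1. szip X1 X2 \<in> ?U}
          \<le> emeasure (bernoulli P1) (cyl \<Omega>1 (\<Union>s\<in>{s. ?good s}. set (V X2 (Suc n) s)))"
        by (intro emeasure_mono sets_cyl) auto
      also have "\<dots> \<le> ennreal ((1/2) ^ Suc n)"
        by (rule emeasure_stages_le[OF P1 V_distinct V_lists V_mono]) auto
      finally show "emeasure (bernoulli P1) {X1. szip X1 X2 \<in> ?U} \<le> ennreal ((1/2) ^ Suc n)" .
    qed (auto intro: sets_cyl)
    also have "\<dots> < (1/2) ^ n" by simp
    finally show ?thesis .
  qed
  have "szip \<alpha>1 \<alpha>2 \<in> streams (\<Omega>1 \<times> \<Omega>2)" using \<alpha> by (simp add: szip_in_streams)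
  from passes_decidable_test[OF R_computable R_small random this]
  obtain n where n: "1 \<le> n" "\<forall>L. \<not> R (n, stake L (szip \<alpha>1 \<alpha>2))" by blast
  obtain L where "accepts M (\<alpha>2 # \<beta>s) (encode (Suc n, stake L \<alpha>1))" using M(3)[of "Suc n"] by auto
  then obtain s0 where "accepts_within M (oracle_prefix (\<alpha>2 # \<beta>s) s0) s0 (encode (Suc n, stake L \<alpha>1))"
    unfolding accepts_oracle_prefix by blast
  then have s: "accepts_within M (oracle_prefix (\<alpha>2 # \<beta>s) (max s0 (Suc L))) (max s0 (Suc L)) (encode (Suc n, stake L \<alpha>1))"
    by (rule accepts_oracle_prefix_mono) simp
  have "\<exists>t. stake L \<alpha>1 \<in> set (V \<alpha>2 (Suc n) t)"
    unfolding V_def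
  proof (rule enum_stage_complete[OF \<Omega>1, where s = "max s0 (Suc L)"])
    show "accepts_within M (oracle_prefix (\<alpha>2 # \<beta>s) t) t (encode (Suc n, \<sigma>))"
      if "accepts_within M (oracle_prefix (\<alpha>2 # \<beta>s) s) s (encode (Suc n, \<sigma>))" "s \<le> t" for s t \<sigma>
      using that by (rule accepts_oracle_prefix_mono)
  qed (use s lists_stake[OF \<alpha>(1)] in auto)
  then obtain t where t: "stake L \<alpha>1 \<in> set (V \<alpha>2 (Suc n) t)" ..
  let ?S = "{\<sigma> \<in> lists \<Omega>1. accepts M (\<alpha>2 # \<beta>s) (encode (Suc n, \<sigma>))}"
  have "set (V \<alpha>2 (Suc n) t) \<subseteq> ?S"
    using V_lists[of \<alpha>2 "Suc n" t] unfolding V_def accepts_oracle_prefix by (auto dest: enum_stage_acc)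
  then have "mass P1 (V \<alpha>2 (Suc n) t) \<le> measure (bernoulli P1) (cyl \<Omega>1 ?S)"
    by (intro mass_le_measure[OF P1 V_distinct] M(1)) auto
  also have "\<dots> < (1/2) ^ Suc n" using M(2)[of "Suc n"] by simp
  finally obtain u where u: "mass_less A u (Suc n) (V \<alpha>2 (Suc n) t)"
    using mass_less_iff[OF A V_lists] by blast
  define K where "K = max t (max u L)"
  have "R (n, stake K (szip \<alpha>1 \<alpha>2))"
    unfolding R
  proof (intro exI[of _ t] conjI bexI[OF _ t])
    show "t \<le> K" by (simp add: K_def)
    show "prefix (stake L \<alpha>1) (stake K \<alpha>1)" by (simp add: prefix_stake K_def)
    show "mass_less A K (Suc n) (V \<alpha>2 (Suc n) t)"
      by (rule mass_less_mono[OF A u]) (simp add: K_def)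
  qed
  then show False using n(2) by blast
qed


text \<open>Suppose that the pair fails a test with levels \<open>S n\<close>. By Markov's inequality, the set \<open>D m\<close> of those \<open>X2\<close>
for which the section of level \<open>2 * m\<close> has measure above \<open>(1/2) ^ m\<close> has measure at most \<open>(1/2) ^ m\<close>.
These sets are enumerable, since lower bounds on the measure of a section are
semidecidable. As the measures are summable, the random sequence \<open>\<alpha>2\<close> lies outside \<open>D m\<close> for all large
\<open>m\<close>: it passes the test whose level \<open>n\<close> is the union of \<open>D m\<close> over \<open>m > n + 1\<close>. Hence from some level on
the sections at \<open>\<alpha>2\<close> have measure at most \<open>(1/2) ^ m\<close>, and they form a test relative to \<open>\<alpha>2\<close> that \<open>\<alpha>1\<close> fails.\<close>

lemma product_random_of_random:
  fixes \<Omega>1 \<Omega>2 :: "nat set" and P1 P2 :: "nat pmf"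
  assumes \<Omega>1: "\<And>a. a \<in> \<Omega>1 \<longleftrightarrow> accepts E [] (encode a)"
    and A: "approximator A \<Omega>1 P1" and P1: "P1 \<in> prob_spaces_on \<Omega>1"
    and random1: "ml_random \<Omega>1 P1 (\<alpha>2 # \<beta>s) \<alpha>1"
    and random2: "ml_random \<Omega>2 P2 \<beta>s \<alpha>2"
    and \<alpha>: "\<alpha>1 \<in> streams \<Omega>1" "\<alpha>2 \<in> streams \<Omega>2"
  shows "ml_random (\<Omega>1 \<times> \<Omega>2) (pair_pmf P1 P2) \<beta>s (szip \<alpha>1 \<alpha>2)"
proof (rule ccontr)
  interpret B1: prob_space "bernoulli P1" by (rule prob_space_bernoulli)
  interpret B2: prob_space "bernoulli P2" by (rule prob_space_bernoulli)
  interpret B: prob_space "bernoulli (pair_pmf P1 P2)" by (rule prob_space_bernoulli)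
  assume "\<not> ml_random (\<Omega>1 \<times> \<Omega>2) (pair_pmf P1 P2) \<beta>s (szip \<alpha>1 \<alpha>2)"
  from failed_test[OF this] obtain M where M:
    "\<And>n :: nat. 1 \<le> n \<Longrightarrow> prefix_free {\<sigma> \<in> lists (\<Omega>1 \<times> \<Omega>2). accepts M \<beta>s (encode (n, \<sigma>))}"
    "\<And>n :: nat. 1 \<le> n \<Longrightarrow> measure (bernoulli (pair_pmf P1 P2))
      (cyl (\<Omega>1 \<times> \<Omega>2) {\<sigma> \<in> lists (\<Omega>1 \<times> \<Omega>2). accepts M \<beta>s (encode (n, \<sigma>))}) < (1/2) ^ n"
    "\<And>n :: nat. 1 \<le> n \<Longrightarrow> \<exists>L. accepts M \<beta>s (encode (n, stake L (szip \<alpha>1 \<alpha>2)))"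
    by blast
  define S where "S n = {\<sigma> \<in> lists (\<Omega>1 \<times> \<Omega>2). accepts M \<beta>s (encode (n, \<sigma>))}" for n :: nat
  \<comment> \<open>The strings of the section of \<open>S n\<close> found by stage \<open>s\<close>: \<open>G\<close> works with a finite string for the
     second coordinate, \<open>V\<close> is the same for a sequence, and \<open>T\<close> is the limit.\<close>
  define G where "G \<tau> n s = enum_stage E
      (\<lambda>s \<sigma>. accepts_within M (oracle_prefix \<beta>s s) s (encode (n, zip \<sigma> (take s \<tau>)))) s"
    for \<tau> :: "nat list" and n s :: nat
  define V where "V X2 n = enum_stage E
      (\<lambda>s \<sigma>. accepts_within M (oracle_prefix \<beta>s s) s (encode (n, zip \<sigma> (stake s X2))))"
    for X2 :: "nat stream" and n :: nat
  define T where "T X2 n = {\<sigma> \<in> lists \<Omega>1. zip \<sigma> (stake (length \<sigma>) X2) \<in> S n}" for X2 n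
  have GV: "G (stake L X2) n s = V X2 n s" if "s \<le> L" for L X2 n s
    using that by (simp add: G_def V_def enum_stage_def take_stake min_def)
  have zip_stake: "zip \<sigma> (stake s X2) = zip \<sigma> (stake (length \<sigma>) X2)" if "length \<sigma> \<le> s"
    for \<sigma> :: "nat list" and X2 :: "nat stream" and s
    using that by (intro nth_equalityI) auto
  have V_lists: "set (V X2 n s) \<subseteq> lists \<Omega>1" for X2 n s
    unfolding V_def by (rule enum_stage_sound[OF \<Omega>1])
  have V_distinct: "distinct (V X2 n s)" for X2 n s
    unfolding V_def by (rule distinct_enum_stage)
  have V_acc_mono: "accepts_within M (oracle_prefix \<beta>s t) t (encode (n, zip \<sigma> (stake t X2)))"
    if "length \<sigma> < s" "accepts_within M (oracle_prefix \<beta>s s) s (encode (n, zip \<sigma> (stake s X2)))" "s \<le> t"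
    for X2 :: "nat stream" and n s t :: nat and \<sigma> :: "nat list"
    using accepts_oracle_prefix_mono[OF that(2,3)] that(1,3) zip_stake[of \<sigma> s X2] zip_stake[of \<sigma> t X2]
    by simp
  have V_mono: "set (V X2 n s) \<subseteq> set (V X2 n t)" if "s \<le> t" for X2 n s t
    unfolding V_def by (rule enum_stage_mono[OF V_acc_mono that])
  have zip_lists: "zip \<sigma> (stake (length \<sigma>) X2) \<in> lists (\<Omega>1 \<times> \<Omega>2)"
    if "\<sigma> \<in> lists \<Omega>1" "X2 \<in> streams \<Omega>2" for \<sigma> X2
    using that(1) lists_stake[OF that(2), of "length \<sigma>"] by (auto dest: set_zip_leftD set_zip_rightD)
  have V_subset: "set (V X2 n s) \<subseteq> T X2 n" if X2: "X2 \<in> streams \<Omega>2" for X2 n s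
  proof
    fix \<sigma> assume \<sigma>: "\<sigma> \<in> set (V X2 n s)"
    then have "\<sigma> \<in> lists \<Omega>1" "length \<sigma> \<le> s" using V_lists length_enum_stage[of \<sigma>] unfolding V_def by fastforce+
    moreover have "accepts M \<beta>s (encode (n, zip \<sigma> (stake s X2)))"
      using \<sigma> unfolding V_def accepts_oracle_prefix by (auto dest: enum_stage_acc)
    ultimately show "\<sigma> \<in> T X2 n"
      using zip_lists[of \<sigma> X2] X2 zip_stake[of \<sigma> s X2] by (simp add: T_def S_def)
  qed
  have T_prefix_free: "prefix_free (T X2 n)" if "1 \<le> n" for X2 n
    unfolding prefix_free_def
  proof (intro ballI impI)
    fix \<sigma> \<tau> assume *: "\<sigma> \<in> T X2 n" "\<tau> \<in> T X2 n" "prefix \<sigma> \<tau>"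
    have \<sigma>: "\<sigma> = take (length \<sigma>) \<tau>" "length \<sigma> \<le> length \<tau>" using *(3) by (auto simp: prefix_def)
    let ?z = "\<lambda>\<sigma>. zip \<sigma> (stake (length \<sigma>) X2)"
    have "take (length \<sigma>) (?z \<tau>) = zip (take (length \<sigma>) \<tau>) (stake (length \<sigma>) X2)"
      using \<sigma>(2) by (simp add: take_zip take_stake min_def)
    also have "\<dots> = ?z \<sigma>" using \<sigma>(1) by simp
    finally have "prefix (?z \<sigma>) (?z \<tau>)" by (metis take_is_prefix)
    then have "?z \<sigma> = ?z \<tau>" using * M(1)[OF that] unfolding prefix_free_def T_def S_def by blast
    then have "length (?z \<sigma>) = length (?z \<tau>)" by (rule arg_cong)
    then show "\<sigma> = \<tau>" using \<sigma> by simp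
  qed
  have T_section: "cyl \<Omega>1 (T X2 n) \<subseteq> {X1. szip X1 X2 \<in> cyl (\<Omega>1 \<times> \<Omega>2) (S n)}"
    if X2: "X2 \<in> streams \<Omega>2" for X2 n
  proof
    fix X1 assume "X1 \<in> cyl \<Omega>1 (T X2 n)"
    then obtain L where "X1 \<in> streams \<Omega>1" "zip (stake L X1) (stake L X2) \<in> S n"
      by (auto simp: cyl_def T_def)
    with X2 show "X1 \<in> {X1. szip X1 X2 \<in> cyl (\<Omega>1 \<times> \<Omega>2) (S n)}"
      by (auto simp: cyl_def szip_in_streams)
  qed
  \<comment> \<open>Using the length of \<open>\<tau>\<close> as the stage shows \<open>D m\<close> to be open.\<close>
  define D where "D m = cyl \<Omega>2 {\<tau>. (1/2) ^ m < mass P1 (G \<tau> (2 * m) (length \<tau>))}" for m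
  have D_iff: "X2 \<in> D m \<longleftrightarrow> X2 \<in> streams \<Omega>2 \<and> (\<exists>s. (1/2) ^ m < mass P1 (V X2 (2 * m) s))" for X2 m
    by (simp add: D_def cyl_def GV)
  have D_small: "emeasure (bernoulli P2) (D m) \<le> ennreal ((1/2) ^ m)" if m: "1 \<le> m" for m
  proof -
    let ?U = "cyl (\<Omega>1 \<times> \<Omega>2) (S (2 * m))"
    let ?u = "\<lambda>X2. emeasure (bernoulli P1) {X1. szip X1 X2 \<in> ?U}"
    have "1 \<le> ennreal (2 ^ m) * ?u X2" if D: "X2 \<in> D m" for X2
    proof -
      obtain s where X2: "X2 \<in> streams \<Omega>2" "(1/2) ^ m < mass P1 (V X2 (2 * m) s)"
        using D unfolding D_iff by blast
      have "mass P1 (V X2 (2 * m) s) \<le> measure (bernoulli P1) (cyl \<Omega>1 (T X2 (2 * m)))"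
        by (intro mass_le_measure[OF P1 V_distinct V_subset[OF X2(1)]] T_prefix_free)
          (use m in \<open>auto simp: T_def\<close>)
      also have "\<dots> \<le> measure (bernoulli P1) {X1. szip X1 X2 \<in> ?U}"
        by (intro B1.finite_measure_mono T_section X2 sections_measurable sets_cyl)
      finally have "ennreal ((1/2) ^ m) \<le> ?u X2"
        unfolding B1.emeasure_eq_measure using X2(2) by (intro ennreal_leI) linarith
      then have "ennreal (2 ^ m) * ennreal ((1/2) ^ m) \<le> ennreal (2 ^ m) * ?u X2"
        by (rule mult_left_mono) simp
      then show ?thesis by (simp add: ennreal_mult[symmetric] power_mult_distrib[symmetric])
    qed
    then have "D m \<subseteq> {X2 \<in> UNIV. 1 \<le> ennreal (2 ^ m) * ?u X2}" by auto
    moreover have u: "?u \<in> borel_measurable (bernoulli P2)"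
      by (rule measurable_emeasure_sections) (rule sets_cyl)
    have "{X2 \<in> space (bernoulli P2). 1 \<le> ennreal (2 ^ m) * ?u X2} \<in> sets (bernoulli P2)"
      using u by (intro borel_measurable_le) auto
    ultimately have "emeasure (bernoulli P2) (D m)
        \<le> emeasure (bernoulli P2) {X2 \<in> UNIV. 1 \<le> ennreal (2 ^ m) * ?u X2}"
      by (intro emeasure_mono) auto
    also have "\<dots> \<le> ennreal (2 ^ m) * (\<integral>\<^sup>+X2. ?u X2 * indicator UNIV X2 \<partial>bernoulli P2)"
      using u sets.top[of "bernoulli P2"] by (intro nn_integral_Markov_inequality) auto
    also have "\<dots> = ennreal (2 ^ m) * emeasure (bernoulli (pair_pmf P1 P2)) ?U"
      by (simp add: emeasure_bernoulli_pair_pmf[OF sets_cyl])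
    also have "\<dots> \<le> ennreal (2 ^ m) * ennreal ((1/2) ^ (2 * m))"
      unfolding B.emeasure_eq_measure S_def
      using M(2)[of "2 * m"] m by (intro mult_left_mono ennreal_leI) auto
    also have "\<dots> = ennreal ((1/2) ^ m)"
      by (simp add: ennreal_mult[symmetric] mult_2 power_add power_mult_distrib[symmetric] mult.assoc[symmetric])
    finally show ?thesis .
  qed
  \<comment> \<open>From \<open>m > n + 1\<close> the measures sum to \<open>(1/2) ^ (n + 1)\<close>, strictly below the bound for level \<open>n\<close>.\<close>
  define R2 :: "nat \<times> nat list \<Rightarrow> bool" where
    "R2 p \<longleftrightarrow> (\<exists>m\<le>length (snd p). fst p + 1 < m \<and>
      (\<exists>s\<le>length (snd p). mass_greater A (length (snd p)) m (G (snd p) (2 * m) s)))" for p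
  have R2: "R2 (n, stake L X2) \<longleftrightarrow>
      (\<exists>m\<le>L. n + 1 < m \<and> (\<exists>s\<le>L. mass_greater A L m (V X2 (2 * m) s)))" for n L X2
    unfolding R2_def fst_conv snd_conv length_stake by (simp add: GV cong: conj_cong)
  have R2_computable: "computable_in \<beta>s R2"
    unfolding R2_def[abs_def] G_def by (intro computable)
  have R2_small: "measure (bernoulli P2) (cyl \<Omega>2 {\<tau>. R2 (n, \<tau>)}) < (1/2) ^ n" for n
  proof -
    have "cyl \<Omega>2 {\<tau>. R2 (n, \<tau>)} \<subseteq> (\<Union>i. D (i + (n + 2)))"
    proof
      fix X2 assume "X2 \<in> cyl \<Omega>2 {\<tau>. R2 (n, \<tau>)}"
      then obtain L m s where *: "X2 \<in> streams \<Omega>2" "n + 1 < m" "mass_greater A L m (V X2 (2 * m) s)"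
        by (auto simp: cyl_def R2)
      then have "X2 \<in> D m" unfolding D_iff using mass_greater_iff[OF A V_lists] by blast
      moreover have "m = (m - (n + 2)) + (n + 2)" using *(2) by simp
      ultimately show "X2 \<in> (\<Union>i. D (i + (n + 2)))" by (metis UNIV_I UN_I)
    qed
    then have "emeasure (bernoulli P2) (cyl \<Omega>2 {\<tau>. R2 (n, \<tau>)}) \<le> emeasure (bernoulli P2) (\<Union>i. D (i + (n + 2)))"
      by (intro emeasure_mono) (auto simp: D_def intro: sets_cyl)
    also have "\<dots> \<le> (\<Sum>i. emeasure (bernoulli P2) (D (i + (n + 2))))"
      by (rule emeasure_subadditive_countably) (auto simp: D_def intro: sets_cyl)
    also have "\<dots> \<le> (\<Sum>i. ennreal ((1/2) ^ (i + (n + 2))))"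
      by (intro suminf_le D_small) auto
    also have "\<dots> = ennreal (\<Sum>i. (1/2) ^ (i + (n + 2)))"
      by (rule suminf_ennreal2) (auto simp: power_add intro!: summable_mult2 summable_geometric)
    also have "(\<Sum>i. (1/2) ^ (i + (n + 2)) :: real) = (1/2) ^ Suc n"
      using suminf_mult2[OF summable_geometric[of "1/2 :: real"], of "(1/2) ^ (n + 2)"]
      by (simp add: suminf_geometric power_add)
    finally have "measure (bernoulli P2) (cyl \<Omega>2 {\<tau>. R2 (n, \<tau>)}) \<le> (1/2) ^ Suc n"
      by (simp add: B2.emeasure_eq_measure)
    also have "\<dots> < (1/2) ^ n" by simp
    finally show ?thesis .
  qed
  from passes_decidable_test[OF R2_computable R2_small random2 \<alpha>(2)]
  obtain n where n: "\<forall>L. \<not> R2 (n, stake L \<alpha>2)" by blast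
  have small: "mass P1 (V \<alpha>2 (2 * m) s) \<le> (1/2) ^ m" if m: "n + 1 < m" for m s
  proof (rule ccontr)
    assume "\<not> mass P1 (V \<alpha>2 (2 * m) s) \<le> (1/2) ^ m"
    then obtain u where u: "mass_greater A u m (V \<alpha>2 (2 * m) s)"
      using mass_greater_iff[OF A V_lists, of m \<alpha>2 "2 * m" s] by auto
    define L where "L = max m (max s u)"
    have "mass_greater A L m (V \<alpha>2 (2 * m) s)" by (rule mass_greater_mono[OF A u]) (simp add: L_def)
    then have "R2 (n, stake L \<alpha>2)"
      unfolding R2 using m by (intro exI[of _ m] conjI exI[of _ s]) (auto simp: L_def)
    then show False using n by blast
  qed
  \<comment> \<open>For level \<open>j\<close> the index \<open>m = j + n + 2\<close> satisfies both \<open>n + 1 < m\<close> and \<open>j < m\<close>.\<close>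
  define R1 :: "nat \<times> nat list \<Rightarrow> bool" where
    "R1 p \<longleftrightarrow> (\<exists>s\<le>length (snd p). \<exists>\<sigma>\<in>set (V \<alpha>2 (2 * (fst p + n + 2)) s). prefix \<sigma> (snd p))" for p
  have R1_computable: "computable_in (\<alpha>2 # \<beta>s) R1"
    unfolding R1_def[abs_def] V_def
    by (intro computable computable_oracle_prefix_tl computable_oracle_prefix_hd)
  have R1_small: "measure (bernoulli P1) (cyl \<Omega>1 {\<sigma>. R1 (j, \<sigma>)}) < (1/2) ^ j" for j
  proof -
    let ?m = "j + n + 2"
    have "cyl \<Omega>1 {\<sigma>. R1 (j, \<sigma>)} \<subseteq> cyl \<Omega>1 {\<tau>. \<exists>\<sigma>\<in>(\<Union>s\<in>{s. True}. set (V \<alpha>2 (2 * ?m) s)). prefix \<sigma> \<tau>}"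
      by (rule cyl_mono) (auto simp: R1_def)
    then have "emeasure (bernoulli P1) (cyl \<Omega>1 {\<sigma>. R1 (j, \<sigma>)})
        \<le> emeasure (bernoulli P1) (cyl \<Omega>1 (\<Union>s\<in>{s. True}. set (V \<alpha>2 (2 * ?m) s)))"
      unfolding cyl_extensions by (rule emeasure_mono) (rule sets_cyl)
    also have "\<dots> \<le> ennreal ((1/2) ^ ?m)"
      by (rule emeasure_stages_le[OF P1 V_distinct V_lists V_mono small]) auto
    finally have "measure (bernoulli P1) (cyl \<Omega>1 {\<sigma>. R1 (j, \<sigma>)}) \<le> (1/2) ^ ?m"
      by (simp add: B1.emeasure_eq_measure)
    also have "\<dots> < (1/2) ^ j" by (rule power_strict_decreasing) auto
    finally show ?thesis .
  qed
  from passes_decidable_test[OF R1_computable R1_small random1 \<alpha>(1)]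
  obtain j where j: "\<forall>L. \<not> R1 (j, stake L \<alpha>1)" by blast
  let ?n = "2 * (j + n + 2)"
  obtain L where "accepts M \<beta>s (encode (?n, stake L (szip \<alpha>1 \<alpha>2)))" using M(3)[of ?n] by auto
  then obtain s0 where s0: "accepts_within M (oracle_prefix \<beta>s s0) s0 (encode (?n, zip (stake L \<alpha>1) (stake L \<alpha>2)))"
    unfolding accepts_oracle_prefix by auto
  define s where "s = max s0 (Suc L)"
  have s: "accepts_within M (oracle_prefix \<beta>s s) s (encode (?n, zip (stake L \<alpha>1) (stake s \<alpha>2)))"
    using accepts_oracle_prefix_mono[OF s0, of s] zip_stake[of "stake L \<alpha>1" s \<alpha>2] by (simp add: s_def)
  have "\<exists>t. stake L \<alpha>1 \<in> set (V \<alpha>2 ?n t)"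
    unfolding V_def
  proof (rule enum_stage_complete[OF \<Omega>1, where s = s])
    show "accepts_within M (oracle_prefix \<beta>s t) t (encode (?n, zip \<sigma> (stake t \<alpha>2)))"
      if "length \<sigma> < s" "accepts_within M (oracle_prefix \<beta>s s) s (encode (?n, zip \<sigma> (stake s \<alpha>2)))" "s \<le> t"
      for s t and \<sigma> :: "nat list"
      using that by (rule V_acc_mono)
  qed (use s lists_stake[OF \<alpha>(1)] in \<open>simp_all add: s_def\<close>)
  then obtain t where t: "stake L \<alpha>1 \<in> set (V \<alpha>2 ?n t)" ..
  have "R1 (j, stake (max t L) \<alpha>1)"
    unfolding R1_def fst_conv snd_conv length_stake
    by (intro exI[of _ t] conjI bexI[OF _ t]) (auto simp: prefix_stake)
  then show False using j by blast
qed

theorem theorem53: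
  fixes \<Omega>1 \<Omega>2 :: "nat set" and P1 P2 :: "nat pmf"
    and \<alpha>1 \<alpha>2 :: "nat stream" and \<beta>s :: "nat stream list"
  assumes "re_infinite \<Omega>1" and "re_infinite \<Omega>2"
    and "P1 \<in> prob_spaces_on \<Omega>1" and "P2 \<in> prob_spaces_on \<Omega>2"
    and "\<alpha>1 \<in> streams \<Omega>1" and "\<alpha>2 \<in> streams \<Omega>2"
    and "\<forall>k<length \<beta>s. \<exists>\<Theta>. re_infinite \<Theta> \<and> \<beta>s ! k \<in> streams \<Theta>"
    and "computable_pmf \<Omega>1 P1"
  shows "ml_random (\<Omega>1 \<times> \<Omega>2) (pair_pmf P1 P2) \<beta>s (szip \<alpha>1 \<alpha>2) \<longleftrightarrow>
    ml_random \<Omega>1 P1 (\<alpha>2 # \<beta>s) \<alpha>1 \<and> ml_random \<Omega>2 P2 \<beta>s \<alpha>2"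
proof -
  obtain E where E: "\<And>a. a \<in> \<Omega>1 \<longleftrightarrow> accepts E [] (encode a)"
    using assms(1) unfolding re_infinite_def recursively_enumerable_def by blast
  obtain A where A: "approximator A \<Omega>1 P1" using approximator_exists[OF assms(8)] ..
  show ?thesis
    using fst_random_of_product_random[OF E A assms(3) _ assms(5,6)]
      snd_random_of_product_random[OF _ assms(5,6)]
      product_random_of_random[OF E A assms(3) _ _ assms(5,6)]
    by blast
qed

end
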